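(* Let $n \ge 4$, and let $F \in \mathbb{Z}[X_1,\ldots,X_n]$ be an $r$-irreducible homogeneous polynomial of degree $d$, for an integer $r \ge 1$. Then there exists a hypersurface $W \subset (\mathbb{P}^{n-1}_{\mathbb{Q}})^*$ of degree at most $O_n(d^{3})$ (i.e. at most $C d^3$ with $C$ depending only on $n$) such that if $\ell \notin W$ is a $\mathbb{Q}$-linear form, then $F|_{\{\ell=0\}}$ is $r$-irreducible over $\mathbb{Q}$.
   Context: $(\mathbb{P}^{n-1}_{\mathbb{Q}})^*$ is the dual space of $\mathbb{P}^{n-1}_{\mathbb{Q}}$, which parametrizes hyperplanes in $\mathbb{A}^n_{\mathbb{Q}}$ through the origin; its elements are identified with nonzero linear forms in $n$ variables up to a scalar. A polynomial over $\mathbb{Q}$ is $r$-irreducible if it has no (non-constant) factors of degree $\le r$ over $\mathbb{Q}$. The restriction $F|_{\{\ell=0\}}$ is regarded as a polynomial in $n-1$ variables by choosing linear coordinates over $\mathbb{Q}$ on the hyperplane $\{\ell=0\}$. *)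

theory Defs
  imports "HOL-Library.Poly_Mapping" "Jordan_Normal_Form.Matrix"
begin

text \<open>
  A polynomial is a finitely supported map from exponent vectors to coefficients, with the
  ring structure of \<open>Poly_Mapping\<close>.  Variables are numbered from 0, so the polynomials in
  \<open>n\<close> variables are those in which only the variables \<open>0, ..., n - 1\<close> occur.
\<close>

type_synonym 'a mpoly = "(nat \<Rightarrow>\<^sub>0 nat) \<Rightarrow>\<^sub>0 'a"

definition polys :: "nat \<Rightarrow> 'a::zero mpoly set" where
  "polys n = {p. \<forall>m \<in> Poly_Mapping.keys p. Poly_Mapping.keys m \<subseteq> {..<n}}"

definition monom_degree :: "(nat \<Rightarrow>\<^sub>0 nat) \<Rightarrow> nat" where
  "monom_degree m = (\<Sum>i \<in> Poly_Mapping.keys m. Poly_Mapping.lookup m i)"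

text \<open>The total degree; it is 0 for the zero polynomial.\<close>

definition total_degree :: "'a::zero mpoly \<Rightarrow> nat" where
  "total_degree p = Max (insert 0 (monom_degree ` Poly_Mapping.keys p))"

definition homogeneous :: "nat \<Rightarrow> 'a::zero mpoly \<Rightarrow> bool" where
  "homogeneous d p \<longleftrightarrow> (\<forall>m \<in> Poly_Mapping.keys p. monom_degree m = d)"

text \<open>
  The value of \<open>p\<close> at \<open>x\<close>, where \<open>h\<close> embeds the coefficients into the target ring
  (\<open>id\<close> for ordinary evaluation, the embedding of constants for substitution of polynomials).
\<close>

definition mpoly_eval :: "('a::zero \<Rightarrow> 'b::comm_semiring_1) \<Rightarrow> (nat \<Rightarrow> 'b) \<Rightarrow> 'a mpoly \<Rightarrow> 'b" where
  "mpoly_eval h x p = (\<Sum>m \<in> Poly_Mapping.keys p. h (Poly_Mapping.lookup p m) *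
     (\<Prod>i \<in> Poly_Mapping.keys m. x i ^ Poly_Mapping.lookup m i))"

definition const_poly :: "'a::zero \<Rightarrow> 'a mpoly" where
  "const_poly c = Poly_Mapping.single 0 c"

definition var_poly :: "nat \<Rightarrow> 'a::zero_neq_one mpoly" where
  "var_poly i = Poly_Mapping.single (Poly_Mapping.single i 1) 1"

definition rat_poly :: "int mpoly \<Rightarrow> rat mpoly" where
  "rat_poly F = Poly_Mapping.map rat_of_int F"

text \<open>
  For \<open>r \<ge> 1\<close> and \<open>n \<ge> 1\<close> the zero polynomial is not \<open>r\<close>-irreducible (a variable divides it),
  whereas a nonzero constant is.
\<close>

definition r_irreducible :: "nat \<Rightarrow> nat \<Rightarrow> rat mpoly \<Rightarrow> bool" where
  "r_irreducible n r p \<longleftrightarrow>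
     \<not> (\<exists>g \<in> polys n. \<exists>q \<in> polys n. p = g * q \<and> 1 \<le> total_degree g \<and> total_degree g \<le> r)"

text \<open>
  A point of the dual projective space is represented by a nonzero linear form, given by its
  vector of coefficients.  Proportional vectors represent the same point; every condition
  imposed on such vectors below is invariant under nonzero scaling.
\<close>

definition dual_points :: "nat \<Rightarrow> rat vec set" where
  "dual_points n = carrier_vec n - {0\<^sub>v n}"

text \<open>
  A hypersurface of degree \<open>D\<close> defined over the rationals is given by its equation, a nonzero
  form of degree \<open>D\<close> in the dual coordinates.  (For \<open>D = 0\<close> it is empty.)
\<close>

definition dual_hypersurface :: "nat \<Rightarrow> nat \<Rightarrow> rat mpoly \<Rightarrow> bool" where
  "dual_hypersurface n D W \<longleftrightarrow> W \<in> polys n \<and> homogeneous D W \<and> W \<noteq> 0"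

definition rational_points :: "nat \<Rightarrow> rat mpoly \<Rightarrow> rat vec set" where
  "rational_points n W = {l \<in> dual_points n. mpoly_eval id (\<lambda>i. l $ i) W = 0}"

definition hyperplane :: "nat \<Rightarrow> rat vec \<Rightarrow> rat vec set" where
  "hyperplane n l = {x \<in> carrier_vec n. l \<bullet> x = 0}"

text \<open>A choice of linear coordinates on the hyperplane: a linear isomorphism onto it.\<close>

definition linear_coords :: "nat \<Rightarrow> rat vec \<Rightarrow> rat mat \<Rightarrow> bool" where
  "linear_coords n l A \<longleftrightarrow> A \<in> carrier_mat n (n - 1) \<and>
     bij_betw (\<lambda>y. A *\<^sub>v y) (carrier_vec (n - 1)) (hyperplane n l)"

text \<open>
  The restriction in these coordinates: substitute for the \<open>i\<close>-th variable the linear form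
  in \<open>n - 1\<close> variables given by the \<open>i\<close>-th row of the matrix.
\<close>

definition restrict_poly :: "rat mat \<Rightarrow> rat mpoly \<Rightarrow> rat mpoly" where
  "restrict_poly A p =
     mpoly_eval const_poly (\<lambda>i. \<Sum>j < dim_col A. const_poly (A $$ (i, j)) * var_poly j) p"

definition restriction_r_irreducible :: "nat \<Rightarrow> nat \<Rightarrow> rat vec \<Rightarrow> rat mpoly \<Rightarrow> bool" where
  "restriction_r_irreducible n r l p \<longleftrightarrow>
     (\<forall>A. linear_coords n l A \<longrightarrow> r_irreducible (n - 1) r (restrict_poly A p))"

text \<open>
  Linear coordinates always exist, so that the previous definition is not vacuous: if the
  \<open>k\<close>-th coefficient of the form is nonzero, one can solve for the \<open>k\<close>-th variable.
\<close>

lemma linear_coords_exist: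
  assumes "l \<in> dual_points n"
  shows "\<exists>A. linear_coords n l A"
proof -
  have l: "l \<in> carrier_vec n" "l \<noteq> 0\<^sub>v n" using assms by (auto simp: dual_points_def)
  then obtain k where k: "k < n" "l $ k \<noteq> 0"
    by (metis carrier_vecD eq_vecI index_zero_vec)
  define s where "s j = (if j < k then j else Suc j)" for j :: nat
  define A where "A = mat n (n - 1) (\<lambda>(i, j).
    if i = k then - l $ s j / l $ k else if i = s j then 1 else 0)"
  have A: "A \<in> carrier_mat n (n - 1)" by (simp add: A_def)
  have s_inj: "s i = s j \<longleftrightarrow> i = j" for i j by (auto simp: s_def split: if_splits)
  have s_bij: "bij_betw s {..<n - 1} ({..<n} - {k})"
  proof (rule bij_betw_imageI)
    show "inj_on s {..<n - 1}" by (auto simp: inj_on_def s_inj)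
    show "s ` {..<n - 1} = {..<n} - {k}"
    proof (intro equalityI subsetI)
      fix i assume i: "i \<in> {..<n} - {k}"
      show "i \<in> s ` {..<n - 1}"
      proof (cases "i < k")
        case True
        then show ?thesis using k by (intro image_eqI[of _ _ i]) (auto simp: s_def)
      next
        case False
        then show ?thesis using i by (intro image_eqI[of _ _ "i - 1"]) (auto simp: s_def)
      qed
    qed (use k in \<open>auto simp: s_def\<close>)
  qed
  have s_lt: "s j < n" "s j \<noteq> k" if "j < n - 1" for j
    using s_bij that by (auto simp: bij_betw_def)
  have Ay_s: "(A *\<^sub>v y) $ s j = y $ j" if "y \<in> carrier_vec (n - 1)" "j < n - 1" for y j
  proof -
    have "(A *\<^sub>v y) $ s j = (\<Sum>i<n - 1. (if j = i then 1 else 0) * y $ i)"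
      using that s_lt[OF that(2)]
      by (auto simp: A_def scalar_prod_def s_inj lessThan_atLeast0 intro!: sum.cong)
    also have "\<dots> = (\<Sum>i<n - 1. if j = i then y $ i else 0)" by (intro sum.cong) auto
    finally show ?thesis using that by simp
  qed
  have Ay_k: "(A *\<^sub>v y) $ k = - (\<Sum>j<n - 1. l $ s j * y $ j) / l $ k"
    if "y \<in> carrier_vec (n - 1)" for y
    using that k by (auto simp: A_def scalar_prod_def lessThan_atLeast0 sum_divide_distrib
        sum_negf[symmetric] intro!: sum.cong)
  have dot: "l \<bullet> x = l $ k * x $ k + (\<Sum>j<n - 1. l $ s j * x $ s j)"
    if "x \<in> carrier_vec n" for x
  proof -
    have "l \<bullet> x = (\<Sum>i<n. l $ i * x $ i)"
      using that by (simp add: scalar_prod_def lessThan_atLeast0)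
    also have "\<dots> = l $ k * x $ k + (\<Sum>i\<in>{..<n} - {k}. l $ i * x $ i)"
      using k by (subst sum.remove[of _ k]) auto
    also have "(\<Sum>i\<in>{..<n} - {k}. l $ i * x $ i) = (\<Sum>j<n - 1. l $ s j * x $ s j)"
      using sum.reindex_bij_betw[OF s_bij, of "\<lambda>i. l $ i * x $ i"] by simp
    finally show ?thesis .
  qed
  have "bij_betw (\<lambda>y. A *\<^sub>v y) (carrier_vec (n - 1)) (hyperplane n l)"
  proof (rule bij_betw_byWitness[where f' = "\<lambda>x. vec (n - 1) (\<lambda>j. x $ s j)"])
    show "\<forall>y\<in>carrier_vec (n - 1). vec (n - 1) (\<lambda>j. (A *\<^sub>v y) $ s j) = y"
      by (auto intro!: eq_vecI simp: Ay_s)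
    show "\<forall>x\<in>hyperplane n l. A *\<^sub>v vec (n - 1) (\<lambda>j. x $ s j) = x"
    proof
      fix x assume "x \<in> hyperplane n l"
      then have x: "x \<in> carrier_vec n" "l \<bullet> x = 0" by (auto simp: hyperplane_def)
      let ?y = "vec (n - 1) (\<lambda>j. x $ s j)"
      show "A *\<^sub>v ?y = x"
      proof (rule eq_vecI)
        fix i assume "i < dim_vec x"
        then have i: "i < n" using x by simp
        show "(A *\<^sub>v ?y) $ i = x $ i"
        proof (cases "i = k")
          case True
          have "(A *\<^sub>v ?y) $ k = - (\<Sum>j<n - 1. l $ s j * x $ s j) / l $ k"
            by (subst Ay_k) auto
          also have "\<dots> = x $ k" using dot[OF x(1)] x(2) k by (simp add: field_simps)
          finally show ?thesis using True by simp
        next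
          case False
          then obtain j where "j < n - 1" "i = s j" using i s_bij by (auto simp: bij_betw_def)
          then show ?thesis using Ay_s[of ?y j] by simp
        qed
      qed (use A x in auto)
    qed
    show "(\<lambda>y. A *\<^sub>v y) ` carrier_vec (n - 1) \<subseteq> hyperplane n l"
    proof clarify
      fix y :: "rat vec" assume y: "y \<in> carrier_vec (n - 1)"
      have c: "A *\<^sub>v y \<in> carrier_vec n" using A y by simp
      have "l \<bullet> (A *\<^sub>v y) = 0"
        unfolding dot[OF c] Ay_k[OF y] using k by (simp add: Ay_s[OF y])
      then show "A *\<^sub>v y \<in> hyperplane n l" using c by (simp add: hyperplane_def)
    qed
    show "(\<lambda>x. vec (n - 1) (\<lambda>j. x $ s j)) ` hyperplane n l \<subseteq> carrier_vec (n - 1)" by auto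
  qed
  then show ?thesis using A unfolding linear_coords_def by blast
qed

end

theory Submission
  imports Defs "Jordan_Normal_Form.Char_Poly" "HOL-Computational_Algebra.Field_as_Ring"
begin

text \<open>
  Write \<open>F = c \<Prod> H\<close> with \<open>H\<close> irreducible over the complex numbers, and restrict to planes
  \<open>P + x u + y v\<close>. Following Ruppert and Gao, a plane curve \<open>f = 0\<close> of degree \<open>d\<close> is irreducible as
  soon as the only closed 1-forms \<open>(g dx + h dy) / f\<close> with \<open>g\<close>, \<open>h\<close> in a box of size \<open>O(d\<^sup>2)\<close> are the
  multiples of \<open>df / f\<close>. This is a linear system of size \<open>O(d\<^sup>2)\<close> whose entries have degree \<open>d\<close> in
  \<open>(P, u, v)\<close>, so its failure is governed by a determinant of degree \<open>O(d\<^sup>3)\<close>. The determinant is not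
  identically zero: for a smooth point \<open>P\<close> of \<open>H = 0\<close> and indeterminate \<open>v\<close>, the restriction of \<open>H\<close> is
  prime, and along the branch through \<open>P\<close> the ratio \<open>g / f\<^sub>x\<close> is constant, because its derivative
  vanishes.

  If all \<open>H\<close> stay irreducible and pairwise non-proportional on a rational plane, a rational factor \<open>g\<close> of
  the restriction of \<open>F\<close>, taken irreducible over the rationals and of multiplicity \<open>m\<close>, lifts to a factor
  \<open>G\<close> with \<open>F = G\<^sup>m Q\<close> over the complex numbers. Expanding in a direction transversal to the plane as in
  Hensel's lemma shows that \<open>G\<close> is rational. So small factors on the hyperplane come from small factors
  of \<open>F\<close>. Finally, \<open>P\<close>, \<open>u\<close>, \<open>v\<close> are chosen as linear functions of \<open>l\<close> with values in the hyperplane \<open>l\<close>;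
  such functions take a given value \<open>(P\<^sub>0, u\<^sub>0, v\<^sub>0)\<close> at some \<open>l\<close>, as three vectors lie on a hyperplane
  when \<open>n \<ge> 4\<close>.
\<close>

subsection \<open>Polynomials in several variables\<close>

text \<open>The hypothesis concerns factors over Q, but irreducibility of a curve becomes a linear
  problem only over C, where \<open>F\<close> may split even if it is irreducible over Q. So what is
  transported is not irreducibility of \<open>F\<close> but its whole factorization over C: factors
  on the plane lift uniquely, and rationality is recovered afterwards. A Q-linear map from C to Q
  that fixes Q plays the role of the Galois action; being additive is enough, since the equations to
  be descended are linear with unique solution. The determinant is useful only if some plane makes
  the system injective, and no such plane can be written down. It is found by treating
  \<open>v\<close> as an indeterminate: X = P + x u + y v can be solved for \<open>v\<close> once y
  is invertible, so the restriction inherits primality from \<open>H\<close>. The final constant 7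
  is 4 + 2 + 1: at most \<open>4 * d ^ 3\<close> from the determinants of all factors together, at
  most \<open>2 * d ^ 3\<close> for keeping the factors pairwise non-proportional, and
  \<open>d\<close> for \<open>F\<close> not vanishing at \<open>u\<close>, which keeps degrees from
  dropping on the plane.\<close>

lemma poly_mapping_sum_monomials:
  "(\<Sum>m \<in> Poly_Mapping.keys p. Poly_Mapping.single m (Poly_Mapping.lookup p m)) = p"
proof (rule poly_mapping_eqI)
  fix k
  have "(\<Sum>m \<in> Poly_Mapping.keys p. if m = k then Poly_Mapping.lookup p k else 0) = Poly_Mapping.lookup p k"
    by (simp add: in_keys_iff)
  moreover have "(\<Sum>m \<in> Poly_Mapping.keys p. if m = k then Poly_Mapping.lookup p k else 0) =
      (\<Sum>m \<in> Poly_Mapping.keys p. Poly_Mapping.lookup (Poly_Mapping.single m (Poly_Mapping.lookup p m)) k)"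
    by (intro sum.cong) (auto simp: lookup_single when_def)
  ultimately show "Poly_Mapping.lookup (\<Sum>m \<in> Poly_Mapping.keys p.
      Poly_Mapping.single m (Poly_Mapping.lookup p m)) k = Poly_Mapping.lookup p k"
    by (simp add: lookup_sum)
qed

definition monom_val :: "(nat \<Rightarrow> 'b::comm_semiring_1) \<Rightarrow> (nat \<Rightarrow>\<^sub>0 nat) \<Rightarrow> 'b" where
  "monom_val x m = (\<Prod>i \<in> Poly_Mapping.keys m. x i ^ Poly_Mapping.lookup m i)"

lemma monom_val_superset:
  assumes "finite S" "Poly_Mapping.keys m \<subseteq> S"
  shows "monom_val x m = (\<Prod>i \<in> S. x i ^ Poly_Mapping.lookup m i)"
  unfolding monom_val_def using assms
  by (intro prod.mono_neutral_left) (auto simp: in_keys_iff)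

lemma monom_val_add: "monom_val x (a + b) = monom_val x a * monom_val x b"
proof -
  let ?S = "Poly_Mapping.keys a \<union> Poly_Mapping.keys b"
  have "Poly_Mapping.keys (a + b) \<subseteq> ?S" by (rule Poly_Mapping.keys_add)
  then show ?thesis
    by (simp add: monom_val_superset[of ?S] lookup_add power_add prod.distrib)
qed

lemma monom_val_0 [simp]: "monom_val x 0 = 1"
  by (simp add: monom_val_def)

lemma mpoly_eval_altdef:
  "mpoly_eval h x p = (\<Sum>m \<in> Poly_Mapping.keys p. h (Poly_Mapping.lookup p m) * monom_val x m)"
  by (simp add: mpoly_eval_def monom_val_def)

lemma mpoly_eval_superset:
  assumes "finite S" "Poly_Mapping.keys p \<subseteq> S" "h 0 = 0"
  shows "mpoly_eval h x p = (\<Sum>m \<in> S. h (Poly_Mapping.lookup p m) * monom_val x m)"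
  unfolding mpoly_eval_altdef using assms
  by (intro sum.mono_neutral_left) (auto simp: in_keys_iff)

lemma mpoly_eval_single: "h 0 = 0 \<Longrightarrow> mpoly_eval h x (Poly_Mapping.single m c) = h c * monom_val x m"
  by (subst mpoly_eval_superset[of "{m}"]) auto

lemma mpoly_eval_const [simp]: "h 0 = 0 \<Longrightarrow> mpoly_eval h x (const_poly c) = h c"
  by (simp add: const_poly_def mpoly_eval_single)

lemma mpoly_eval_var: "h 0 = 0 \<Longrightarrow> h 1 = 1 \<Longrightarrow> mpoly_eval h x (var_poly i) = x i"
  by (simp add: var_poly_def mpoly_eval_single monom_val_def)

lemma mpoly_eval_zero [simp]: "mpoly_eval h x 0 = 0"
  by (simp add: mpoly_eval_def)

lemma mpoly_eval_add:
  assumes "h 0 = 0" "\<And>a b. h (a + b) = h a + h b"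
  shows "mpoly_eval h x (p + q) = mpoly_eval h x p + mpoly_eval h x q"
proof -
  let ?S = "Poly_Mapping.keys p \<union> Poly_Mapping.keys q"
  have "Poly_Mapping.keys (p + q) \<subseteq> ?S" by (rule Poly_Mapping.keys_add)
  then show ?thesis
    by (simp add: mpoly_eval_superset[of ?S] lookup_add assms sum.distrib algebra_simps)
qed

lemma mpoly_eval_sum:
  assumes "h 0 = 0" "\<And>a b. h (a + b) = h a + h b"
  shows "mpoly_eval h x (sum f A) = (\<Sum>i \<in> A. mpoly_eval h x (f i))"
  by (induction A rule: infinite_finite_induct) (auto simp: mpoly_eval_add assms)

lemma mpoly_eval_mult:
  assumes "h 0 = 0" "\<And>a b. h (a + b) = h a + h b" "\<And>a b. h (a * b) = h a * h b"
  shows "mpoly_eval h x (p * q) = mpoly_eval h x p * mpoly_eval h x q"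
proof -
  let ?s = "\<lambda>p m. Poly_Mapping.single m (Poly_Mapping.lookup p m)"
  have "p * q = (\<Sum>m \<in> Poly_Mapping.keys p. ?s p m) * (\<Sum>k \<in> Poly_Mapping.keys q. ?s q k)"
    by (simp only: poly_mapping_sum_monomials)
  also have "\<dots> = (\<Sum>m \<in> Poly_Mapping.keys p. \<Sum>k \<in> Poly_Mapping.keys q.
      Poly_Mapping.single (m + k) (Poly_Mapping.lookup p m * Poly_Mapping.lookup q k))"
    by (simp add: sum_product mult_single)
  finally show ?thesis
    by (simp add: mpoly_eval_sum assms mpoly_eval_single monom_val_add mpoly_eval_altdef[of h x p]
        mpoly_eval_altdef[of h x q] sum_product algebra_simps)
qed

lemma mpoly_eval_hom:
  assumes "comm_ring_hom h"
  shows "comm_ring_hom (mpoly_eval h x)"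
proof -
  interpret comm_ring_hom h by fact
  have "mpoly_eval h x 1 = 1"
    using mpoly_eval_const[of h x 1] by (simp add: const_poly_def)
  then show ?thesis
    by unfold_locales (auto simp: mpoly_eval_add mpoly_eval_mult hom_add hom_mult)
qed

lemma hom_mpoly_eval:
  assumes "comm_ring_hom f"
  shows "f (mpoly_eval h x p) = mpoly_eval (\<lambda>c. f (h c)) (\<lambda>i. f (x i)) p"
proof -
  interpret comm_ring_hom f by fact
  show ?thesis by (simp add: mpoly_eval_def hom_distribs)
qed

lemma const_poly_hom: "comm_ring_hom (const_poly :: 'a::comm_ring_1 \<Rightarrow> 'a mpoly)"
  by unfold_locales (auto simp: const_poly_def single_add mult_single)

interpretation const_poly: comm_ring_hom "const_poly :: 'a::comm_ring_1 \<Rightarrow> 'a mpoly"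
  by (rule const_poly_hom)

lemma const_poly_eq_0_iff [simp]: "const_poly a = 0 \<longleftrightarrow> a = 0"
  unfolding const_poly_def by (metis lookup_single_eq lookup_zero single_zero)

lemma var_poly_power:
  "var_poly i ^ k = (Poly_Mapping.single (Poly_Mapping.single i k) 1 :: 'a::comm_ring_1 mpoly)"
proof (induction k)
  case (Suc k)
  have "Poly_Mapping.single i 1 + Poly_Mapping.single i k = Poly_Mapping.single i (Suc k)"
    by (simp flip: single_add)
  with Suc show ?case by (simp add: var_poly_def mult_single)
qed simp

lemma monom_val_var: "monom_val var_poly m = (Poly_Mapping.single m 1 :: 'a::comm_ring_1 mpoly)"
proof -
  have "(\<Prod>i\<in>A. Poly_Mapping.single (f i) 1) = (Poly_Mapping.single (sum f A) 1 :: 'a mpoly)"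
    for f :: "nat \<Rightarrow> nat \<Rightarrow>\<^sub>0 nat" and A
    by (induction A rule: infinite_finite_induct) (auto simp: mult_single)
  then show ?thesis using poly_mapping_sum_monomials[of m]
    by (simp add: monom_val_def var_poly_power)
qed

lemma mpoly_eval_id: "mpoly_eval const_poly var_poly p = (p :: 'a::comm_ring_1 mpoly)"
  using poly_mapping_sum_monomials[of p]
  by (simp add: mpoly_eval_altdef monom_val_var const_poly_def mult_single)

lemma hom_eq_mpoly_eval:
  fixes f :: "'a::comm_ring_1 mpoly \<Rightarrow> 'b::comm_ring_1"
  assumes "comm_ring_hom f"
  shows "f p = mpoly_eval (\<lambda>c. f (const_poly c)) (\<lambda>i. f (var_poly i)) p"
  using hom_mpoly_eval[OF assms, of const_poly var_poly p] by (simp add: mpoly_eval_id)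

lemma mpoly_eval_cong:
  assumes "p \<in> polys n" "\<And>i. i < n \<Longrightarrow> x i = y i"
  shows "mpoly_eval h x p = mpoly_eval h y p"
  unfolding mpoly_eval_def using assms
  by (intro sum.cong refl arg_cong2[where f = "(*)"] prod.cong arg_cong2[where f = "(^)"])
    (auto simp: polys_def subset_iff)

text \<open>Uniqueness in the universal property of a polynomial ring. Identities between iterated
  substitutions are later proved by checking constants and variables only.\<close>

lemma mpoly_hom_eqI:
  fixes f g :: "'a::comm_ring_1 mpoly \<Rightarrow> 'b::comm_ring_1"
  assumes "comm_ring_hom f" "comm_ring_hom g" "p \<in> polys n"
    and "\<And>c. f (const_poly c) = g (const_poly c)" "\<And>i. i < n \<Longrightarrow> f (var_poly i) = g (var_poly i)"
  shows "f p = g p"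
proof -
  have "f p = mpoly_eval (\<lambda>c. f (const_poly c)) (\<lambda>i. f (var_poly i)) p"
    by (rule hom_eq_mpoly_eval) fact
  also have "\<dots> = mpoly_eval (\<lambda>c. g (const_poly c)) (\<lambda>i. g (var_poly i)) p"
    unfolding assms(4) by (rule mpoly_eval_cong[OF assms(3,5)])
  also have "\<dots> = g p" by (rule hom_eq_mpoly_eval[symmetric]) fact
  finally show ?thesis .
qed

text \<open>Induction over the value of a polynomial. The predicate \<open>P\<close> will be
  membership in \<open>polys\<close>, or lying in the image of a substitution after multiplication
  by a power of y.\<close>

lemma mpoly_eval_closed:
  assumes "p \<in> polys n"
    and "P 0" "P 1" "\<And>a b. P a \<Longrightarrow> P b \<Longrightarrow> P (a + b)" "\<And>a b. P a \<Longrightarrow> P b \<Longrightarrow> P (a * b)"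
    and "\<And>c. P (h c)" "\<And>i. i < n \<Longrightarrow> P (x i)"
  shows "P (mpoly_eval h x p)"
proof -
  have sum: "P (sum f A)" if "\<And>i. i \<in> A \<Longrightarrow> P (f i)" for f :: "(nat \<Rightarrow>\<^sub>0 nat) \<Rightarrow> 'b" and A
    using that by (induction A rule: infinite_finite_induct) (auto simp: assms)
  have pow: "P (a ^ k)" if "P a" for a k
    using that by (induction k) (auto simp: assms)
  have prod: "P (prod f A)" if "\<And>i. i \<in> A \<Longrightarrow> P (f i)" for f :: "nat \<Rightarrow> 'b" and A
    using that by (induction A rule: infinite_finite_induct) (auto simp: assms)
  show ?thesis unfolding mpoly_eval_def
    using assms(1) by (intro sum assms(5) prod pow assms(6,7)) (auto simp: polys_def)
qed

lemma const_in_polys [simp, intro]: "const_poly c \<in> polys n"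
  by (auto simp: polys_def const_poly_def split: if_splits)

lemma var_in_polys [intro]: "i < n \<Longrightarrow> var_poly i \<in> polys n"
  by (auto simp: polys_def var_poly_def)

lemma zero_in_polys [simp, intro]: "0 \<in> polys n"
  by (auto simp: polys_def)

lemma one_in_polys [simp, intro]: "1 \<in> polys n"
  by (auto simp: polys_def)

lemma add_in_polys [intro]: "p \<in> polys n \<Longrightarrow> q \<in> polys n \<Longrightarrow> p + q \<in> polys n"
  unfolding polys_def using Poly_Mapping.keys_add[of p q] by blast

lemma uminus_in_polys [intro]: "p \<in> polys n \<Longrightarrow> - p \<in> polys n" for p :: "'a::ab_group_add mpoly"
  unfolding polys_def by (simp add: in_keys_iff)

lemma diff_in_polys [intro]: "p \<in> polys n \<Longrightarrow> q \<in> polys n \<Longrightarrow> p - q \<in> polys n"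
  for p q :: "'a::ab_group_add mpoly"
  using add_in_polys[of p n "- q"] uminus_in_polys[of q n] by simp

lemma mult_in_polys [intro]: "p \<in> polys n \<Longrightarrow> q \<in> polys n \<Longrightarrow> p * q \<in> polys n"
  unfolding polys_def
proof (intro CollectI ballI subsetI)
  fix m i assume *: "p \<in> {p. \<forall>m\<in>Poly_Mapping.keys p. Poly_Mapping.keys m \<subseteq> {..<n}}"
    "q \<in> {p. \<forall>m\<in>Poly_Mapping.keys p. Poly_Mapping.keys m \<subseteq> {..<n}}"
    "m \<in> Poly_Mapping.keys (p * q)" "i \<in> Poly_Mapping.keys m"
  then obtain a b where "a \<in> Poly_Mapping.keys p" "b \<in> Poly_Mapping.keys q" "m = a + b"
    using keys_mult[of p q] by blast
  then show "i \<in> {..<n}" using * Poly_Mapping.keys_add[of a b] by blast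
qed

lemma power_in_polys [intro]: "p \<in> polys n \<Longrightarrow> p ^ k \<in> polys n" for p :: "'a::comm_ring_1 mpoly"
  by (induction k) auto

lemma sum_in_polys [intro]: "(\<And>i. i \<in> A \<Longrightarrow> f i \<in> polys n) \<Longrightarrow> sum f A \<in> polys n"
  by (induction A rule: infinite_finite_induct) auto

lemma prod_in_polys [intro]:
  "(\<And>i. i \<in> A \<Longrightarrow> f i \<in> polys n) \<Longrightarrow> prod f A \<in> polys n" for f :: "'b \<Rightarrow> 'a::comm_ring_1 mpoly"
  by (induction A rule: infinite_finite_induct) auto

lemma polys_mono: "m \<le> n \<Longrightarrow> p \<in> polys m \<Longrightarrow> p \<in> polys n"
  by (fastforce simp: polys_def)

lemma ex_polys: "\<exists>n. p \<in> polys n"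
proof -
  have "finite (\<Union>m \<in> Poly_Mapping.keys p. Poly_Mapping.keys m)" by simp
  then obtain n where "(\<Union>m \<in> Poly_Mapping.keys p. Poly_Mapping.keys m) \<subseteq> {..<n}"
    using finite_nat_iff_bounded by blast
  then show ?thesis by (auto simp: polys_def intro!: exI[of _ n])
qed

lemma polys_0_const: "p \<in> polys 0 \<Longrightarrow> \<exists>c. p = const_poly c"
proof -
  assume "p \<in> polys 0"
  then have "Poly_Mapping.keys p \<subseteq> {0}" by (auto simp: polys_def)
  then have "p = const_poly (Poly_Mapping.lookup p 0)"
    unfolding const_poly_def by (intro poly_mapping_eqI) (auto simp: lookup_single in_keys_iff when_def)
  then show ?thesis by blast
qed

section \<open>Gradings, total degree and homogeneity\<close>

definition weight :: "(nat \<Rightarrow> nat) \<Rightarrow> (nat \<Rightarrow>\<^sub>0 nat) \<Rightarrow> nat" where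
  "weight w m = (\<Sum>i \<in> Poly_Mapping.keys m. w i * Poly_Mapping.lookup m i)"

text \<open>The homomorphism X_i -> t^(w i) X_i. Weighted degree becomes degree in t over a domain,
  so additivity comes from \<open>degree_mult_eq\<close>. Weight 1 everywhere gives the total
  degree; weight 1 exactly on the variables from n on detects membership in
  \<open>polys n\<close>.\<close>

definition weigh :: "(nat \<Rightarrow> nat) \<Rightarrow> 'a::comm_ring_1 mpoly \<Rightarrow> 'a mpoly poly" where
  "weigh w = mpoly_eval (\<lambda>c. [:const_poly c:]) (\<lambda>i. monom (var_poly i) (w i))"

lemma const_lift_hom: "comm_ring_hom h \<Longrightarrow> comm_ring_hom (\<lambda>c. [:h c:])"
proof -
  assume "comm_ring_hom h"
  then interpret comm_ring_hom h .
  show ?thesis by unfold_locales (auto simp: hom_add hom_mult one_pCons)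
qed

lemma weigh_hom: "comm_ring_hom (weigh w)"
  unfolding weigh_def by (intro mpoly_eval_hom const_lift_hom const_poly_hom)

lemma monom_val_monom:
  "monom_val (\<lambda>i. monom (a i) (w i)) m = monom (monom_val a m) (weight w m)"
proof -
  have "(\<Prod>i\<in>A. monom (b i) (e i)) = monom (prod b A) (sum e A)" for b and e :: "nat \<Rightarrow> nat" and A
    by (induction A rule: infinite_finite_induct) (auto simp: mult_monom)
  then show ?thesis by (simp add: monom_val_def weight_def monom_power mult.commute)
qed

lemma coeff_weigh:
  "Poly_Mapping.lookup (coeff (weigh w p) k) m =
     (if weight w m = k then Poly_Mapping.lookup p m else 0)"
proof -
  have [simp]: "[:c:] * monom a k = monom (c * a) k" for c a :: "'a mpoly" and k
    by (simp add: smult_monom)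
  have "weigh w p = (\<Sum>m \<in> Poly_Mapping.keys p.
      monom (Poly_Mapping.single m (Poly_Mapping.lookup p m)) (weight w m))"
    unfolding weigh_def mpoly_eval_altdef monom_val_monom monom_val_var
    by (intro sum.cong refl) (simp add: const_poly_def mult_single smult_monom del: One_nat_def)
  then have "Poly_Mapping.lookup (coeff (weigh w p) k) m =
     (\<Sum>m' \<in> Poly_Mapping.keys p. Poly_Mapping.lookup
       (if weight w m' = k then Poly_Mapping.single m' (Poly_Mapping.lookup p m') else 0) m)"
    by (simp add: coeff_sum lookup_sum)
  also have "\<dots> = (\<Sum>m' \<in> Poly_Mapping.keys p. if m' = m then
        (if weight w m = k then Poly_Mapping.lookup p m else 0) else 0)"
    by (intro sum.cong refl) (auto simp: lookup_single when_def)
  also have "\<dots> = (if weight w m = k then Poly_Mapping.lookup p m else 0)"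
    by (auto simp: in_keys_iff)
  finally show ?thesis .
qed

lemma weigh_eq_0_iff [simp]: "weigh w p = 0 \<longleftrightarrow> p = 0"
proof
  assume "weigh w p = 0"
  then have "Poly_Mapping.lookup p m = 0" for m
    using coeff_weigh[of w p "weight w m" m] by simp
  then show "p = 0" by (simp add: poly_mapping_eqI)
qed (simp add: weigh_def)

lemma weigh_eq_monom:
  assumes "\<And>m. m \<in> Poly_Mapping.keys p \<Longrightarrow> weight w m = d"
  shows "weigh w p = monom p d"
proof (rule poly_eqI, rule poly_mapping_eqI)
  fix k m show "Poly_Mapping.lookup (coeff (weigh w p) k) m = Poly_Mapping.lookup (coeff (monom p d) k) m"
    using assms[of m] by (auto simp: coeff_weigh in_keys_iff)
qed

lemma degree_weigh:
  assumes "p \<noteq> 0" shows "degree (weigh w p) = Max (weight w ` Poly_Mapping.keys p)"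
proof (rule antisym)
  have ne: "finite (weight w ` Poly_Mapping.keys p)" "weight w ` Poly_Mapping.keys p \<noteq> {}"
    using assms by auto
  show "degree (weigh w p) \<le> Max (weight w ` Poly_Mapping.keys p)"
  proof (rule degree_le, intro allI impI poly_mapping_eqI)
    fix k m assume "Max (weight w ` Poly_Mapping.keys p) < k"
    then show "Poly_Mapping.lookup (coeff (weigh w p) k) m = Poly_Mapping.lookup 0 m"
      using ne by (auto simp: coeff_weigh in_keys_iff)
  qed
  obtain m where m: "m \<in> Poly_Mapping.keys p" "weight w m = Max (weight w ` Poly_Mapping.keys p)"
    using Max_in[OF ne] by auto
  then have "Poly_Mapping.lookup (coeff (weigh w p) (weight w m)) m \<noteq> 0"
    by (auto simp: coeff_weigh in_keys_iff)
  then have "coeff (weigh w p) (weight w m) \<noteq> 0" by auto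
  then show "Max (weight w ` Poly_Mapping.keys p) \<le> degree (weigh w p)"
    using m le_degree by metis
qed

lemma monom_degree_weight: "monom_degree m = weight (\<lambda>_. 1) m"
  by (simp add: monom_degree_def weight_def)

lemma total_degree_weigh: "total_degree p = degree (weigh (\<lambda>_. 1) p)" for p :: "'a::comm_ring_1 mpoly"
proof (cases "p = 0")
  case False
  then show ?thesis
    by (simp add: total_degree_def degree_weigh monom_degree_weight[abs_def] Max_insert)
qed (simp add: total_degree_def weigh_def)

lemma total_degree_mult:
  fixes p q :: "'a::idom mpoly"
  assumes "p \<noteq> 0" "q \<noteq> 0"
  shows "total_degree (p * q) = total_degree p + total_degree q"
proof -
  interpret comm_ring_hom "weigh (\<lambda>_. 1) :: 'a mpoly \<Rightarrow> _" by (rule weigh_hom)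
  show ?thesis using assms by (simp add: total_degree_weigh hom_mult degree_mult_eq del: One_nat_def)
qed

lemma total_degree_const [simp]: "total_degree (const_poly c) = 0"
  by (auto simp: total_degree_def const_poly_def monom_degree_def)

lemma total_degree_0_const:
  assumes "total_degree p = 0" shows "\<exists>c. p = const_poly c"
proof -
  have "monom_degree m = 0" if "m \<in> Poly_Mapping.keys p" for m
    using that assms Max_ge[of "insert 0 (monom_degree ` Poly_Mapping.keys p)" "monom_degree m"]
    by (simp add: total_degree_def)
  then have "Poly_Mapping.keys p \<subseteq> {0}"
    by (auto simp: monom_degree_def in_keys_iff intro!: poly_mapping_eqI)
  then have "p = const_poly (Poly_Mapping.lookup p 0)"
    unfolding const_poly_def by (intro poly_mapping_eqI) (auto simp: lookup_single in_keys_iff when_def)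
  then show ?thesis by blast
qed

lemma total_degree_homogeneous:
  assumes "homogeneous d p" "p \<noteq> 0" shows "total_degree p = d"
proof -
  have "monom_degree ` Poly_Mapping.keys p = {d}"
    using assms keys_eq_empty[of p] by (fastforce simp: homogeneous_def)
  then show ?thesis by (simp add: total_degree_def)
qed

lemma monom_degree_le_total: "m \<in> Poly_Mapping.keys p \<Longrightarrow> monom_degree m \<le> total_degree p"
  unfolding total_degree_def by (intro Max_ge) auto

lemma in_polys_iff_weight:
  "p \<in> polys n \<longleftrightarrow> (\<forall>m \<in> Poly_Mapping.keys p. weight (\<lambda>i. if i < n then 0 else 1) m = 0)"
proof -
  have "weight (\<lambda>i. if i < n then 0 else 1) m = 0 \<longleftrightarrow> Poly_Mapping.keys m \<subseteq> {..<n}" for m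
    by (auto simp: weight_def in_keys_iff subset_iff)
  then show ?thesis by (simp add: polys_def)
qed

text \<open>The degree in the variables from n on is additive and vanishes for the product, hence
  for each factor.\<close>

lemma polys_dvd_closed:
  fixes p q :: "'a::idom mpoly"
  assumes "p * q \<in> polys n" "p * q \<noteq> 0" shows "p \<in> polys n"
proof -
  let ?w = "\<lambda>i. if i < n then 0 else (1::nat)"
  interpret comm_ring_hom "weigh ?w :: 'a mpoly \<Rightarrow> _" by (rule weigh_hom)
  have "weigh ?w (p * q) = monom (p * q) 0"
    using assms by (intro weigh_eq_monom) (auto simp: in_polys_iff_weight)
  then have "degree (weigh ?w p * weigh ?w q) = 0" 
    by (metis hom_mult degree_monom_eq assms(2))
  then have "degree (weigh ?w p) = 0" using assms by (auto simp: degree_mult_eq)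
  moreover have "p \<noteq> 0" using assms by auto
  ultimately have "Max (weight ?w ` Poly_Mapping.keys p) = 0" using degree_weigh by metis
  then have "\<forall>m \<in> Poly_Mapping.keys p. weight ?w m = 0"
    by (metis (no_types, lifting) Max_ge finite_imageI finite_keys imageI le_zero_eq)
  then show ?thesis by (simp add: in_polys_iff_weight)
qed

text \<open>Over a domain both the lowest and the highest exponent add up in a product; they
  coincide for a monomial, hence also for its factors.\<close>

lemma monom_factor:
  fixes A B :: "'a::idom poly"
  assumes "A * B = monom c d" "c \<noteq> 0"
  shows "A = monom (lead_coeff A) (degree A)"
proof -
  have nz: "A \<noteq> 0" "B \<noteq> 0" using assms by auto
  define i where "i = (LEAST i. coeff A i \<noteq> 0)"
  define j where "j = (LEAST j. coeff B j \<noteq> 0)"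
  have "\<exists>i. coeff A i \<noteq> 0" using nz by (simp add: poly_eq_iff)
  then have i: "coeff A i \<noteq> 0" "\<And>k. k < i \<Longrightarrow> coeff A k = 0"
    unfolding i_def by (rule LeastI_ex) (use not_less_Least in blast)
  have "\<exists>j. coeff B j \<noteq> 0" using nz by (simp add: poly_eq_iff)
  then have j: "coeff B j \<noteq> 0" "\<And>k. k < j \<Longrightarrow> coeff B k = 0"
    unfolding j_def by (rule LeastI_ex) (use not_less_Least in blast)
  have "coeff (A * B) (i + j) = (\<Sum>k\<le>i + j. coeff A k * coeff B (i + j - k))"
    by (rule coeff_mult)
  also have "\<dots> = (\<Sum>k\<le>i + j. if k = i then coeff A i * coeff B j else 0)"
  proof (intro sum.cong refl)
    fix k
    assume "k \<in> {..i + j}"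
    then show "coeff A k * coeff B (i + j - k) = (if k = i then coeff A i * coeff B j else 0)"
      using i(2)[of k] j(2)[of "i + j - k"] by (cases k i rule: linorder_cases) auto
  qed
  also have "\<dots> = coeff A i * coeff B j" by simp
  finally have "coeff (monom c d) (i + j) \<noteq> 0" using assms i j by simp
  then have d: "d = i + j" by (auto split: if_splits)
  have "degree A + degree B = d" using degree_mult_eq[OF nz] degree_monom_eq[OF assms(2)] assms(1) by simp
  then have "degree A = i" using d le_degree[OF i(1)] le_degree[OF j(1)] by simp
  then show ?thesis
    using i by (intro poly_eqI) (metis coeff_eq_0 coeff_monom linorder_neqE_nat)
qed

lemma homogeneous_factor:
  fixes p q :: "'a::idom mpoly"
  assumes "homogeneous d (p * q)" "p * q \<noteq> 0"
  shows "homogeneous (total_degree p) p"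
proof -
  interpret comm_ring_hom "weigh (\<lambda>_. 1) :: 'a mpoly \<Rightarrow> _" by (rule weigh_hom)
  have "weigh (\<lambda>_. 1) p * weigh (\<lambda>_. 1) q = monom (p * q) d"
    using assms weigh_eq_monom[of "p * q" "\<lambda>_. 1" d]
    by (simp add: homogeneous_def monom_degree_weight hom_mult del: One_nat_def)
  then have *: "weigh (\<lambda>_. 1) p = monom (lead_coeff (weigh (\<lambda>_. 1) p)) (total_degree p)"
    using monom_factor assms(2) total_degree_weigh by metis
  show ?thesis unfolding homogeneous_def
  proof
    fix m assume "m \<in> Poly_Mapping.keys p"
    then have "Poly_Mapping.lookup (coeff (weigh (\<lambda>_. 1) p) (monom_degree m)) m \<noteq> 0"
      by (simp add: coeff_weigh monom_degree_weight in_keys_iff)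
    then show "monom_degree m = total_degree p" by (subst (asm) *) (auto split: if_splits)
  qed
qed

text \<open>A graded logical relation between two evaluations of one form. Relating a polynomial of
  degree at most d to its coefficient at d turns it into the computation of leading coefficients in
  \<open>line_lead\<close>.\<close>

lemma mpoly_eval_rel:
  assumes "p \<in> polys n" "homogeneous d p"
    and "\<And>d. R d 0 0" "R 0 1 1" "\<And>d a b a' b'. R d a a' \<Longrightarrow> R d b b' \<Longrightarrow> R d (a + b) (a' + b')"
    and "\<And>d e a b a' b'. R d a a' \<Longrightarrow> R e b b' \<Longrightarrow> R (d + e) (a * b) (a' * b')"
    and "\<And>c. R 0 (h c) (h' c)" "\<And>i. i < n \<Longrightarrow> R 1 (x i) (x' i)"
  shows "R d (mpoly_eval h x p) (mpoly_eval h' x' p)"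
proof -
  have sum: "R d (sum f A) (sum f' A)" if "\<And>i. i \<in> A \<Longrightarrow> R d (f i) (f' i)" for f f' and A :: "(nat \<Rightarrow>\<^sub>0 nat) set"
    using that by (induction A rule: infinite_finite_induct) (auto simp: assms)
  have pow: "R k (a ^ k) (a' ^ k)" if "R 1 a a'" for a a' k
    using that assms(6)[of 1 a a'] by (induction k) (auto simp: assms)
  have prod: "R (sum e A) (prod f A) (prod f' A)" if "\<And>i. i \<in> A \<Longrightarrow> R (e i) (f i) (f' i)"
    for e f f' and A :: "nat set"
    using that by (induction A rule: infinite_finite_induct) (auto simp: assms)
  show ?thesis unfolding mpoly_eval_def
  proof (rule sum)
    fix m assume m: "m \<in> Poly_Mapping.keys p"
    have "R (monom_degree m) (\<Prod>i\<in>Poly_Mapping.keys m. x i ^ Poly_Mapping.lookup m i)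
        (\<Prod>i\<in>Poly_Mapping.keys m. x' i ^ Poly_Mapping.lookup m i)"
      unfolding monom_degree_def
      using assms(1) m by (intro prod pow assms(8)) (auto simp: polys_def)
    then show "R d (h (Poly_Mapping.lookup p m) * (\<Prod>i\<in>Poly_Mapping.keys m. x i ^ Poly_Mapping.lookup m i))
        (h' (Poly_Mapping.lookup p m) * (\<Prod>i\<in>Poly_Mapping.keys m. x' i ^ Poly_Mapping.lookup m i))"
      using assms(6)[OF assms(7)] assms(2) m by (fastforce simp: homogeneous_def)
  qed
qed

lemma mpoly_eval_graded:
  assumes "p \<in> polys n" "homogeneous d p"
    and "\<And>d. P d 0" "P 0 1" "\<And>d a b. P d a \<Longrightarrow> P d b \<Longrightarrow> P d (a + b)"
    and "\<And>d e a b. P d a \<Longrightarrow> P e b \<Longrightarrow> P (d + e) (a * b)"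
    and "\<And>c. P 0 (h c)" "\<And>i. i < n \<Longrightarrow> P 1 (x i)"
  shows "P d (mpoly_eval h x p)"
  using assms(1,2) by (rule mpoly_eval_rel[where R = "\<lambda>d a _. P d a" and h' = h and x' = x]) (fact assms(3-))+

lemma mpoly_eval_filtered:
  assumes "p \<in> polys n" "total_degree p \<le> d"
    and "\<And>d. P d 0" "P 0 1" "\<And>d a b. P d a \<Longrightarrow> P d b \<Longrightarrow> P d (a + b)"
    and "\<And>d e a b. P d a \<Longrightarrow> P e b \<Longrightarrow> P (d + e) (a * b)" "\<And>d e a. P d a \<Longrightarrow> d \<le> e \<Longrightarrow> P e a"
    and "\<And>c. P 0 (h c)" "\<And>i. i < n \<Longrightarrow> P 1 (x i)"
  shows "P d (mpoly_eval h x p)"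
proof -
  have sum: "P d (sum f A)" if "\<And>i. i \<in> A \<Longrightarrow> P d (f i)" for f :: "(nat \<Rightarrow>\<^sub>0 nat) \<Rightarrow> 'b" and A
    using that by (induction A rule: infinite_finite_induct) (auto simp: assms)
  have pow: "P k (a ^ k)" if "P 1 a" for a k
    using that assms(6)[of 1 a] by (induction k) (auto simp: assms)
  have prod: "P (sum e A) (prod f A)" if "\<And>i. i \<in> A \<Longrightarrow> P (e i) (f i)" for e and f :: "nat \<Rightarrow> 'b" and A
    using that by (induction A rule: infinite_finite_induct) (auto simp: assms)
  show ?thesis unfolding mpoly_eval_def
  proof (rule sum)
    fix m assume m: "m \<in> Poly_Mapping.keys p"
    have "P (monom_degree m) (\<Prod>i\<in>Poly_Mapping.keys m. x i ^ Poly_Mapping.lookup m i)"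
      unfolding monom_degree_def
      using assms(1) m by (intro prod pow assms(9)) (auto simp: polys_def)
    then have "P (0 + monom_degree m) (h (Poly_Mapping.lookup p m) * (\<Prod>i\<in>Poly_Mapping.keys m. x i ^ Poly_Mapping.lookup m i))"
      by (intro assms(6,8))
    then show "P d (h (Poly_Mapping.lookup p m) * (\<Prod>i\<in>Poly_Mapping.keys m. x i ^ Poly_Mapping.lookup m i))"
      using assms(7) monom_degree_le_total[OF m] assms(2) by force
  qed
qed

subsection \<open>Unique factorization\<close>

lemma comm_ring_hom_comp: "comm_ring_hom f \<Longrightarrow> comm_ring_hom g \<Longrightarrow> comm_ring_hom (\<lambda>x. f (g x))"
proof -
  assume "comm_ring_hom f" "comm_ring_hom g"
  then interpret f: comm_ring_hom f + g: comm_ring_hom g .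
  show ?thesis by unfold_locales (auto simp: f.hom_add g.hom_add f.hom_mult g.hom_mult)
qed

lemma poly_eval_hom: "comm_ring_hom (\<lambda>P. poly P (a :: 'a::comm_ring_1))"
  by unfold_locales auto

lemma map_poly_hom: "comm_ring_hom h \<Longrightarrow> comm_ring_hom (map_poly h)"
proof -
  assume "comm_ring_hom h"
  then interpret map_poly_comm_ring_hom h by (simp add: map_poly_comm_ring_hom_def)
  show ?thesis ..
qed

lemma id_comm_ring_hom: "comm_ring_hom id" "comm_ring_hom (\<lambda>x. x)"
  by unfold_locales auto

text \<open>Singles out X_n as the outer variable. The number of variables is not part of the type,
  so that the coefficients lie in \<open>polys n\<close> has to be tracked by hypotheses.\<close>

definition unipoly :: "nat \<Rightarrow> 'a::comm_ring_1 mpoly \<Rightarrow> 'a mpoly poly" where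
  "unipoly n = mpoly_eval (\<lambda>c. [:const_poly c:]) (\<lambda>i. if i = n then [:0, 1:] else [:var_poly i:])"

lemma unipoly_hom: "comm_ring_hom (unipoly n)"
  unfolding unipoly_def by (intro mpoly_eval_hom const_lift_hom const_poly_hom)

interpretation unipoly: comm_ring_hom "unipoly n"
  by (rule unipoly_hom)

lemma unipoly_const [simp]: "unipoly n (const_poly c) = [:const_poly c:]"
  by (simp add: unipoly_def)

lemma unipoly_var: "unipoly n (var_poly i) = (if i = n then [:0, 1:] else [:var_poly i:])"
  by (simp add: unipoly_def mpoly_eval_var one_pCons)

lemma poly_unipoly: "poly (unipoly n p) (var_poly n) = p"
proof -
  have "poly (unipoly n p) (var_poly n) = mpoly_eval const_poly var_poly p"
    unfolding unipoly_def hom_mpoly_eval[OF poly_eval_hom]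
    by (rule arg_cong3[where f = mpoly_eval]) auto
  then show ?thesis by (simp add: mpoly_eval_id)
qed

lemma unipoly_eq_0_iff [simp]: "unipoly n p = 0 \<longleftrightarrow> p = 0"
  using poly_unipoly[of n p] by auto

lemma unipoly_polys: "a \<in> polys n \<Longrightarrow> unipoly n a = [:a:]"
  by (rule mpoly_hom_eqI[of _ _ _ n]) (auto simp: unipoly_var intro: unipoly_hom const_lift_hom[of id, simplified] id_comm_ring_hom)

lemma coeff_unipoly_polys: "p \<in> polys (Suc n) \<Longrightarrow> coeff (unipoly n p) i \<in> polys n"
proof -
  assume p: "p \<in> polys (Suc n)"
  have "\<forall>i. coeff (unipoly n p) i \<in> polys n"
    unfolding unipoly_def
    by (rule mpoly_eval_closed[OF p])
      (auto simp: coeff_mult coeff_1 coeff_pCons split: nat.split)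
  then show ?thesis ..
qed

lemma unipoly_degree_0: "p \<in> polys (Suc n) \<Longrightarrow> degree (unipoly n p) = 0 \<Longrightarrow> p \<in> polys n"
  by (metis coeff_unipoly_polys degree_0_id poly_unipoly poly_const_conv)

lemma mpoly_nonvanishing:
  fixes p :: "'a::{idom,ring_char_0} mpoly"
  assumes "p \<in> polys n" "p \<noteq> 0"
  shows "\<exists>x. mpoly_eval id x p \<noteq> 0"
  using assms
proof (induction n arbitrary: p)
  case 0
  then show ?case using polys_0_const[of p] by auto
next
  case (Suc n)
  from Suc.prems obtain i where i: "coeff (unipoly n p) i \<noteq> 0"
    by (metis leading_coeff_0_iff unipoly_eq_0_iff)
  from Suc.IH[OF coeff_unipoly_polys[OF Suc.prems(1)] this]
  obtain x where x: "mpoly_eval id x (coeff (unipoly n p) i) \<noteq> 0" by blast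
  define e where "e = (mpoly_eval id x :: 'a mpoly \<Rightarrow> 'a)"
  interpret e: comm_ring_hom e unfolding e_def by (rule mpoly_eval_hom[OF id_comm_ring_hom(1)])
  have e_simps: "e (const_poly c) = c" "e (var_poly j) = x j" for c j
    by (simp_all add: e_def mpoly_eval_var)
  have map_e: "map_poly e [:a:] = [:e a:]" for a
    by (simp add: poly_eq_iff coeff_map_poly coeff_pCons split: nat.split)
  have "coeff (map_poly e (unipoly n p)) i \<noteq> 0" using x by (simp add: e_def coeff_map_poly)
  then have "map_poly e (unipoly n p) \<noteq> 0" by (metis coeff_0)
  then obtain y where y: "poly (map_poly e (unipoly n p)) y \<noteq> 0"
    using poly_all_0_iff_0 by blast
  have "mpoly_eval id (x(n := y)) p = poly (map_poly e (unipoly n p)) y"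
  proof (rule mpoly_hom_eqI[OF _ _ Suc.prems(1)])
    show "comm_ring_hom (mpoly_eval id (x(n := y)))" by (rule mpoly_eval_hom[OF id_comm_ring_hom(1)])
    show "comm_ring_hom (\<lambda>p. poly (map_poly e (unipoly n p)) y)"
      by (intro comm_ring_hom_comp[OF poly_eval_hom] comm_ring_hom_comp[OF _ unipoly_hom]
          map_poly_hom e.comm_ring_hom_axioms)
  qed (auto simp: unipoly_var mpoly_eval_var map_poly_pCons map_e e_simps)
  then show ?case using y by metis
qed

lemma mpoly_unit_iff:
  fixes p :: "'a::field mpoly"
  shows "p dvd 1 \<longleftrightarrow> p \<noteq> 0 \<and> total_degree p = 0"
proof
  assume "p dvd 1"
  then obtain q where q: "1 = p * q" by (auto elim: dvdE)
  then have "p \<noteq> 0" "q \<noteq> 0" by auto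
  moreover from this have "total_degree (1 :: 'a mpoly) = total_degree p + total_degree q"
    using q total_degree_mult by metis
  moreover have "total_degree (1 :: 'a mpoly) = 0"
    using total_degree_const[of "1::'a"] by (simp del: total_degree_const)
  ultimately show "p \<noteq> 0 \<and> total_degree p = 0" by simp
next
  assume *: "p \<noteq> 0 \<and> total_degree p = 0"
  then obtain c where c: "p = const_poly c" using total_degree_0_const by blast
  with * have "c \<noteq> 0" by auto
  then have "p * const_poly (1 / c) = 1"
    unfolding c by (simp flip: const_poly.hom_mult)
  then show "p dvd 1" by (metis dvd_triv_left)
qed

lemma mpoly_irreducible_divisor:
  fixes c :: "'a::field mpoly"
  assumes "c \<noteq> 0" "\<not> c dvd 1"
  shows "\<exists>\<pi>. irreducible \<pi> \<and> \<pi> dvd c"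
  using assms
proof (induction "total_degree c" arbitrary: c rule: less_induct)
  case less
  show ?case
  proof (cases "irreducible c")
    case False
    then obtain a b where ab: "c = a * b" "\<not> a dvd 1" "\<not> b dvd 1"
      using less.prems by (auto simp: irreducible_def)
    then have nz: "a \<noteq> 0" "b \<noteq> 0" using less.prems by auto
    then have "total_degree a < total_degree c"
      using ab total_degree_mult[OF nz] by (auto simp: mpoly_unit_iff)
    from less.hyps[OF this nz(1) ab(2)] show ?thesis using ab by auto
  qed auto
qed

lemma polys_dvd:
  fixes p q :: "'a::idom mpoly"
  shows "p \<in> polys n \<Longrightarrow> p \<noteq> 0 \<Longrightarrow> q dvd p \<Longrightarrow> q \<in> polys n"
  using polys_dvd_closed by (metis dvdE)

text \<open>Gauss: the coefficient of \<open>a b\<close> at the sum of the first indices where \<open>\<pi>\<close> fails to divide.\<close>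

lemma prime_dvd_polys_Suc:
  fixes \<pi> :: "'a::idom mpoly"
  assumes \<pi>: "\<pi> \<in> polys n" "\<And>a b. a \<in> polys n \<Longrightarrow> b \<in> polys n \<Longrightarrow> \<pi> dvd a * b \<Longrightarrow> \<pi> dvd a \<or> \<pi> dvd b"
    and ab: "a \<in> polys (Suc n)" "b \<in> polys (Suc n)" "\<pi> dvd a * b"
  shows "\<pi> dvd a \<or> \<pi> dvd b"
proof -
  have iff: "\<pi> dvd p \<longleftrightarrow> (\<forall>i. \<pi> dvd coeff (unipoly n p) i)" for p
  proof
    assume "\<pi> dvd p"
    then have "[:\<pi>:] dvd unipoly n p"
      using unipoly.hom_mult[of n \<pi>] by (metis unipoly_polys[OF \<pi>(1)] dvdE dvd_triv_left)
    then show "\<forall>i. \<pi> dvd coeff (unipoly n p) i" by (simp add: const_poly_dvd_iff)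
  next
    assume "\<forall>i. \<pi> dvd coeff (unipoly n p) i"
    then obtain q where "unipoly n p = [:\<pi>:] * q" by (auto simp: const_poly_dvd_iff[symmetric] elim: dvdE)
    then have "p = \<pi> * poly q (var_poly n)" using poly_unipoly[of n p] by simp
    then show "\<pi> dvd p" by simp
  qed
  show ?thesis
  proof (rule ccontr)
    let ?A = "coeff (unipoly n a)" and ?B = "coeff (unipoly n b)"
    assume "\<not> ?thesis"
    then have ex: "\<exists>i. \<not> \<pi> dvd ?A i" "\<exists>i. \<not> \<pi> dvd ?B i"
      using iff[of a] iff[of b] by blast+
    define i where "i = (LEAST i. \<not> \<pi> dvd ?A i)"
    define j where "j = (LEAST i. \<not> \<pi> dvd ?B i)"
    have i: "\<not> \<pi> dvd ?A i" "\<And>k. k < i \<Longrightarrow> \<pi> dvd ?A k"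
      unfolding i_def using LeastI_ex[OF ex(1)] not_less_Least by blast+
    have j: "\<not> \<pi> dvd ?B j" "\<And>k. k < j \<Longrightarrow> \<pi> dvd ?B k"
      unfolding j_def using LeastI_ex[OF ex(2)] not_less_Least by blast+
    have "coeff (unipoly n (a * b)) (i + j) = (\<Sum>k\<le>i + j. ?A k * ?B (i + j - k))"
      by (simp add: unipoly.hom_mult coeff_mult)
    also have "\<dots> = ?A i * ?B j + (\<Sum>k\<in>{..i + j} - {i}. ?A k * ?B (i + j - k))"
      by (subst sum.remove[of _ i]) auto
    finally have "\<pi> dvd ?A i * ?B j + (\<Sum>k\<in>{..i + j} - {i}. ?A k * ?B (i + j - k))"
      using ab(3) unfolding iff[of "a * b"] by metis
    moreover have "\<pi> dvd (\<Sum>k\<in>{..i + j} - {i}. ?A k * ?B (i + j - k))"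
    proof (rule dvd_sum)
      fix k assume "k \<in> {..i + j} - {i}"
      then have "k < i \<or> i + j - k < j" by auto
      then show "\<pi> dvd ?A k * ?B (i + j - k)" using i(2) j(2) by auto
    qed
    ultimately have "\<pi> dvd ?A i * ?B j" by (simp add: dvd_add_left_iff)
    then show False using \<pi>(2) i(1) j(1) coeff_unipoly_polys ab by blast
  qed
qed

text \<open>The type contains polynomials in arbitrarily many variables, whereas an induction on
  variables tests primality inside \<open>polys n\<close> only. Gauss's lemma enlarges the test ring
  one variable at a time.\<close>

lemma prime_elem_of_polys:
  fixes \<pi> :: "'a::idom mpoly"
  assumes "\<pi> \<in> polys n" "\<pi> \<noteq> 0" "\<not> \<pi> dvd 1"
    and "\<And>a b. a \<in> polys n \<Longrightarrow> b \<in> polys n \<Longrightarrow> \<pi> dvd a * b \<Longrightarrow> \<pi> dvd a \<or> \<pi> dvd b"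
  shows "prime_elem \<pi>"
proof -
  have *: "\<pi> dvd a \<or> \<pi> dvd b" if "a \<in> polys (n + k)" "b \<in> polys (n + k)" "\<pi> dvd a * b" for a b k
    using that
  proof (induction k arbitrary: a b)
    case 0
    then show ?case using assms(4) by simp
  next
    case (Suc k)
    show ?case
      by (rule prime_dvd_polys_Suc[of \<pi> "n + k"]) (use Suc polys_mono[OF _ assms(1)] in auto)
  qed
  show ?thesis
  proof (rule prime_elemI)
    fix a b assume "\<pi> dvd a * b"
    moreover obtain k l where "a \<in> polys k" "b \<in> polys l" using ex_polys by blast
    ultimately show "\<pi> dvd a \<or> \<pi> dvd b"
      using *[of a "k + l" b] polys_mono[of k "n + (k + l)" a] polys_mono[of l "n + (k + l)" b] by simp
  qed (use assms in auto)
qed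

lemma mpoly_pseudo_division:
  fixes a b :: "'a::idom mpoly"
  assumes "a \<in> polys (Suc n)" "b \<in> polys (Suc n)" "b \<noteq> 0"
  shows "\<exists>c q r. c \<in> polys n \<and> c \<noteq> 0 \<and> q \<in> polys (Suc n) \<and> r \<in> polys (Suc n) \<and> c * a = q * b + r \<and>
    (r = 0 \<or> degree (unipoly n r) < degree (unipoly n b))"
  using assms(1)
proof (induction "degree (unipoly n a)" arbitrary: a rule: less_induct)
  case less
  let ?d = "\<lambda>p. degree (unipoly n p)" and ?l = "\<lambda>p. lead_coeff (unipoly n p)"
  show ?case
  proof (cases "a = 0 \<or> ?d a < ?d b")
    case True
    then show ?thesis using less.prems by (intro exI[of _ 1] exI[of _ 0] exI[of _ a]) auto
  next
    case False
    define k where "k = ?d a - ?d b"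
    define a1 where "a1 = ?l b * a - ?l a * var_poly n ^ k * b"
    have l: "?l b \<in> polys n" "?l a \<in> polys n" using coeff_unipoly_polys less.prems assms by blast+
    then have lS: "?l b \<in> polys (Suc n)" "?l a \<in> polys (Suc n)" using polys_mono[of n "Suc n"] by auto
    have x: "(var_poly n :: 'a mpoly) ^ k \<in> polys (Suc n)" by (intro power_in_polys var_in_polys) simp
    have a1: "a1 \<in> polys (Suc n)" unfolding a1_def using lS x less.prems assms by blast
    have lnz: "?l b \<noteq> 0" using assms by simp
    have u: "unipoly n a1 = smult (?l b) (unipoly n a) - monom (?l a) k * unipoly n b"
      by (simp add: a1_def unipoly.hom_minus unipoly.hom_mult unipoly.hom_power unipoly_polys l unipoly_var
          monom_altdef mult.assoc)
    have d: "a1 = 0 \<or> ?d a1 < ?d a"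
    proof -
      have "?d a1 \<le> ?d a" unfolding u
        using False order.trans[OF degree_mult_le add_right_mono[OF degree_monom_le], of "?l a" k "unipoly n b"]
        by (intro degree_diff_le) (auto simp: k_def)
      moreover have "coeff (unipoly n a1) (?d a) = 0"
        using False by (simp add: u k_def coeff_monom_mult)
      ultimately show ?thesis
        by (metis leading_coeff_0_iff order_le_imp_less_or_eq unipoly_eq_0_iff)
    qed
    have "\<exists>c q r. c \<in> polys n \<and> c \<noteq> 0 \<and> q \<in> polys (Suc n) \<and> r \<in> polys (Suc n) \<and> c * a1 = q * b + r \<and>
      (r = 0 \<or> ?d r < ?d b)"
      using d
    proof
      assume "a1 = 0" then show ?thesis by (intro exI[of _ 1] exI[of _ 0]) auto
    qed (use less.hyps a1 in blast)
    then obtain c q r where c: "c \<in> polys n" "c \<noteq> 0" "q \<in> polys (Suc n)" "r \<in> polys (Suc n)"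
      "c * a1 = q * b + r" "r = 0 \<or> ?d r < ?d b" by blast
    have "(c * ?l b) * a = (q + c * ?l a * var_poly n ^ k) * b + r"
      using c(5) by (simp add: a1_def algebra_simps)
    moreover have "c * ?l b \<in> polys n" "c * ?l b \<noteq> 0" using c l lnz by auto
    moreover have "q + c * ?l a * var_poly n ^ k \<in> polys (Suc n)"
      using c lS x polys_mono[of n "Suc n" c] by auto
    ultimately show ?thesis using c by blast
  qed
qed

text \<open>Every irreducible factor of \<open>c\<close> is prime by \<open>IH\<close>, so it
  divides \<open>q\<close> or \<open>b\<close> and can be cancelled there. This plays the role of
  contents and primitive parts.\<close>

lemma cancel_polys_factor:
  fixes p :: "'a::field mpoly"
  assumes IH: "\<And>\<pi> :: 'a mpoly. \<pi> \<in> polys n \<Longrightarrow> irreducible \<pi> \<Longrightarrow> prime_elem \<pi>"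
    and "c \<in> polys n" "c \<noteq> 0" "c * p = q * b"
  shows "\<exists>c1 c2 q' b'. c1 \<in> polys n \<and> c2 \<in> polys n \<and> q = c1 * q' \<and> b = c2 * b' \<and> p = q' * b'"
  using assms(2-)
proof (induction "total_degree c" arbitrary: c q b rule: less_induct)
  case less
  show ?case
  proof (cases "c dvd 1")
    case True
    then obtain u where u: "1 = c * u" by (auto elim: dvdE)
    have "q = c * (u * q)" using u by (metis mult.assoc mult_1)
    moreover have "p = (u * q) * b" using u less.prems(3) by (metis mult.assoc mult.left_commute mult_1)
    ultimately show ?thesis using less.prems(1)
      by (intro exI[of _ c] exI[of _ 1] exI[of _ "u * q"] exI[of _ b]) auto
  next
    case False
    then obtain \<pi> c' where \<pi>: "irreducible \<pi>" "c = \<pi> * c'"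
      using mpoly_irreducible_divisor[of c] less.prems by (auto elim: dvdE)
    have mem: "\<pi> \<in> polys n" "c' \<in> polys n"
      using \<pi>(2) less.prems polys_dvd[of c n] by auto
    then have pr: "prime_elem \<pi>" using IH \<pi> by blast
    have nz: "\<pi> \<noteq> 0" "c' \<noteq> 0" using \<pi>(2) less.prems by auto
    have lt: "total_degree c' < total_degree c"
      using total_degree_mult[OF nz] \<pi> nz by (auto simp: mpoly_unit_iff irreducible_def)
    have "\<pi> dvd q * b" using less.prems(3) \<pi>(2) by (metis dvd_triv_left mult.assoc)
    then consider "\<pi> dvd q" | "\<pi> dvd b" using pr by (meson prime_elem_dvd_mult_iff)
    then show ?thesis
    proof cases
      case 1
      then obtain q1 where q1: "q = \<pi> * q1" by (auto elim: dvdE)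
      then have "c' * p = q1 * b" using less.prems(3) \<pi>(2) nz by (simp add: mult.assoc)
      from less.hyps[OF lt mem(2) nz(2) this] obtain c1 c2 q' b' where
        "c1 \<in> polys n" "c2 \<in> polys n" "q1 = c1 * q'" "b = c2 * b'" "p = q' * b'" by blast
      then show ?thesis using q1 mem
        by (intro exI[of _ "\<pi> * c1"] exI[of _ c2] exI[of _ q'] exI[of _ b']) (auto simp: mult.assoc)
    next
      case 2
      then obtain b1 where b1: "b = \<pi> * b1" by (auto elim: dvdE)
      then have "c' * p = q * b1" using less.prems(3) \<pi>(2) nz by (simp add: mult.assoc mult.left_commute)
      from less.hyps[OF lt mem(2) nz(2) this] obtain c1 c2 q' b' where
        "c1 \<in> polys n" "c2 \<in> polys n" "q = c1 * q'" "b1 = c2 * b'" "p = q' * b'" by blast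
      then show ?thesis using b1 mem
        by (intro exI[of _ c1] exI[of _ "\<pi> * c2"] exI[of _ q'] exI[of _ b']) (auto simp: mult.assoc)
    qed
  qed
qed

text \<open>Induction on the number of variables. Euclid's algorithm in X_n over the fraction field
  in the other variables is imitated by pseudo-division, and \<open>cancel_polys_factor\<close>
  removes the denominators.\<close>

theorem mpoly_irreducible_imp_prime_elem:
  fixes p :: "'a::field mpoly"
  assumes "irreducible p"
  shows "prime_elem p"
proof -
  have *: "prime_elem p" if "p \<in> polys n" "irreducible p" for n and p :: "'a mpoly"
    using that
  proof (induction n arbitrary: p)
    case 0
    then show ?case using polys_0_const[of p] by (auto simp: irreducible_def mpoly_unit_iff)
  next
    case (Suc n)
    let ?d = "\<lambda>p. degree (unipoly n p)"
    note IH = Suc.IH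
    have p: "p \<in> polys (Suc n)" "irreducible p" "p \<noteq> 0" "\<not> p dvd 1"
      using Suc.prems by (auto simp: irreducible_def)
    have d_mult: "?d (a * b) = ?d a + ?d b" if "a \<noteq> 0" "b \<noteq> 0" for a b :: "'a mpoly"
      using that by (simp add: unipoly.hom_mult degree_mult_eq)
    have d_dvd: "?d p \<le> ?d r" if r: "p dvd r" "r \<noteq> 0" for r
    proof -
      obtain k where "r = p * k" using r(1) by (auto elim: dvdE)
      then show ?thesis using d_mult[of p k] r(2) by auto
    qed
    have d0: "?d c = 0" if "c \<in> polys n" for c :: "'a mpoly"
      using that by (simp add: unipoly_polys)
    show ?case
    proof (cases "p \<in> polys n")
      case False
      then have dp: "?d p \<noteq> 0" using unipoly_degree_0 p by blast
      have absorb: "p dvd x" if "p = c * p'" "x = p' * m" "c \<in> polys n" for c p' x m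
      proof -
        have "c dvd 1 \<or> p' dvd 1" using p(2) that(1) by (auto simp: irreducible_def)
        moreover have "\<not> p' dvd 1"
        proof
          assume "p' dvd 1"
          then have "p' \<in> polys n" using polys_dvd[of 1 n p'] by auto
          then show False using that False by auto
        qed
        ultimately have "c dvd 1" by blast
        then obtain u where u: "1 = c * u" by (auto elim: dvdE)
        have "x = (p' * (c * u)) * m" using that(2) u by simp
        also have "\<dots> = p * (u * m)" using that(1) by (simp add: algebra_simps)
        finally show ?thesis by simp
      qed
      show ?thesis
      proof (rule prime_elem_of_polys[OF p(1,3,4)], rule ccontr)
        fix a b0 :: "'a mpoly"
        assume a: "a \<in> polys (Suc n)" and b0: "b0 \<in> polys (Suc n)" "p dvd a * b0" "\<not> (p dvd a \<or> p dvd b0)"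
        \<comment> \<open>A counterexample \<open>b\<close> of least degree in X_n is compared with
          \<open>p\<close> twice. Dividing \<open>b\<close> by \<open>p\<close> shows that
          \<open>b\<close> has smaller degree than \<open>p\<close>; dividing \<open>p\<close> by
          \<open>b\<close> leaves no remainder, so \<open>b\<close> divides \<open>p\<close> up to
          factors from \<open>polys n\<close>.\<close>
        define S where "S b \<longleftrightarrow> b \<in> polys (Suc n) \<and> p dvd a * b \<and> \<not> p dvd b" for b
        have "S b0" using b0 by (simp add: S_def)
        then obtain b where b: "S b" "\<And>c. S c \<Longrightarrow> ?d b \<le> ?d c"
          using ex_has_least_nat[of S b0 ?d] by blast
        then have b': "b \<in> polys (Suc n)" "p dvd a * b" "\<not> p dvd b" "b \<noteq> 0" by (auto simp: S_def)
        have bp: "?d b < ?d p"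
        proof -
          obtain c q r where c: "c \<in> polys n" "c \<noteq> 0" "q \<in> polys (Suc n)" "r \<in> polys (Suc n)"
            "c * b = q * p + r" "r = 0 \<or> ?d r < ?d p"
            using mpoly_pseudo_division[OF b'(1) p(1,3)] by blast
          have "p dvd r"  if "\<not> ?thesis"
          proof (rule ccontr)
            assume "\<not> p dvd r"
            moreover have "a * r = c * (a * b) - (a * q) * p" using c(5) by (simp add: algebra_simps)
            then have "p dvd a * r" using b'(2) by (metis dvd_diff dvd_mult dvd_triv_right)
            ultimately have "S r" using c by (simp add: S_def)
            then show False using b(2)[of r] c(6) that \<open>\<not> p dvd r\<close> by auto
          qed
          moreover have "r = 0" if "p dvd r"
            using that c(6) d_dvd[of r] by fastforce
          moreover have False if "r = 0"
          proof -
            have "c * b = q * p" using c(5) that by simp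
            from cancel_polys_factor[OF IH c(1,2) this] obtain c1 c2 q' p' where
              "c1 \<in> polys n" "c2 \<in> polys n" "q = c1 * q'" "p = c2 * p'" "b = q' * p'" by blast
            then show False using absorb[of c2 p' b q'] b'(3) by (simp add: mult.commute)
          qed
          ultimately show ?thesis by blast
        qed
        obtain c q r where c: "c \<in> polys n" "c \<noteq> 0" "q \<in> polys (Suc n)" "r \<in> polys (Suc n)"
          "c * p = q * b + r" "r = 0 \<or> ?d r < ?d b"
          using mpoly_pseudo_division[OF p(1) b'(1,4)] by blast
        have "r = 0"
        proof (rule ccontr)
          assume r: "r \<noteq> 0"
          have "a * r = (a * c) * p - q * (a * b)" using c(5) by (simp add: algebra_simps)
          then have "p dvd a * r" using b'(2) by (metis dvd_diff dvd_mult dvd_triv_right)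
          moreover have "\<not> p dvd r"
            using r c(6) bp d_dvd[of r] by auto
          ultimately have "S r" using c by (simp add: S_def)
          then show False using b(2)[of r] c(6) r by auto
        qed
        then have "c * p = q * b" using c by simp
        from cancel_polys_factor[OF IH c(1,2) this] obtain c1 c2 q' b1 where
          *: "c1 \<in> polys n" "c2 \<in> polys n" "q = c1 * q'" "b = c2 * b1" "p = q' * b1" by blast
        have nz: "q' \<noteq> 0" "b1 \<noteq> 0" "c2 \<noteq> 0" using * p b' by auto
        have "\<not> q' dvd 1"
        proof
          assume "q' dvd 1"
          then have "q' \<in> polys n" using polys_dvd[of 1 n q'] by auto
          then have "?d p = ?d b" using * nz d0 d_mult by simp
          then show False using bp by simp
        qed
        \<comment> \<open>Now \<open>b\<close> itself lies in \<open>polys n\<close>, so it can be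
          cancelled from \<open>b * a = p * m\<close>, which makes \<open>p\<close> divide
          \<open>a\<close>.\<close>
        then have "b1 dvd 1" using p(2) *(5) by (auto simp: irreducible_def)
        then have "b1 \<in> polys n" using polys_dvd[of 1 n b1] by auto
        then have bn: "b \<in> polys n" using * by auto
        obtain m where "b * a = p * m" using b'(2) unfolding mult.commute[of a b] by (rule dvdE)
        from cancel_polys_factor[OF IH bn b'(4) this] obtain c1 c2 p' m' where
          "c1 \<in> polys n" "p = c1 * p'" "a = p' * m'" by blast
        then show False using absorb[of c1 p' a m'] b0(3) by blast
      qed
    qed (use IH p in blast)
  qed
  obtain n where "p \<in> polys n" using ex_polys by blast
  then show ?thesis using assms * by blast
qed

subsection \<open>Linear algebra over integral domains\<close>

text \<open>A nonzero element of least degree in the ideal of \<open>p\<close> and \<open>q\<close>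
  divides both up to scalars, by pseudo-division; primality of \<open>p\<close> forces its degree to
  be 0. The base ring will be a polynomial ring, and \<open>\<rho>\<close> acts as a resultant
  there: common roots are excluded where it does not vanish.\<close>

lemma prime_elem_poly_bezout:
  fixes p q :: "'a::idom poly"
  assumes p: "prime_elem p" "degree p > 0" and q: "\<not> p dvd q"
  shows "\<exists>\<alpha> \<beta> \<rho>. \<rho> \<noteq> 0 \<and> \<alpha> * p + \<beta> * q = [:\<rho>:]"
proof -
  define S where "S b \<longleftrightarrow> b \<noteq> 0 \<and> (\<exists>\<alpha> \<beta>. b = \<alpha> * p + \<beta> * q)" for b
  have "q \<noteq> 0" using q by auto
  then have "S q" unfolding S_def by (intro conjI exI[of _ 0] exI[of _ 1]) simp_all
  then obtain b where b: "S b" "\<And>c. S c \<Longrightarrow> degree b \<le> degree c"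
    using ex_has_least_nat[of S q degree] by blast
  obtain \<alpha> \<beta> where \<alpha>\<beta>: "b = \<alpha> * p + \<beta> * q" and "b \<noteq> 0" using b(1) by (auto simp: S_def)
  have exact: "\<exists>a k. a \<noteq> 0 \<and> [:a:] * x = b * k" if x: "x = u * p + v * q" for x u v
  proof -
    obtain a k where ak: "a \<noteq> 0" "smult a x = b * k + pseudo_mod x b"
      using pseudo_mod(1)[OF \<open>b \<noteq> 0\<close>, of x] by blast
    have "pseudo_mod x b = smult a x - b * k" using ak by simp
    also have "\<dots> = (smult a u - k * \<alpha>) * p + (smult a v - k * \<beta>) * q"
      unfolding x \<alpha>\<beta> by (simp add: algebra_simps smult_add_right)
    finally have "pseudo_mod x b \<noteq> 0 \<Longrightarrow> S (pseudo_mod x b)" unfolding S_def by blast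
    then have "pseudo_mod x b = 0"
      using b(2) pseudo_mod(2)[OF \<open>b \<noteq> 0\<close>, of x] by (metis not_le)
    then show ?thesis using ak by auto
  qed
  obtain a k where k: "a \<noteq> 0" "[:a:] * p = b * k"
    using exact[of p 1 0] by auto
  have "degree b = 0"
  proof -
    have "p dvd b * k" using k(2) by (metis dvd_triv_right)
    then consider "p dvd k" | "p dvd b" using p(1) prime_elem_dvd_mult_iff by blast
    then show ?thesis
    proof cases
      case 1
      then obtain m where "k = p * m" by (rule dvdE)
      then have "p * [:a:] = p * (b * m)" using k(2) by (simp add: algebra_simps)
      then have *: "[:a:] = b * m" using p(1) by (metis mult_left_cancel prime_elem_def)
      then have "b \<noteq> 0" "m \<noteq> 0" using k(1) by auto
      then show ?thesis using arg_cong[OF *, of degree] by (simp add: degree_mult_eq)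
    next
      case 2
      obtain a' k' where k': "a' \<noteq> 0" "[:a':] * q = b * k'" using exact[of q 0 1] by auto
      then have "p dvd [:a':] * q" using 2 by simp
      then have "p dvd [:a':]" using q p(1) prime_elem_dvd_mult_iff by blast
      then have "degree p \<le> 0" using k' by (metis degree_pCons_0 dvd_imp_degree_le pCons_eq_0_iff)
      then show ?thesis using p(2) by simp
    qed
  qed
  then obtain \<rho> where "b = [:\<rho>:]" by (metis degree_0_id)
  then show ?thesis using \<alpha>\<beta> \<open>b \<noteq> 0\<close> by (intro exI[of _ \<alpha>] exI[of _ \<beta>] exI[of _ \<rho>]) auto
qed

text \<open>Fraction-free Gaussian elimination, one column at a time, with \<open>\<delta>\<close>
  collecting the pivots. The index type of the equations may be infinite; the left inverse uses a
  finite set \<open>E\<close> of them.\<close>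

lemma kernel_or_left_inverse:
  fixes c :: "nat \<Rightarrow> 'e \<Rightarrow> 'a::idom"
  shows "(\<exists>k. (\<exists>j<N. k j \<noteq> 0) \<and> (\<forall>e. (\<Sum>j<N. k j * c j e) = 0)) \<or>
    (\<exists>E b \<delta>. finite E \<and> \<delta> \<noteq> 0 \<and>
      (\<forall>i<N. \<forall>j<N. (\<Sum>e\<in>E. b i e * c j e) = (if i = j then \<delta> else 0)))"
proof (induction N)
  case 0
  show ?case by (intro disjI2 exI[of _ "{}"] exI[of _ "\<lambda>_ _. 0"] exI[of _ 1]) auto
next
  case (Suc N)
  show ?case using Suc.IH
  proof
    assume "\<exists>k. (\<exists>j<N. k j \<noteq> 0) \<and> (\<forall>e. (\<Sum>j<N. k j * c j e) = 0)"
    then obtain k where "\<exists>j<N. k j \<noteq> 0" "\<forall>e. (\<Sum>j<N. k j * c j e) = 0" by blast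
    then show ?thesis
      by (intro disjI1 exI[of _ "k(N := 0)"]) (auto intro: less_SucI)
  next
    assume "\<exists>E b \<delta>. finite E \<and> \<delta> \<noteq> 0 \<and>
      (\<forall>i<N. \<forall>j<N. (\<Sum>e\<in>E. b i e * c j e) = (if i = j then \<delta> else 0))"
    then obtain E b \<delta> where E: "finite E" and \<delta>: "\<delta> \<noteq> 0"
      and b: "\<And>i j. i < N \<Longrightarrow> j < N \<Longrightarrow> (\<Sum>e\<in>E. b i e * c j e) = (if i = j then \<delta> else 0)" by blast
    define s where "s i = (\<Sum>e\<in>E. b i e * c N e)" for i
    \<comment> \<open>The new column scaled by \<open>\<delta>\<close>, reduced by the old ones. If
      it vanishes everywhere, this is the sought relation; otherwise some \<open>e0\<close> serves
      as pivot.\<close>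
    define r where "r e = \<delta> * c N e - (\<Sum>i<N. s i * c i e)" for e
    show ?thesis
    proof (cases "\<forall>e. r e = 0")
      case True
      then have "\<forall>e. (\<Sum>j<Suc N. (if j = N then \<delta> else - s j) * c j e) = 0"
        by (simp add: r_def sum_negf)
      then show ?thesis using \<delta> by (intro disjI1 exI[of _ "\<lambda>j. if j = N then \<delta> else - s j"]) auto
    next
      case False
      then obtain e0 where e0: "r e0 \<noteq> 0" by blast
      define E' where "E' = insert e0 E"
      have E': "finite E'" using E by (simp add: E'_def)
      define b1 where "b1 i e = (if e \<in> E then b i e else 0)" for i e
      have b1: "(\<Sum>e\<in>E'. b1 i e * x e) = (\<Sum>e\<in>E. b i e * x e)" for i x
        unfolding E'_def using E by (intro sum.mono_neutral_cong_right) (auto simp: b1_def)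
      \<comment> \<open>A functional that kills the old columns and takes the value
        \<open>r e0\<close> on the new one.\<close>
      define b' where "b' e = (if e = e0 then \<delta> else 0) - (\<Sum>j<N. c j e0 * b1 j e)" for e
      have b'_sum: "(\<Sum>e\<in>E'. b' e * x e) = \<delta> * x e0 - (\<Sum>j<N. c j e0 * (\<Sum>e\<in>E. b j e * x e))" for x
      proof -
        have "(\<Sum>e\<in>E'. b' e * x e) = (\<Sum>e\<in>E'. if e = e0 then \<delta> * x e0 else 0) -
            (\<Sum>e\<in>E'. \<Sum>j<N. c j e0 * b1 j e * x e)"
          by (auto simp: b'_def left_diff_distrib sum_subtractf sum_distrib_right intro!: sum.cong)
        also have "(\<Sum>e\<in>E'. \<Sum>j<N. c j e0 * b1 j e * x e) = (\<Sum>j<N. c j e0 * (\<Sum>e\<in>E'. b1 j e * x e))"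
          by (subst sum.swap) (simp add: sum_distrib_left mult.assoc)
        also have "(\<Sum>e\<in>E'. if e = e0 then \<delta> * x e0 else 0) = \<delta> * x e0"
          using E by (simp add: E'_def)
        finally show ?thesis by (simp only: b1)
      qed
      have b'_c: "(\<Sum>e\<in>E'. b' e * c j e) = 0" if "j < N" for j
      proof -
        have "(\<Sum>i<N. c i e0 * (\<Sum>e\<in>E. b i e * c j e)) = (\<Sum>i<N. if i = j then c j e0 * \<delta> else 0)"
          using b that by (intro sum.cong) auto
        then show ?thesis using that by (simp add: b'_sum mult.commute)
      qed
      have b'_N: "(\<Sum>e\<in>E'. b' e * c N e) = r e0"
        by (simp add: b'_sum r_def s_def mult.commute)
      \<comment> \<open>Correcting the old rows by \<open>b'\<close> makes them kill the new column;
        the common scalar becomes \<open>\<delta> * r e0\<close>.\<close>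
      define b2 where "b2 i e = (if i = N then \<delta> * b' e else r e0 * b1 i e - s i * b' e)" for i e
      have "(\<Sum>e\<in>E'. b2 i e * c j e) = (if i = j then \<delta> * r e0 else 0)"
        if "i < Suc N" "j < Suc N" for i j
      proof (cases "i = N")
        case True
        then have "(\<Sum>e\<in>E'. b2 i e * c j e) = \<delta> * (\<Sum>e\<in>E'. b' e * c j e)"
          by (simp add: b2_def sum_distrib_left mult.assoc)
        then show ?thesis using True that b'_N b'_c[of j] by (auto simp: less_Suc_eq)
      next
        case False
        then have "(\<Sum>e\<in>E'. b2 i e * c j e) = (\<Sum>e\<in>E'. r e0 * (b1 i e * c j e) - s i * (b' e * c j e))"
          by (intro sum.cong) (auto simp: b2_def algebra_simps)
        also have "\<dots> = r e0 * (\<Sum>e\<in>E. b i e * c j e) - s i * (\<Sum>e\<in>E'. b' e * c j e)"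
          by (simp add: sum_subtractf b1[symmetric] sum_distrib_left)
        finally show ?thesis
          using False that b'_N b'_c[of j] b[of i j] by (auto simp: less_Suc_eq s_def)
      qed
      then show ?thesis using E' \<delta> e0
        by (intro disjI2 exI[of _ E'] exI[of _ b2] exI[of _ "\<delta> * r e0"]) auto
    qed
  qed
qed

lemma injective_imp_left_inverse:
  fixes c :: "nat \<Rightarrow> 'e \<Rightarrow> 'a::idom"
  assumes inj: "\<And>k j. (\<And>e. (\<Sum>j<N. k j * c j e) = 0) \<Longrightarrow> j < N \<Longrightarrow> k j = 0"
  obtains E b \<delta> where "finite E" "\<delta> \<noteq> 0"
    "\<And>i j. i < N \<Longrightarrow> j < N \<Longrightarrow> (\<Sum>e\<in>E. b i e * c j e) = (if i = j then \<delta> else 0)"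
proof -
  have "\<not> (\<exists>k. (\<exists>j<N. k j \<noteq> 0) \<and> (\<forall>e. (\<Sum>j<N. k j * c j e) = 0))"
  proof (intro notI, elim exE conjE)
    fix k j assume "j < N" "k j \<noteq> 0" "\<forall>e. (\<Sum>j<N. k j * c j e) = 0"
    then show False using inj[of k j] by simp
  qed
  then obtain E b \<delta> where "finite E" "\<delta> \<noteq> 0"
    "\<forall>i<N. \<forall>j<N. (\<Sum>e\<in>E. b i e * c j e) = (if i = j then \<delta> else 0)"
    using kernel_or_left_inverse[of N c] by (elim disjE exE conjE) auto
  then show thesis using that[of E \<delta> b] by blast
qed

lemma left_inverse_injective:
  fixes c :: "nat \<Rightarrow> 'e \<Rightarrow> 'a::idom"
  assumes "\<delta> \<noteq> 0"
    and "\<And>i j. i < N \<Longrightarrow> j < N \<Longrightarrow> (\<Sum>e\<in>E. b i e * c j e) = (if i = j then \<delta> else 0)"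
    and "\<And>e. (\<Sum>j<N. k j * c j e) = 0" "i < N"
  shows "k i = 0"
proof -
  have "0 = (\<Sum>e\<in>E. b i e * (\<Sum>j<N. k j * c j e))" using assms(3) by simp
  also have "\<dots> = (\<Sum>j<N. k j * (\<Sum>e\<in>E. b i e * c j e))"
    by (simp add: sum_distrib_left mult.left_commute) (rule sum.swap)
  also have "\<dots> = (\<Sum>j<N. if j = i then k i * \<delta> else 0)"
    using assms(2,4) by (intro sum.cong) auto
  finally show ?thesis using assms(1,4) by simp
qed

text \<open>The scalar \<open>\<delta>\<close> of a left inverse is a nonzero polynomial; at a point
  where it does not vanish the left inverse specializes along with the columns.\<close>

lemma generic_injective:
  fixes c :: "nat \<Rightarrow> 'e \<Rightarrow> 'a::{idom,ring_char_0} mpoly"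
  assumes "\<And>k j. (\<And>e. (\<Sum>j<N. k j * c j e) = 0) \<Longrightarrow> j < N \<Longrightarrow> k j = 0"
  shows "\<exists>x. \<forall>k. (\<forall>e. (\<Sum>j<N. k j * mpoly_eval id x (c j e)) = 0) \<longrightarrow> (\<forall>j<N. k j = 0)"
proof -
  obtain E b \<delta> where E: "finite E" "\<delta> \<noteq> 0"
    and b: "\<And>i j. i < N \<Longrightarrow> j < N \<Longrightarrow> (\<Sum>e\<in>E. b i e * c j e) = (if i = j then \<delta> else 0)"
    by (rule injective_imp_left_inverse[where c = c and N = N]) (use assms in blast)+
  obtain n where "\<delta> \<in> polys n" using ex_polys by blast
  then obtain x where x: "mpoly_eval id x \<delta> \<noteq> 0" using mpoly_nonvanishing E by blast
  define h where "h = (mpoly_eval id x :: 'a mpoly \<Rightarrow> 'a)"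
  interpret comm_ring_hom h unfolding h_def by (rule mpoly_eval_hom[OF id_comm_ring_hom(1)])
  have *: "(\<Sum>e\<in>E. h (b i e) * h (c j e)) = (if i = j then h \<delta> else 0)" if "i < N" "j < N" for i j
    using arg_cong[OF b[OF that], of h] by (simp add: hom_sum hom_mult split: if_splits)
  have "k i = 0" if "\<And>e. (\<Sum>j<N. k j * h (c j e)) = 0" "i < N" for k i
    by (rule left_inverse_injective[where \<delta> = "h \<delta>" and E = E and b = "\<lambda>i e. h (b i e)"
        and c = "\<lambda>j e. h (c j e)" and N = N and k = k])
      (use x * that h_def in simp_all)
  then show ?thesis unfolding h_def by blast
qed

section \<open>Closure properties of forms, and openness of injectivity\<close>

lemma homogeneous_0 [simp]: "homogeneous d 0"
  by (simp add: homogeneous_def)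

lemma homogeneous_const [simp]: "homogeneous 0 (const_poly c)"
  by (auto simp: homogeneous_def const_poly_def monom_degree_def split: if_splits)

lemma homogeneous_1 [simp]: "homogeneous 0 (1 :: 'a::comm_ring_1 mpoly)"
  using homogeneous_const[of "1::'a"] by (simp del: homogeneous_const)

lemma homogeneous_var: "homogeneous 1 (var_poly i)"
  by (auto simp: homogeneous_def var_poly_def monom_degree_def split: if_splits)

lemma homogeneous_add: "homogeneous d p \<Longrightarrow> homogeneous d q \<Longrightarrow> homogeneous d (p + q)"
  using Poly_Mapping.keys_add[of p q] unfolding homogeneous_def by blast

lemma monom_degree_add: "monom_degree (a + b) = monom_degree a + monom_degree b"
proof -
  have *: "monom_degree m = (\<Sum>i\<in>S. Poly_Mapping.lookup m i)"
    if "finite S" "Poly_Mapping.keys m \<subseteq> S" for m S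
    unfolding monom_degree_def using that by (intro sum.mono_neutral_left) (auto simp: in_keys_iff)
  let ?S = "Poly_Mapping.keys a \<union> Poly_Mapping.keys b"
  show ?thesis
    by (simp add: *[of ?S] Poly_Mapping.keys_add lookup_add sum.distrib)
qed

lemma homogeneous_mult: "homogeneous d p \<Longrightarrow> homogeneous e q \<Longrightarrow> homogeneous (d + e) (p * q)"
proof -
  assume *: "homogeneous d p" "homogeneous e q"
  show ?thesis unfolding homogeneous_def
  proof
    fix m assume "m \<in> Poly_Mapping.keys (p * q)"
    then obtain a b where "a \<in> Poly_Mapping.keys p" "b \<in> Poly_Mapping.keys q" "m = a + b"
      using keys_mult[of p q] by blast
    then show "monom_degree m = d + e" using * by (simp add: homogeneous_def monom_degree_add)
  qed
qed

lemma homogeneous_uminus: "homogeneous d p \<Longrightarrow> homogeneous d (- p)"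
  for p :: "'a::ab_group_add mpoly"
  by (simp add: homogeneous_def in_keys_iff)

lemma homogeneous_diff: "homogeneous d p \<Longrightarrow> homogeneous d q \<Longrightarrow> homogeneous d (p - q)"
  for p q :: "'a::ab_group_add mpoly"
  using homogeneous_add[of d p "- q"] homogeneous_uminus[of d q] by simp

lemma homogeneous_sum: "(\<And>i. i \<in> A \<Longrightarrow> homogeneous d (f i)) \<Longrightarrow> homogeneous d (sum f A)"
  by (induction A rule: infinite_finite_induct) (auto intro: homogeneous_add)

lemma homogeneous_prod:
  "(\<And>i. i \<in> A \<Longrightarrow> homogeneous (d i) (f i)) \<Longrightarrow> homogeneous (sum d A) (prod f A)"
  for f :: "'b \<Rightarrow> 'a::comm_ring_1 mpoly"
  by (induction A rule: infinite_finite_induct) (auto intro: homogeneous_mult)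

lemma homogeneous_const_mult: "homogeneous d p \<Longrightarrow> homogeneous d (const_poly c * p)"
  using homogeneous_mult[OF homogeneous_const, of d p] by simp

text \<open>Injectivity is witnessed by an \<open>N\<close> by \<open>N\<close> determinant whose
  rows combine the equations with constant coefficients, namely those of a left inverse at
  \<open>x0\<close>. At \<open>x0\<close> the matrix is a scalar matrix; elsewhere its entries keep
  the degree \<open>d\<close> of the columns, which gives \<open>N * d\<close>.\<close>

lemma injective_open:
  fixes c :: "nat \<Rightarrow> 'e \<Rightarrow> 'a::{idom,ring_char_0} mpoly"
  assumes c: "\<And>j e. j < N \<Longrightarrow> c j e \<in> polys m" "\<And>j e. j < N \<Longrightarrow> homogeneous d (c j e)"
    and inj: "\<And>k j. (\<And>e. (\<Sum>j<N. k j * mpoly_eval id x0 (c j e)) = 0) \<Longrightarrow> j < N \<Longrightarrow> k j = 0"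
  shows "\<exists>W \<in> polys m. homogeneous (N * d) W \<and> W \<noteq> 0 \<and> (\<forall>x. mpoly_eval id x W \<noteq> 0 \<longrightarrow>
    (\<forall>k. (\<forall>e. (\<Sum>j<N. k j * mpoly_eval id x (c j e)) = 0) \<longrightarrow> (\<forall>j<N. k j = 0)))"
proof -
  define h where "h x = (mpoly_eval id x :: 'a mpoly \<Rightarrow> 'a)" for x
  have h: "comm_ring_hom (h x)" for x unfolding h_def by (rule mpoly_eval_hom[OF id_comm_ring_hom(1)])
  obtain E b \<delta> where E: "finite E" "\<delta> \<noteq> 0"
    and b: "\<And>i j. i < N \<Longrightarrow> j < N \<Longrightarrow> (\<Sum>e\<in>E. b i e * h x0 (c j e)) = (if i = j then \<delta> else 0)"
    by (rule injective_imp_left_inverse[where c = "\<lambda>j e. h x0 (c j e)" and N = N])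
      (use inj[folded h_def] in blast)+
  define M where "M = mat N N (\<lambda>(i, j). \<Sum>e\<in>E. const_poly (b i e) * c j e)"
  have M: "M \<in> carrier_mat N N" by (simp add: M_def)
  have hM: "map_mat (h x) M = mat N N (\<lambda>(i, j). \<Sum>e\<in>E. b i e * h x (c j e))" for x
  proof -
    interpret comm_ring_hom "h x" by (rule h)
    have "h x (const_poly a) = a" for a by (simp add: h_def)
    then show ?thesis by (intro eq_matI) (auto simp: M_def hom_sum hom_mult)
  qed
  have h_det: "h x (det M) = det (mat N N (\<lambda>(i, j). \<Sum>e\<in>E. b i e * h x (c j e)))" for x
    using comm_ring_hom.hom_det[OF h, of x M] hM by simp
  have "mat N N (\<lambda>(i, j). \<Sum>e\<in>E. b i e * h x0 (c j e)) = \<delta> \<cdot>\<^sub>m 1\<^sub>m N"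
    using b by (intro eq_matI) auto
  then have "h x0 (det M) \<noteq> 0" using E unfolding h_det by simp
  then have nz: "det M \<noteq> 0" unfolding h_def by auto
  have sign: "(signof p :: 'a mpoly) \<in> polys m \<and> homogeneous 0 (signof p :: 'a mpoly)" for p :: "nat \<Rightarrow> nat"
    by (auto simp: sign_def homogeneous_uminus)
  have M_entry: "M $$ (i, j) \<in> polys m \<and> homogeneous d (M $$ (i, j))" if "i < N" "j < N" for i j
    using that c by (auto simp: M_def intro!: homogeneous_sum homogeneous_const_mult)
  have perm: "p i < N" if "p permutes {0..<N}" "i < N" for p i
    using that permutes_in_image by fastforce
  have "det M \<in> polys m"
    unfolding det_def'[OF M] using sign M_entry perm
    by (intro sum_in_polys mult_in_polys prod_in_polys) auto
  moreover have "homogeneous (N * d) (det M)"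
    unfolding det_def'[OF M]
  proof (rule homogeneous_sum)
    fix p assume p: "p \<in> {p. p permutes {0..<N}}"
    have "homogeneous (0 + (\<Sum>i = 0..<N. d)) (signof p * (\<Prod>i = 0..<N. M $$ (i, p i)))"
      using sign M_entry perm p by (intro homogeneous_mult homogeneous_prod) auto
    then show "homogeneous (N * d) (signof p * (\<Prod>i = 0..<N. M $$ (i, p i)))" by simp
  qed
  moreover have "k j = 0" if x: "h x (det M) \<noteq> 0" "\<And>e. (\<Sum>j<N. k j * h x (c j e)) = 0" "j < N" for x k j
  proof -
    let ?A = "mat N N (\<lambda>(i, j). \<Sum>e\<in>E. b i e * h x (c j e))"
    have A: "?A \<in> carrier_mat N N" by simp
    have "?A *\<^sub>v vec N k = 0\<^sub>v N"
    proof (rule eq_vecI)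
      fix i assume "i < dim_vec (0\<^sub>v N :: 'a vec)"
      then have i: "i < N" by simp
      have "(?A *\<^sub>v vec N k) $ i = (\<Sum>j<N. (\<Sum>e\<in>E. b i e * h x (c j e)) * k j)"
        using i by (simp add: scalar_prod_def lessThan_atLeast0)
      also have "\<dots> = (\<Sum>e\<in>E. b i e * (\<Sum>j<N. k j * h x (c j e)))"
        by (simp add: sum_distrib_left sum_distrib_right sum.swap[of _ E] algebra_simps)
      finally show "(?A *\<^sub>v vec N k) $ i = 0\<^sub>v N $ i" using x i by simp
    qed simp
    moreover have "det ?A \<noteq> 0" using x(1) by (simp only: h_det not_False_eq_True)
    ultimately have "vec N k = 0\<^sub>v N"
      using det_0_iff_vec_prod_zero[OF A] vec_carrier[of N k] by blast
    then show ?thesis using x(3) by (metis index_vec index_zero_vec(1))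
  qed
  ultimately show ?thesis using nz unfolding h_def
    by (intro bexI[of _ "det M"] conjI allI impI) auto
qed

text \<open>The coordinate at 1 with respect to a Q-basis of C containing 1. A complex number is
  rational exactly if it is fixed by this map.\<close>

lemma rational_functional:
  "\<exists>\<phi> :: complex \<Rightarrow> rat. \<phi> 1 = 1 \<and> (\<forall>a b. \<phi> (a + b) = \<phi> a + \<phi> b) \<and> (\<forall>q a. \<phi> (of_rat q * a) = q * \<phi> a)"
proof -
  interpret vector_space "\<lambda>(q::rat) (z::complex). of_rat q * z"
    by unfold_locales (auto simp: algebra_simps of_rat_add of_rat_mult)
  define B where "B = extend_basis {1::complex}"
  have ind: "independent {1::complex}" by (simp add: dependent_single)
  have B: "independent B" "span B = UNIV" "1 \<in> B"
    using extend_basis_superset[OF ind] independent_extend_basis[OF ind] span_extend_basis[OF ind]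
    by (auto simp: B_def)
  show ?thesis
  proof (intro exI[of _ "\<lambda>z. representation B z 1"] conjI allI)
    show "representation B 1 1 = 1" using representation_basis[OF B(1,3)] by simp
    show "representation B (a + b) 1 = representation B a 1 + representation B b 1" for a b
      using representation_add[OF B(1), of b a] B(2) by simp
    show "representation B (of_rat q * a) 1 = q * representation B a 1" for q a
      using representation_scale[OF B(1), of a q] B(2) by simp
  qed
qed

subsection \<open>Closed forms on plane curves\<close>

text \<open>In bivariate polynomials the outer variable is \<open>x\<close> and the inner one is \<open>y\<close>.\<close>

definition pderiv_y :: "'a::idom poly poly \<Rightarrow> 'a poly poly" where
  "pderiv_y = map_poly pderiv"

lemma coeff_pderiv_y [simp]: "coeff (pderiv_y f) i = pderiv (coeff f i)"
  by (simp add: pderiv_y_def coeff_map_poly)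

lemma pderiv_y_add: "pderiv_y (f + g) = pderiv_y f + pderiv_y g"
  by (intro poly_eqI) (simp add: pderiv_add)

lemma pderiv_y_diff: "pderiv_y (f - g) = pderiv_y f - pderiv_y g"
  by (intro poly_eqI) (simp add: pderiv_diff)

lemma pderiv_y_mult: "pderiv_y (f * g) = pderiv_y f * g + f * pderiv_y g"
  by (intro poly_eqI, simp only: coeff_mult coeff_add coeff_pderiv_y pderiv_sum pderiv_mult sum.distrib)
    (simp add: mult.commute add.commute)

lemma pderiv_y_power_Suc:
  "pderiv_y (f ^ Suc n) = of_nat (Suc n) * f ^ n * pderiv_y f"
proof (induction n)
  case (Suc n)
  have "pderiv_y (f ^ Suc (Suc n)) = pderiv_y f * f ^ Suc n + f * (of_nat (Suc n) * f ^ n * pderiv_y f)"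
    by (simp only: power_Suc[of f "Suc n"] pderiv_y_mult Suc.IH)
  then show ?case by (simp add: algebra_simps)
qed (simp add: pderiv_y_mult)

lemma pderiv_y_0 [simp]: "pderiv_y 0 = 0"
  by (simp add: pderiv_y_def)

lemma pderiv_y_const: "pderiv_y [:a:] = [:pderiv a:]"
  by (intro poly_eqI) (simp add: coeff_pCons split: nat.split)

lemma pderiv_pderiv_y: "pderiv (pderiv_y f) = pderiv_y (pderiv f)"
  by (intro poly_eqI) (simp add: coeff_pderiv pderiv_mult pderiv_of_nat pderiv_add pderiv_1)

text \<open>\<open>f\<^sup>2\<close> times the derivative of the 1-form \<open>(g dx + h dy) / f\<close>, up to sign.\<close>

definition closed_form :: "'a::idom poly poly \<Rightarrow> 'a poly poly \<Rightarrow> 'a poly poly \<Rightarrow> 'a poly poly" where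
  "closed_form f g h = f * (pderiv_y g - pderiv h) - g * pderiv_y f + h * pderiv f"

abbreviation at0 :: "'a::idom poly poly \<Rightarrow> 'a" where
  "at0 f \<equiv> poly (poly f 0) 0"

abbreviation varX :: "'a::idom poly poly" where "varX \<equiv> [:0, 1:]"
abbreviation varY :: "'a::idom poly poly" where "varY \<equiv> [:[:0, 1:]:]"

lemma at0_decompose:
  assumes "at0 u = 0" obtains u1 u2 where "u = varX * u1 + varY * u2"
proof -
  obtain a u1 where u: "u = pCons a u1" by (cases u)
  obtain b a1 where a: "a = pCons b a1" by (cases a)
  have "u = varX * u1 + varY * [:a1:]" using assms by (simp add: u a)
  then show thesis using that by blast
qed

lemma not_dvd_varY_power:
  assumes "degree f > 0" shows "\<not> f dvd (varY :: 'a::idom poly poly) ^ m"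
proof
  assume "f dvd varY ^ m"
  moreover have *: "varY ^ m = [:[:0, 1:] ^ m :: 'a poly:]" by (simp add: poly_const_pow)
  moreover have "[:[:0, 1:] ^ m :: 'a poly:] \<noteq> 0" by simp
  ultimately have "degree f \<le> 0" using dvd_imp_degree_le by (metis degree_pCons_0)
  then show False using assms by simp
qed

text \<open>The origin is a smooth point of the curve with local parameter y, as
  \<open>pderiv f\<close> does not vanish there. In the local ring, where \<open>s\<close> is a
  denominator, \<open>g\<close> is shown to vanish to every order: differentiating along the curve
  gains one order at a time, in characteristic 0.\<close>

lemma closed_form_vanishing_order:
  fixes f g h :: "'a::{idom,ring_char_0} poly poly"
  assumes f: "prime_elem f" "degree f > 0" "at0 f = 0" "at0 (pderiv f) \<noteq> 0"
    and gh: "closed_form f g h = 0" "at0 g = 0"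
  shows "\<exists>s \<alpha> \<beta>. at0 s \<noteq> 0 \<and> s * g = \<alpha> * f + \<beta> * varY ^ Suc m"
proof (induction m)
  case 0
  obtain f1 f2 where f12: "f = varX * f1 + varY * f2" using at0_decompose[OF f(3)] by blast
  obtain g1 g2 where g12: "g = varX * g1 + varY * g2" using at0_decompose[OF gh(2)] by blast
  have "at0 f1 \<noteq> 0"
    using f(4) by (simp add: f12 pderiv_add pderiv_mult pderiv_pCons pderiv_smult)
  moreover have "f1 * g = g1 * f + (f1 * g2 - f2 * g1) * varY ^ Suc 0"
  proof -
    have "f1 * (x * g1 + y * g2) = g1 * (x * f1 + y * f2) + (f1 * g2 - f2 * g1) * y" for x y
      by (simp add: algebra_simps)
    then show ?thesis by (simp only: f12 g12 power_Suc power_0 mult_1_right)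
  qed
  ultimately show ?case by blast
next
  case (Suc m)
  then obtain s \<alpha> \<beta> where s: "at0 s \<noteq> 0" and sg: "s * g = \<alpha> * f + \<beta> * varY ^ Suc m" by blast
  define fx fy where "fx = pderiv f" and "fy = pderiv_y f"
  define fxx fxy where "fxx = pderiv fx" and "fxy = pderiv fy"
  \<comment> \<open>The derivation tangent to the curve: it kills \<open>f\<close>, and it sends y
    to \<open>fx\<close>, a unit at the origin.\<close>
  define D where "D a = fx * pderiv_y a - fy * pderiv a" for a
  have D_add: "D (a + b) = D a + D b" for a b
    by (simp add: D_def pderiv_add pderiv_y_add algebra_simps)
  have D_mult: "D (a * b) = D a * b + a * D b" for a b
    by (simp add: D_def pderiv_mult pderiv_y_mult algebra_simps)
  have D_f: "D f = 0" by (simp add: D_def fx_def fy_def)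
  have D_Y: "D (varY ^ Suc m) = of_nat (Suc m) * varY ^ m * fx"
  proof -
    have "pderiv ((varY :: 'a poly poly) ^ Suc m) = 0" by (simp add: poly_const_pow pderiv_pCons del: power_Suc)
    moreover have "pderiv_y (varY :: 'a poly poly) = 1" by (simp add: pderiv_y_const pderiv_pCons one_pCons)
    ultimately show ?thesis unfolding D_def pderiv_y_power_Suc by (simp add: algebra_simps)
  qed
  define v where "v = pderiv_y g - pderiv h"
  define u where "u = pderiv v"
  have v: "f * v = g * fy - h * fx"
    using gh(1) by (simp add: closed_form_def v_def fx_def fy_def algebra_simps)
  have "pderiv (f * v) = pderiv (g * fy - h * fx)" using v by simp
  then have "f * u + v * fx = g * fxy + pderiv g * fy - (h * fxx + pderiv h * fx)"
    by (simp add: pderiv_mult pderiv_diff u_def fx_def[symmetric] fxx_def[symmetric] fxy_def[symmetric] algebra_simps)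
  then have "D g = g * fxy - h * fxx - f * u"
    by (simp add: D_def v_def algebra_simps)
  then have "fx * D g = fx * (g * fxy - h * fxx - f * u)" by (rule arg_cong)
  also have "\<dots> = g * (fx * fxy) - (h * fx) * fxx - f * u * fx" by (simp add: algebra_simps)
  also have "h * fx = g * fy - f * v" using v by simp
  finally have Dg: "fx * D g = g * (fx * fxy - fy * fxx) + f * (v * fxx - u * fx)" by (simp add: algebra_simps)
  \<comment> \<open>Here \<open>t\<close> is \<open>D fx\<close>, so the identity says that the
    derivative of \<open>g / fx\<close> vanishes modulo \<open>f\<close>. This is what closedness
    provides.\<close>
  define t \<kappa> where "t = fx * fxy - fy * fxx" and "\<kappa> = v * fxx - u * fx"
  have Dg: "fx * D g = g * t + f * \<kappa>" using Dg by (simp add: t_def \<kappa>_def)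
  have "D (s * g) = D (\<alpha> * f + \<beta> * varY ^ Suc m)" using sg by simp
  then have Dsg: "D s * g + s * D g = D \<alpha> * f + D \<beta> * varY ^ Suc m + \<beta> * (of_nat (Suc m) * varY ^ m * fx)"
    by (simp only: D_add D_mult D_f D_Y) simp
  define q where "q = fx * D s + s * t"
  define n where "n = (of_nat (Suc m) :: 'a poly poly)"
  \<comment> \<open>Applying \<open>D\<close> to the relation for \<open>s * g\<close> and
    eliminating \<open>g\<close> leaves a multiple of \<open>f\<close>. Cancelling
    \<open>varY ^ m\<close> modulo the prime \<open>f\<close> then shows that
    \<open>\<beta>\<close>, times a unit at the origin, is a multiple of y on the curve.\<close>
  have "varY ^ m * (n * s * \<beta> * fx\<^sup>2 + varY * (s * fx * D \<beta> - q * \<beta>)) =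
      f * (q * \<alpha> + s\<^sup>2 * \<kappa> - s * fx * D \<alpha>)"
  proof -
    have Y: "varY ^ Suc m = (varY :: 'a poly poly) * varY ^ m" by simp
    define y Ym where "y = (varY :: 'a poly poly)" and "Ym = (varY :: 'a poly poly) ^ m"
    have e1: "D s * g + s * D g = D \<alpha> * f + D \<beta> * (y * Ym) + \<beta> * (n * Ym * fx)"
      using Dsg by (simp only: Y n_def y_def Ym_def)
    have e2: "s * g = \<alpha> * f + \<beta> * (y * Ym)" using sg by (simp only: Y y_def Ym_def)
    have "Ym * (n * s * \<beta> * fx\<^sup>2 + y * (s * fx * D \<beta> - q * \<beta>)) = f * (q * \<alpha> + s\<^sup>2 * \<kappa> - s * fx * D \<alpha>)"
    proof -
      have "Ym * (n * s * \<beta> * fx\<^sup>2 + y * (s * fx * D \<beta> - q * \<beta>)) =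
          s * fx * (D \<alpha> * f + D \<beta> * (y * Ym) + \<beta> * (n * Ym * fx)) - s * fx * D \<alpha> * f - q * (\<beta> * (y * Ym))"
        by (simp add: algebra_simps power2_eq_square)
      also have "\<dots> = s * fx * (D s * g + s * D g) - s * fx * D \<alpha> * f - q * (s * g - \<alpha> * f)"
        using e1 e2 by simp
      also have "\<dots> = fx * D s * (s * g) + s\<^sup>2 * (fx * D g) - s * fx * D \<alpha> * f - q * (s * g - \<alpha> * f)"
        by (simp add: algebra_simps power2_eq_square)
      also have "\<dots> = f * (q * \<alpha> + s\<^sup>2 * \<kappa> - s * fx * D \<alpha>)"
        unfolding Dg q_def by (simp add: algebra_simps power2_eq_square)
      finally show ?thesis .
    qed
    then show ?thesis by (simp only: y_def Ym_def)
  qed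
  then have "f dvd varY ^ m * (n * s * \<beta> * fx\<^sup>2 + varY * (s * fx * D \<beta> - q * \<beta>))" by simp
  then have "f dvd n * s * \<beta> * fx\<^sup>2 + varY * (s * fx * D \<beta> - q * \<beta>)"
    using prime_elem_dvd_mult_iff[OF f(1)] not_dvd_varY_power[OF f(2)] by blast
  then obtain \<omega> where \<omega>: "n * s * \<beta> * fx\<^sup>2 + varY * (s * fx * D \<beta> - q * \<beta>) = f * \<omega>" by (rule dvdE)
  define \<gamma> where "\<gamma> = s * fx * D \<beta> - q * \<beta>"
  have "(n * s\<^sup>2 * fx\<^sup>2) * g = (n * s * fx\<^sup>2 * \<alpha> + \<omega> * varY ^ Suc m) * f + (- \<gamma>) * varY ^ Suc (Suc m)"
  proof -
    define y Ym where "y = (varY :: 'a poly poly)" and "Ym = (varY :: 'a poly poly) ^ Suc m"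
    have e1: "s * g = \<alpha> * f + \<beta> * Ym" using sg by (simp only: Ym_def)
    have e2: "n * s * \<beta> * fx\<^sup>2 + y * \<gamma> = f * \<omega>" using \<omega> by (simp only: y_def \<gamma>_def)
    have e2': "n * s * \<beta> * fx\<^sup>2 = f * \<omega> - y * \<gamma>" using e2 by (simp add: algebra_simps)
    have "(n * s\<^sup>2 * fx\<^sup>2) * g = n * s * fx\<^sup>2 * (s * g)" by (simp add: algebra_simps power2_eq_square)
    also have "\<dots> = n * s * fx\<^sup>2 * \<alpha> * f + (n * s * \<beta> * fx\<^sup>2) * Ym" unfolding e1 by (simp add: algebra_simps)
    also have "\<dots> = (n * s * fx\<^sup>2 * \<alpha> + \<omega> * Ym) * f + (- \<gamma>) * (y * Ym)"
      unfolding e2' by (simp add: algebra_simps)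
    finally have "(n * s\<^sup>2 * fx\<^sup>2) * g = (n * s * fx\<^sup>2 * \<alpha> + \<omega> * Ym) * f + (- \<gamma>) * (y * Ym)" .
    then show ?thesis by (simp only: y_def Ym_def power_Suc)
  qed
  moreover have "at0 (n * s\<^sup>2 * fx\<^sup>2) \<noteq> 0"
    using s f(4) by (simp add: n_def fx_def del: of_nat_Suc)
  ultimately show ?case by blast
qed

text \<open>
  On the curve \<open>f = 0\<close> the ratio \<open>g / f\<^sub>x\<close> has derivative zero; if it vanishes at a smooth point,
  it vanishes there to all orders.
\<close>

lemma closed_form_dvd:
  fixes f g h :: "'a::{idom,ring_char_0} poly poly"
  assumes f: "prime_elem f" "degree f > 0" "at0 f = 0" "at0 (pderiv f) \<noteq> 0"
    and gh: "closed_form f g h = 0" "at0 g = 0"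
  shows "f dvd g"
proof (rule ccontr)
  assume "\<not> f dvd g"
  from prime_elem_poly_bezout[OF f(1,2) this] obtain a b \<rho> where
    \<rho>: "\<rho> \<noteq> 0" "a * f + b * g = [:\<rho>:]" by blast
  obtain \<rho>1 where \<rho>1: "\<rho> = [:0, 1:] ^ order 0 \<rho> * \<rho>1" "\<not> [:0, 1:] dvd \<rho>1"
    using order_decomp[OF \<rho>(1), of 0] by auto
  \<comment> \<open>The exact order of y in the resultant \<open>\<rho>\<close>. Vanishing of
    \<open>g\<close> to order \<open>m + 1\<close> is one more than \<open>\<rho>\<close> allows: it
    would force \<open>\<rho>1\<close> to vanish at 0.\<close>
  define m where "m = order 0 \<rho>"
  have \<rho>Y: "[:\<rho>:] = varY ^ m * [:\<rho>1:]" using \<rho>1(1) by (simp add: m_def poly_const_pow mult.commute)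
  obtain s \<alpha> \<beta> where s: "at0 s \<noteq> 0" "s * g = \<alpha> * f + \<beta> * varY ^ Suc m"
    using closed_form_vanishing_order[OF assms] by blast
  have "varY ^ m * (s * [:\<rho>1:] - b * \<beta> * varY) = f * (s * a + b * \<alpha>)"
  proof -
    define y Ym R where "y = (varY :: 'a poly poly)" and "Ym = (varY :: 'a poly poly) ^ m" and "R = [:\<rho>1:]"
    have e1: "\<beta> * (y * Ym) = s * g - \<alpha> * f" using s(2) by (simp only: y_def Ym_def power_Suc) simp
    have e2: "Ym * R = a * f + b * g" using \<rho>(2) \<rho>Y by (simp only: Ym_def R_def)
    have "Ym * (s * R - b * \<beta> * y) = s * (Ym * R) - b * (\<beta> * (y * Ym))" by (simp add: algebra_simps)
    also have "\<dots> = f * (s * a + b * \<alpha>)" unfolding e1 e2 by (simp add: algebra_simps)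
    finally show ?thesis by (simp only: y_def Ym_def R_def)
  qed
  then have "f dvd varY ^ m * (s * [:\<rho>1:] - b * \<beta> * varY)" by simp
  then have "f dvd s * [:\<rho>1:] - b * \<beta> * varY"
    using prime_elem_dvd_mult_iff[OF f(1)] not_dvd_varY_power[OF f(2)] by blast
  then obtain k where "s * [:\<rho>1:] - b * \<beta> * varY = f * k" by (rule dvdE)
  then have "at0 (s * [:\<rho>1:] - b * \<beta> * varY) = 0" using f(3) by simp
  then have "poly \<rho>1 0 = 0" using s(1) by simp
  then show False using \<rho>1(2) by (simp add: poly_eq_0_iff_dvd)
qed

text \<open>Subtracting a multiple of df makes \<open>g\<close> vanish at the origin. Then
  \<open>f\<close> divides the difference, whose degree in x is too small, so the form is a multiple
  of df. The normalized coefficient at x^(d-1), which for df is \<open>d\<close> times a nonzero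
  leading coefficient, forces that multiple to be 0.\<close>

lemma closed_form_unique:
  fixes f g h :: "'a::{idom,ring_char_0} poly poly"
  assumes f: "prime_elem f" "degree f = d" "d > 0" "at0 f = 0" "at0 (pderiv f) \<noteq> 0"
    and lead: "coeff (coeff f d) 0 \<noteq> 0"
    and gh: "closed_form f g h = 0" "degree g < d" "degree h < d" "coeff (coeff g (d - 1)) 0 = 0"
  shows "g = 0 \<and> h = 0"
proof -
  have fx: "degree (pderiv f) < d" "pderiv f \<noteq> 0" using f by (auto simp: degree_pderiv)
  have small: "k = 0" if "f dvd k" "degree k < d" for k
    using that f(2) dvd_imp_degree_le by (metis not_le)
  \<comment> \<open>The multiple to subtract is the value of \<open>g / pderiv f\<close> at the
    origin, cross-multiplied because the coefficients only form a domain.\<close>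
  define a b where "a = [:[:at0 (pderiv f):]:]" and "b = [:[:at0 g:]:]"
  have [simp]: "pderiv a = 0" "pderiv b = 0" "pderiv_y a = 0" "pderiv_y b = 0"
    by (simp_all add: a_def b_def pderiv_pCons pderiv_y_const)
  have "closed_form f (a * g - b * pderiv f) (a * h - b * pderiv_y f) =
      a * closed_form f g h"
    by (simp add: closed_form_def pderiv_diff pderiv_mult pderiv_y_diff pderiv_y_mult pderiv_pderiv_y algebra_simps)
  moreover have "at0 (a * g - b * pderiv f) = 0" by (simp add: a_def b_def)
  ultimately have "f dvd a * g - b * pderiv f"
    using closed_form_dvd[OF f(1) _ f(4,5)] f(2,3) gh(1) by simp
  moreover have "degree (a * g - b * pderiv f) < d"
    using fx gh(2) by (intro degree_diff_less) (auto simp: a_def b_def intro: le_less_trans[OF degree_smult_le])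
  ultimately have ab: "a * g = b * pderiv f" using small[of "a * g - b * pderiv f"] by simp
  have "coeff (coeff (a * g) (d - 1)) 0 = 0" using gh(4) by (simp add: a_def)
  then have "at0 g * (of_nat d * coeff (coeff f d) 0) = 0"
    using f(3) unfolding ab by (simp add: b_def coeff_pderiv of_nat_poly)
  then have "at0 g = 0" using lead f(3) by simp
  then have "a * g = 0" using ab by (simp add: b_def)
  then have g: "g = 0" using f(5) by (simp add: a_def)
  then have "f dvd h * pderiv f" using gh(1) by (simp add: closed_form_def dvd_def algebra_simps)
  then have "f dvd h" using prime_elem_dvd_mult_iff[OF f(1)] small fx by blast
  then show ?thesis using g small gh(3) by simp
qed

section \<open>Degrees in the two variables, and closed forms on reducible curves\<close>

definition ydeg_le :: "nat \<Rightarrow> 'a::idom poly poly \<Rightarrow> bool" where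
  "ydeg_le n f \<longleftrightarrow> (\<forall>i. degree (coeff f i) \<le> n)"

lemma ydeg_le_add: "ydeg_le n f \<Longrightarrow> ydeg_le n g \<Longrightarrow> ydeg_le n (f + g)"
  by (auto simp: ydeg_le_def intro: degree_add_le)

lemma ydeg_le_diff: "ydeg_le n f \<Longrightarrow> ydeg_le n g \<Longrightarrow> ydeg_le n (f - g)"
  by (auto simp: ydeg_le_def intro: degree_diff_le)

lemma ydeg_le_mult: "ydeg_le m f \<Longrightarrow> ydeg_le n g \<Longrightarrow> ydeg_le (m + n) (f * g)"
  unfolding ydeg_le_def coeff_mult
  by (intro allI degree_sum_le) (auto intro: order.trans[OF degree_mult_le] add_mono)

lemma ydeg_le_pderiv: "ydeg_le n f \<Longrightarrow> ydeg_le n (pderiv f)"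
  by (auto simp: ydeg_le_def coeff_pderiv intro: order.trans[OF degree_mult_le] simp flip: of_nat_Suc)

lemma ydeg_le_pderiv_y: "ydeg_le n f \<Longrightarrow> ydeg_le n (pderiv_y f)"
  unfolding ydeg_le_def coeff_pderiv_y by (meson degree_pderiv_le diff_le_self order.trans)

lemma ydeg_le_const: "ydeg_le 0 [:[:c:]:]"
  by (simp add: ydeg_le_def coeff_pCons split: nat.split)

lemma coeff_mult_bound:
  fixes p q :: "'a::comm_ring_1 poly"
  assumes "degree p \<le> m" "degree q \<le> n"
  shows "coeff (p * q) (m + n) = coeff p m * coeff q n"
proof -
  have "coeff (p * q) (m + n) = (\<Sum>i\<le>m + n. if i = m then coeff p m * coeff q n else 0)"
    unfolding coeff_mult
  proof (intro sum.cong refl)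
    fix i assume "i \<in> {..m + n}"
    then show "coeff p i * coeff q (m + n - i) = (if i = m then coeff p m * coeff q n else 0)"
      using assms by (cases i m rule: linorder_cases) (auto simp: coeff_eq_0)
  qed
  then show ?thesis by simp
qed

text \<open>The coefficient of the highest power of y, read as a polynomial in x (\<open>T\<close>
  below), is multiplicative, so degrees in y add up.\<close>

lemma ydeg_le_factors:
  assumes "ydeg_le n (f1 * f2)" "f1 * f2 \<noteq> 0"
  obtains n1 n2 where "ydeg_le n1 f1" "ydeg_le n2 f2" "n1 + n2 \<le> n"
proof -
  define Y where "Y f = Max ((\<lambda>i. degree (coeff f i)) ` {..degree f})" for f :: "'a poly poly"
  define T where "T k f = map_poly (\<lambda>p. coeff p k) f" for k and f :: "'a poly poly"
  have Y: "ydeg_le (Y f) f" for f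
    unfolding ydeg_le_def
  proof
    fix i show "degree (coeff f i) \<le> Y f"
      unfolding Y_def by (cases "i \<le> degree f") (auto intro: Max_ge simp: coeff_eq_0)
  qed
  have T: "T (Y f) f \<noteq> 0" if "f \<noteq> 0" for f
  proof -
    have "Y f \<in> (\<lambda>i. degree (coeff f i)) ` {..degree f}" unfolding Y_def by (intro Max_in) auto
    then obtain i where i: "Y f = degree (coeff f i)" by auto
    have "\<exists>j. coeff f j \<noteq> 0 \<and> degree (coeff f j) = Y f"
    proof (cases "coeff f i = 0")
      case True
      then have "Y f = 0" using i by simp
      then have "degree (lead_coeff f) = 0" using Y[of f] by (simp add: ydeg_le_def)
      then show ?thesis using that \<open>Y f = 0\<close> by (intro exI[of _ "degree f"]) auto
    qed (use i in auto)
    then obtain j where j: "coeff f j \<noteq> 0" "degree (coeff f j) = Y f" by blast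
    then have "coeff (coeff f j) (Y f) \<noteq> 0" using leading_coeff_0_iff by metis
    then have "coeff (T (Y f) f) j \<noteq> 0" by (simp add: T_def coeff_map_poly)
    then show ?thesis by (metis coeff_0)
  qed
  have nz: "f1 \<noteq> 0" "f2 \<noteq> 0" using assms by auto
  have "T (Y f1 + Y f2) (f1 * f2) = T (Y f1) f1 * T (Y f2) f2"
  proof (rule poly_eqI)
    fix k
    have "coeff (coeff f1 i * coeff f2 j) (Y f1 + Y f2) =
        coeff (coeff f1 i) (Y f1) * coeff (coeff f2 j) (Y f2)" for i j
      using Y[of f1] Y[of f2] by (intro coeff_mult_bound) (auto simp: ydeg_le_def)
    then show "coeff (T (Y f1 + Y f2) (f1 * f2)) k = coeff (T (Y f1) f1 * T (Y f2) f2) k"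
      by (simp add: T_def coeff_map_poly coeff_mult coeff_sum)
  qed
  then have "T (Y f1 + Y f2) (f1 * f2) \<noteq> 0" using T nz by simp
  then obtain k where "coeff (T (Y f1 + Y f2) (f1 * f2)) k \<noteq> 0" by (metis leading_coeff_0_iff)
  then have "coeff (coeff (f1 * f2) k) (Y f1 + Y f2) \<noteq> 0" by (simp add: T_def coeff_map_poly)
  then have "Y f1 + Y f2 \<le> degree (coeff (f1 * f2) k)" by (rule le_degree)
  then have "Y f1 + Y f2 \<le> n" using assms(1) unfolding ydeg_le_def using order.trans by blast
  then show thesis using that Y by blast
qed

text \<open>A leading coefficient free of y is inherited by factors and excludes factors in y alone:
  over a field, a factor of degree 0 in x is a unit.\<close>

definition x_monic :: "nat \<Rightarrow> 'a::idom poly poly \<Rightarrow> bool" where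
  "x_monic d f \<longleftrightarrow> degree f = d \<and> (\<exists>c. c \<noteq> 0 \<and> coeff f d = [:c:])"

lemma x_monic_factors:
  assumes "x_monic d (f1 * f2)"
  obtains k l where "x_monic k f1" "x_monic l f2" "k + l = d"
proof -
  obtain c where c: "degree (f1 * f2) = d" "c \<noteq> 0" "lead_coeff (f1 * f2) = [:c:]"
    using assms by (auto simp: x_monic_def)
  then have nz: "f1 \<noteq> 0" "f2 \<noteq> 0" by auto
  have p: "lead_coeff f1 * lead_coeff f2 = [:c:]" using c(3) unfolding lead_coeff_mult .
  then have "degree (lead_coeff f1) + degree (lead_coeff f2) = 0"
    using nz degree_mult_eq[of "lead_coeff f1" "lead_coeff f2"] by simp
  then obtain c1 c2 where "lead_coeff f1 = [:c1:]" "lead_coeff f2 = [:c2:]"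
    by (metis add_is_0 degree_0_id)
  moreover from this have "c1 \<noteq> 0" "c2 \<noteq> 0" using nz by auto
  ultimately show thesis using c(1) nz that[of "degree f1" "degree f2"]
    by (auto simp: x_monic_def degree_mult_eq)
qed

lemma x_monic_0_unit:
  fixes f :: "'a::field poly poly"
  assumes "x_monic 0 f" shows "f dvd 1"
proof -
  obtain c where "c \<noteq> 0" "f = [:[:c:]:]" using assms degree_0_id[of f] by (auto simp: x_monic_def)
  then have "f * [:[:1 / c:]:] = 1" by (simp add: one_pCons)
  then show ?thesis by (metis dvd_triv_left)
qed

lemma degree_pderiv_y_less:
  assumes "x_monic d f" "d > 0" shows "degree (pderiv_y f) < d"
proof -
  have "coeff (pderiv_y f) d = 0" using assms by (auto simp: x_monic_def pderiv_pCons)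
  moreover have "degree (pderiv_y f) \<le> d"
    using assms by (intro degree_le) (auto simp: x_monic_def coeff_eq_0)
  ultimately show ?thesis using assms(2)
    by (metis degree_0 leading_coeff_0_iff order_le_imp_less_or_eq)
qed

text \<open>The form in question is dp / p, the logarithmic differential.\<close>

lemma closed_form_of_factor:
  "closed_form (p * q) (pderiv p * q) (pderiv_y p * q) = 0"
  unfolding closed_form_def pderiv_mult pderiv_y_mult pderiv_pderiv_y by (simp add: algebra_simps)

text \<open>The form in question is dp / p^2, the differential of -1/p.\<close>

lemma closed_form_of_square:
  "closed_form (p * (p * q)) (pderiv p * q) (pderiv_y p * q) = 0"
  unfolding closed_form_def pderiv_mult pderiv_y_mult pderiv_pderiv_y by (simp add: algebra_simps)

text \<open>If \<open>k\<close> and \<open>l\<close> are the degrees of \<open>f1\<close> and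
  \<open>f2\<close> in x, then \<open>l\<close> times df1/f1 minus \<open>k\<close> times df2/f2 is
  closed, and these weights cancel the coefficient at x^(d-1). Should its \<open>g\<close> vanish,
  the factors share a prime \<open>p\<close>, and dp / p^2 serves instead.\<close>

lemma reducible_closed_form:
  fixes f :: "complex poly poly"
  assumes f: "x_monic d f" "ydeg_le d f" "f = f1 * f2" "\<not> f1 dvd 1" "\<not> f2 dvd 1"
  shows "\<exists>g h. (g \<noteq> 0 \<or> h \<noteq> 0) \<and> closed_form f g h = 0 \<and> degree g < d \<and> degree h < d \<and>
    ydeg_le d g \<and> ydeg_le d h \<and> coeff (coeff g (d - 1)) 0 = 0"
proof -
  obtain k l where k: "x_monic k f1" and l: "x_monic l f2" and kl: "k + l = d"
    using x_monic_factors f(1,3) by metis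
  have kl0: "k > 0" "l > 0" using x_monic_0_unit f(4,5) k l by (metis gr0I)+
  have nz: "f \<noteq> 0" using f(1) by (auto simp: x_monic_def)
  define gc where "gc a b = [:[:of_nat l:]:] * (a * f2) - [:[:of_nat k:]:] * (b * f1)" for a b :: "complex poly poly"
  define g h where "g = gc (pderiv f1) (pderiv f2)" and "h = gc (pderiv_y f1) (pderiv_y f2)"
  have lin: "closed_form f (u * g1 - v * g2) (u * h1 - v * h2) = u * closed_form f g1 h1 - v * closed_form f g2 h2"
    if "pderiv u = 0" "pderiv_y u = 0" "pderiv v = 0" "pderiv_y v = 0" for u v g1 h1 g2 h2
    using that by (simp add: closed_form_def pderiv_diff pderiv_mult pderiv_y_diff pderiv_y_mult algebra_simps)
  have "closed_form f g h = 0"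
    unfolding g_def h_def gc_def
    using closed_form_of_factor[of f1 f2] closed_form_of_factor[of f2 f1]
    by (subst lin) (simp_all add: pderiv_pCons pderiv_y_const f(3) mult.commute[of f2 f1])
  moreover have "degree g < d \<and> coeff (coeff g (d - 1)) 0 = 0"
  proof -
    have d1: "degree (pderiv f1) \<le> k - 1" "degree f2 \<le> l" "degree (pderiv f2) \<le> l - 1" "degree f1 \<le> k"
      using k l by (simp_all add: x_monic_def degree_pderiv)
    have "degree (pderiv f1 * f2) < d" "degree (pderiv f2 * f1) < d"
      using d1 kl kl0 degree_mult_le[of "pderiv f1" f2] degree_mult_le[of "pderiv f2" f1] by linarith+
    then have "degree g < d" unfolding g_def gc_def
      by (intro degree_diff_less) (auto intro: le_less_trans[OF degree_smult_le])
    moreover have "d - 1 = (k - 1) + l" "d - 1 = (l - 1) + k" using kl kl0 by auto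
    then have "coeff (pderiv f1 * f2) (d - 1) = coeff (pderiv f1) (k - 1) * coeff f2 l"
      "coeff (pderiv f2 * f1) (d - 1) = coeff (pderiv f2) (l - 1) * coeff f1 k"
      using coeff_mult_bound d1 by metis+
    then have "coeff g (d - 1) = 0"
      using kl0 by (simp add: g_def gc_def coeff_pderiv of_nat_poly mult.commute)
    ultimately show ?thesis by simp
  qed
  moreover have "degree h < d"
  proof -
    have "degree (pderiv_y f1) < k" "degree f2 \<le> l" "degree (pderiv_y f2) < l" "degree f1 \<le> k"
      using k l kl0 degree_pderiv_y_less by (auto simp: x_monic_def)
    then have "degree (pderiv_y f1 * f2) < d" "degree (pderiv_y f2 * f1) < d"
      using kl degree_mult_le[of "pderiv_y f1" f2] degree_mult_le[of "pderiv_y f2" f1] by linarith+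
    then show ?thesis unfolding h_def gc_def
      by (intro degree_diff_less) (auto intro: le_less_trans[OF degree_smult_le])
  qed
  moreover have "ydeg_le d g \<and> ydeg_le d h"
  proof -
    obtain n1 n2 where n: "ydeg_le n1 f1" "ydeg_le n2 f2" "n1 + n2 \<le> d"
      using ydeg_le_factors[of d f1 f2] f nz by metis
    have mono: "ydeg_le d a" if "ydeg_le (0 + (n1 + n2)) a" for a :: "complex poly poly"
      using that n(3) unfolding ydeg_le_def using order.trans by fastforce
    have "ydeg_le (n1 + n2) (a * f2)" "ydeg_le (n1 + n2) (b * f1)"
      if "ydeg_le n1 a" "ydeg_le n2 b" for a b
      using ydeg_le_mult[OF that(1) n(2)] ydeg_le_mult[OF that(2) n(1)] by (simp_all add: add.commute)
    then have "ydeg_le d (gc a b)" if "ydeg_le n1 a" "ydeg_le n2 b" for a b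
      unfolding gc_def using that by (intro mono ydeg_le_diff ydeg_le_mult[OF ydeg_le_const])
    then show ?thesis unfolding g_def h_def
      using n(1,2) by (blast intro: ydeg_le_pderiv ydeg_le_pderiv_y)
  qed
  moreover have ?thesis if g0: "g = 0"
  proof -
    have "f1 \<noteq> 0" using nz f(3) by auto
    then obtain p where p: "p dvd f1" "prime p" using prime_divisor_exists[of f1] f(4) by blast
    then have pr: "prime_elem p" by simp
    \<comment> \<open>Orders along \<open>p\<close> are compared: if \<open>p\<close> did not divide
      \<open>f2\<close>, then \<open>pderiv f1 * f2\<close> would contain \<open>p\<close> exactly
      \<open>e - 1\<close> times, whereas \<open>pderiv f2 * f1\<close> contains it at least
      \<open>e\<close> times.\<close>
    define e where "e = multiplicity p f1"
    obtain m1 where m1: "f1 = p ^ e * m1" "\<not> p dvd m1"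
      using multiplicity_decompose'[of f1 p] pr \<open>f1 \<noteq> 0\<close> unfolding e_def prime_elem_def by metis
    have "e > 0" using p(1) m1 by (metis gr0I mult_1 power_0)
    then obtain e' where e': "e = Suc e'" using gr0_conv_Suc by blast
    obtain r where r: "f = p * r" using p(1) f(3) by (metis dvdE dvd_mult2)
    then obtain j j' where j: "x_monic j p" "j + j' = d" using x_monic_factors f(1) by metis
    have j0: "j > 0" using x_monic_0_unit j(1) pr by (metis gr0I prime_elem_not_unit)
    have px: "pderiv p \<noteq> 0" using j(1) j0 by (auto simp: x_monic_def pderiv_eq_0_iff)
    have "\<not> p dvd pderiv p"
    proof
      assume "p dvd pderiv p"
      then have "degree p \<le> degree (pderiv p)" using px dvd_imp_degree_le by blast
      then show False using j(1) j0 by (simp add: degree_pderiv x_monic_def)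
    qed
    moreover have "p dvd [:[:of_nat (l * e):]:] * pderiv p * m1 * f2"
    proof -
      have *: "[:[:of_nat l:]:] * (pderiv f1 * f2) = [:[:of_nat k:]:] * (pderiv f2 * f1)"
        using g0 by (simp add: g_def gc_def)
      have df1: "pderiv f1 = p ^ e' * ([:[:of_nat e:]:] * pderiv p * m1 + p * pderiv m1)"
        unfolding m1(1) e' pderiv_mult pderiv_power_Suc by (simp add: algebra_simps of_nat_poly smult_add_right)
      have "p ^ e' * ([:[:of_nat l:]:] * (([:[:of_nat e:]:] * pderiv p * m1 + p * pderiv m1) * f2)) =
          p ^ e' * (p * ([:[:of_nat k:]:] * (pderiv f2 * m1)))"
        using * unfolding df1 unfolding m1(1) e' by (simp only: power_Suc ac_simps)
      moreover have "p ^ e' \<noteq> 0" using pr by auto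
      ultimately have "[:[:of_nat l:]:] * (([:[:of_nat e:]:] * pderiv p * m1 + p * pderiv m1) * f2) =
          p * ([:[:of_nat k:]:] * (pderiv f2 * m1))" by (metis mult_left_cancel)
      then have "[:[:of_nat l:]:] * [:[:of_nat e:]:] * pderiv p * m1 * f2 =
          p * ([:[:of_nat k:]:] * (pderiv f2 * m1) - [:[:of_nat l:]:] * pderiv m1 * f2)"
      proof -
        have "L * E * px * m1 * f2 = L * ((E * px * m1 + p * px') * f2) - p * (L * px' * f2)" for L E px px'
          by (simp add: algebra_simps)
        moreover have "p * u - p * v = p * (u - v)" for u v by (simp add: algebra_simps)
        moreover assume "[:[:of_nat l:]:] * (([:[:of_nat e:]:] * pderiv p * m1 + p * pderiv m1) * f2) =
          p * ([:[:of_nat k:]:] * (pderiv f2 * m1))"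
        ultimately show ?thesis by metis
      qed
      then show ?thesis by (simp add: mult.assoc[symmetric]) 
    qed
    moreover have "\<not> p dvd [:[:of_nat (l * e):]:]"
    proof
      assume "p dvd [:[:of_nat (l * e):]:]"
      moreover have "[:[:of_nat (l * e):]:] \<noteq> (0 :: complex poly poly)"
        using kl0 e' by (simp only: pCons_eq_0_iff of_nat_eq_0_iff) simp
      ultimately have "degree p \<le> 0" using dvd_imp_degree_le by (metis degree_pCons_0)
      then show False using j(1) j0 by (simp add: x_monic_def)
    qed
    ultimately have "p dvd f2" using prime_elem_dvd_mult_iff[OF pr] m1(2) by blast
    then obtain q2 q1 where "f2 = p * q2" "f1 = p * q1" using p(1) by (auto elim!: dvdE)
    then have q: "f = p * (p * (q1 * q2))" using f(3) by (simp add: algebra_simps)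
    define q where "q = q1 * q2"
    have fq: "f = p * (p * q)" using \<open>f = p * (p * (q1 * q2))\<close> by (simp add: q_def)
    have "q \<noteq> 0" using fq nz by auto
    have dq: "j + (j + degree q) = d"
      using f(1) fq j(1) nz \<open>q \<noteq> 0\<close> pr by (auto simp: x_monic_def degree_mult_eq)
    have "degree (pderiv p * q) \<le> (j - 1) + degree q"
      using degree_mult_le[of "pderiv p" q] j(1) by (simp add: degree_pderiv x_monic_def)
    \<comment> \<open>Below \<open>d - 1\<close>, not only below \<open>d\<close>: so the
      coefficient excluded from the box is 0.\<close>
    then have "degree (pderiv p * q) < d - 1" using dq j0 by linarith
    moreover have "degree (pderiv_y p * q) < d"
      using degree_mult_le[of "pderiv_y p" q] degree_pderiv_y_less[OF j(1) j0] dq by linarith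
    moreover have "pderiv p * q \<noteq> 0" using px \<open>q \<noteq> 0\<close> by simp
    moreover have "ydeg_le d (pderiv p * q) \<and> ydeg_le d (pderiv_y p * q)"
    proof -
      obtain n1 n2 where n: "ydeg_le n1 p" "ydeg_le n2 (p * q)" "n1 + n2 \<le> d"
        using ydeg_le_factors[of d p "p * q"] f(2) fq nz by metis
      obtain n3 n4 where n': "ydeg_le n3 p" "ydeg_le n4 q" "n3 + n4 \<le> n2"
        using ydeg_le_factors[OF n(2)] fq nz by (metis mult_zero_right)
      have mono: "ydeg_le d a" if "ydeg_le (n3 + n4) a" for a :: "complex poly poly"
        using that n(3) n'(3) unfolding ydeg_le_def by (meson add_leD2 order.trans)
      show ?thesis using n'(1,2) by (intro conjI mono ydeg_le_mult ydeg_le_pderiv ydeg_le_pderiv_y)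
    qed
    ultimately show ?thesis
      using closed_form_of_square[of p q] fq
      by (intro exI[of _ "pderiv p * q"] exI[of _ "pderiv_y p * q"]) (auto simp: coeff_eq_0)
  qed
  ultimately show ?thesis by blast
qed

subsection \<open>Generic planes through a smooth point\<close>

text \<open>This is H(a + x b). The target is an arbitrary domain, so points and directions may be
  numbers, indeterminates or polynomials in further variables.\<close>

definition line :: "('a::zero \<Rightarrow> 'b::idom) \<Rightarrow> (nat \<Rightarrow> 'b) \<Rightarrow> (nat \<Rightarrow> 'b) \<Rightarrow> 'a mpoly \<Rightarrow> 'b poly" where
  "line h a b = mpoly_eval (\<lambda>c. [:h c:]) (\<lambda>i. [:a i, b i:])"

text \<open>This is H(P + x u + y v), read as a line in direction \<open>u\<close> whose base point
  moves with y.\<close>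

definition plane :: "('a::zero \<Rightarrow> 'b::idom) \<Rightarrow> (nat \<Rightarrow> 'b) \<Rightarrow> (nat \<Rightarrow> 'b) \<Rightarrow> (nat \<Rightarrow> 'b) \<Rightarrow> 'a mpoly \<Rightarrow> 'b poly poly" where
  "plane h P u v = line (\<lambda>c. [:h c:]) (\<lambda>i. [:P i, v i:]) (\<lambda>i. [:u i:])"

lemma line_hom: "comm_ring_hom h \<Longrightarrow> comm_ring_hom (line h a b)"
  unfolding line_def by (intro mpoly_eval_hom const_lift_hom)

lemma plane_hom: "comm_ring_hom h \<Longrightarrow> comm_ring_hom (plane h P u v)"
  unfolding plane_def by (intro line_hom const_lift_hom)

lemma map_poly_const: "k 0 = 0 \<Longrightarrow> map_poly k [:c:] = [:k c:]"
  by (intro poly_eqI) (simp add: coeff_map_poly coeff_pCons split: nat.split)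

lemma map_poly_linear: "k 0 = 0 \<Longrightarrow> map_poly k [:c, c':] = [:k c, k c':]"
  by (intro poly_eqI) (simp add: coeff_map_poly coeff_pCons split: nat.split)

lemma comm_ring_hom_zero: "comm_ring_hom h \<Longrightarrow> h 0 = 0"
proof -
  assume "comm_ring_hom h" then interpret comm_ring_hom h .
  show ?thesis by simp
qed

lemma map_poly_line:
  assumes "comm_ring_hom k"
  shows "map_poly k (line h a b H) = line (\<lambda>c. k (h c)) (\<lambda>i. k (a i)) (\<lambda>i. k (b i)) H"
  unfolding line_def hom_mpoly_eval[OF map_poly_hom[OF assms]]
  by (simp add: map_poly_const map_poly_linear comm_ring_hom_zero[OF assms])

lemma poly_line:
  "poly (line h a b H) z = mpoly_eval h (\<lambda>i. a i + z * b i) H"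
  unfolding line_def hom_mpoly_eval[OF poly_eval_hom] by simp

lemma map_poly_plane:
  assumes "comm_ring_hom k"
  shows "map_poly (map_poly k) (plane h P u v H) = plane (\<lambda>c. k (h c)) (\<lambda>i. k (P i)) (\<lambda>i. k (u i)) (\<lambda>i. k (v i)) H"
  unfolding plane_def map_poly_line[OF map_poly_hom[OF assms]]
  by (simp add: map_poly_const map_poly_linear comm_ring_hom_zero[OF assms])

lemma plane_y0: "map_poly (\<lambda>q. poly q 0) (plane h P u v H) = line h P u H"
  unfolding plane_def map_poly_line[OF poly_eval_hom] by simp

lemma line_lead:
  assumes "H \<in> polys n" "homogeneous d H"
  shows "degree (line h a b H) \<le> d" "coeff (line h a b H) d = mpoly_eval h b H"
proof -
  have "degree (line h a b H) \<le> d \<and> coeff (line h a b H) d = mpoly_eval h b H"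
    unfolding line_def
  proof (rule mpoly_eval_rel[OF assms])
    fix d e :: nat and p q :: "'b poly" and x y :: 'b
    assume *: "degree p \<le> d \<and> coeff p d = x" "degree q \<le> e \<and> coeff q e = y"
    then have "coeff (p * q) (d + e) = coeff p d * coeff q e" by (intro coeff_mult_bound) auto
    then show "degree (p * q) \<le> d + e \<and> coeff (p * q) (d + e) = x * y"
      using * degree_mult_le[of p q] by simp
  qed (auto intro: degree_add_le)
  then show "degree (line h a b H) \<le> d" "coeff (line h a b H) d = mpoly_eval h b H" by auto
qed

lemma mpoly_eval_const_lift:
  assumes "comm_ring_hom h"
  shows "mpoly_eval (\<lambda>c. [:h c:]) (\<lambda>i. [:u i:]) H = [:mpoly_eval h u H:]"
  using hom_mpoly_eval[OF const_lift_hom[OF id_comm_ring_hom(2)], of h u H] by simp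

lemma plane_lead:
  assumes "H \<in> polys n" "homogeneous d H" "comm_ring_hom h"
  shows "degree (plane h P u v H) \<le> d" "coeff (plane h P u v H) d = [:mpoly_eval h u H:]"
  unfolding plane_def
  by (rule line_lead(1)[OF assms(1,2)])
    (simp only: line_lead(2)[OF assms(1,2)] mpoly_eval_const_lift[OF assms(3)])

lemma plane_ydeg:
  assumes "H \<in> polys n" "homogeneous d H"
  shows "ydeg_le d (plane h P u v H)"
  unfolding plane_def line_def
proof (rule mpoly_eval_graded[OF assms])
  show "ydeg_le e (a + b)" if "ydeg_le e a" "ydeg_le e b" for e and a b :: "'b poly poly"
    using that by (rule ydeg_le_add)
  show "ydeg_le (e + e') (a * b)" if "ydeg_le e a" "ydeg_le e' b" for e e' and a b :: "'b poly poly"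
    using that by (rule ydeg_le_mult)
qed (simp_all add: ydeg_le_def coeff_pCons coeff_1 split: nat.split)

lemma at0_plane: "at0 (plane h P u v H) = mpoly_eval h P H"
  unfolding plane_def poly_line hom_mpoly_eval[OF poly_eval_hom] by simp

lemma at0_pderiv_plane: "at0 (pderiv (plane h P u v H)) = poly (pderiv (line h P u H)) 0"
  using arg_cong[OF plane_y0[of h P u v H], of "\<lambda>p. coeff p 1"]
  by (simp add: coeff_map_poly poly_0_coeff_0 coeff_pderiv)

lemma poly_hom_eqI:
  fixes f g :: "'a::comm_ring_1 poly \<Rightarrow> 'b::comm_ring_1"
  assumes "comm_ring_hom f" "comm_ring_hom g" "\<And>a. f [:a:] = g [:a:]" "f [:0, 1:] = g [:0, 1:]"
  shows "f p = g p"
proof -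
  interpret f: comm_ring_hom f by fact
  interpret g: comm_ring_hom g by fact
  show ?thesis
  proof (induction p)
    case (pCons a p)
    have "pCons a p = [:a:] + [:0, 1:] * p" by simp
    then show ?case using pCons assms(3,4) by (metis f.hom_add f.hom_mult g.hom_add g.hom_mult)
  qed (simp add: f.hom_zero g.hom_zero)
qed

lemma prime_elem_iso:
  assumes "comm_ring_hom \<sigma>" "comm_ring_hom \<tau>" "\<And>a. \<tau> (\<sigma> a) = a" "\<And>b. \<sigma> (\<tau> b) = b" "prime_elem p"
  shows "prime_elem (\<sigma> p)"
proof -
  interpret \<sigma>: comm_ring_hom \<sigma> by fact
  interpret \<tau>: comm_ring_hom \<tau> by fact
  have dvd: "\<sigma> a dvd b \<longleftrightarrow> a dvd \<tau> b" for a b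
  proof
    assume "\<sigma> a dvd b" then show "a dvd \<tau> b" by (metis assms(3) \<tau>.hom_mult dvdE dvd_triv_left)
  next
    assume "a dvd \<tau> b" then show "\<sigma> a dvd b" by (metis assms(4) \<sigma>.hom_mult dvdE dvd_triv_left)
  qed
  show ?thesis
  proof (rule prime_elemI)
    show "\<sigma> p \<noteq> 0" using assms(3)[of p] assms(5) by (metis \<tau>.hom_zero prime_elem_def)
    show "\<not> \<sigma> p dvd 1" using assms(5) by (simp add: dvd prime_elem_def \<tau>.hom_one)
    fix a b assume "\<sigma> p dvd a * b"
    then show "\<sigma> p dvd a \<or> \<sigma> p dvd b"
      using assms(5) by (simp add: dvd \<tau>.hom_mult prime_elem_dvd_mult_iff)
  qed
qed

text \<open>X -> X + x u is an automorphism of the polynomial ring in X and x, with inverse X -> X -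
  x u, and a prime stays prime when x is adjoined.\<close>

lemma line_prime:
  assumes "prime_elem H"
  shows "prime_elem (line const_poly var_poly (\<lambda>i. const_poly (u i)) (H :: 'a::idom mpoly))"
proof -
  define S where "S u = line const_poly var_poly (\<lambda>i. const_poly (u i) :: 'a mpoly)" for u
  have S: "comm_ring_hom (S u)" for u unfolding S_def by (intro line_hom const_poly_hom)
  define \<sigma> where "\<sigma> u A = poly (map_poly (S u) A) [:0, 1:]" for u A
  have \<sigma>: "comm_ring_hom (\<sigma> u)" for u
    unfolding \<sigma>_def by (intro comm_ring_hom_comp[OF poly_eval_hom] map_poly_hom S)
  have \<sigma>_const: "\<sigma> u [:a:] = S u a" for u a
    by (simp add: \<sigma>_def map_poly_const comm_ring_hom_zero[OF S])
  have \<sigma>_x: "\<sigma> u [:0, 1:] = [:0, 1:]" for u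
  proof -
    interpret comm_ring_hom "S u" by (rule S)
    show ?thesis by (simp add: \<sigma>_def map_poly_linear)
  qed
  have S_var: "S u (var_poly i) = [:var_poly i, const_poly (u i):]" "S u (const_poly c) = [:const_poly c:]" for u i c
    by (simp_all add: S_def line_def mpoly_eval_var one_pCons)
  have inv: "\<sigma> (\<lambda>i. - u i) (\<sigma> u A) = A" for u and A :: "'a mpoly poly"
  proof (rule poly_hom_eqI[where f = "\<lambda>A. \<sigma> (\<lambda>i. - u i) (\<sigma> u A)" and g = "\<lambda>A. A"])
    show "comm_ring_hom (\<lambda>A. \<sigma> (\<lambda>i. - u i) (\<sigma> u A))" by (rule comm_ring_hom_comp[OF \<sigma> \<sigma>])
    show "\<sigma> (\<lambda>i. - u i) (\<sigma> u [:a:]) = [:a:]" for a :: "'a mpoly"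
    proof -
      obtain n where n: "a \<in> polys n" using ex_polys by blast
      have "\<sigma> (\<lambda>i. - u i) (S u a) = [:a:]"
      proof (rule mpoly_hom_eqI[OF _ _ n, where f = "\<lambda>a. \<sigma> (\<lambda>i. - u i) (S u a)"])
        show "comm_ring_hom (\<lambda>a. \<sigma> (\<lambda>i. - u i) (S u a))" by (rule comm_ring_hom_comp[OF \<sigma> S])
        show "comm_ring_hom (\<lambda>a. [:a:])" by (rule const_lift_hom[OF id_comm_ring_hom(2)])
        fix i
        interpret comm_ring_hom "\<sigma> (\<lambda>i. - u i)" by (rule \<sigma>)
        have "[:var_poly i, const_poly (u i):] = [:var_poly i :: 'a mpoly:] + [:0, 1:] * [:const_poly (u i):]" by simp
        then have "\<sigma> (\<lambda>i. - u i) (S u (var_poly i)) =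
            S (\<lambda>i. - u i) (var_poly i) + [:0, 1:] * S (\<lambda>i. - u i) (const_poly (u i))"
          by (simp only: S_var(1)[of u] hom_add hom_mult \<sigma>_x \<sigma>_const)
        then show "\<sigma> (\<lambda>i. - u i) (S u (var_poly i)) = [:var_poly i:]"
          by (simp add: S_var const_poly.hom_uminus)
      qed (simp add: S_var \<sigma>_const)
      then show ?thesis by (simp add: \<sigma>_const)
    qed
  qed (simp_all add: \<sigma>_x id_comm_ring_hom)
  have "prime_elem (\<sigma> u [:H:])"
  proof (rule prime_elem_iso[OF \<sigma>[of u] \<sigma>[of "\<lambda>i. - u i"]])
    show "\<sigma> (\<lambda>i. - u i) (\<sigma> u a) = a" for a by (rule inv)
    show "\<sigma> u (\<sigma> (\<lambda>i. - u i) b) = b" for b using inv[of "\<lambda>i. - u i" b] by (simp only: minus_minus)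
    show "prime_elem [:H:]" by (rule lift_prime_elem_poly[OF assms])
  qed
  then show ?thesis by (simp add: \<sigma>_const S_def)
qed

text \<open>On the line X + x u with X indeterminate the restriction is prime with nonzero
  derivative, so Bezout produces a nonzero \<open>\<rho>\<close> in X alone. At an X where
  \<open>\<rho>\<close> does not vanish all roots on the line are simple, and there is one since C
  is algebraically closed.\<close>

lemma smooth_point:
  fixes H :: "complex mpoly"
  assumes H: "H \<in> polys n" "homogeneous d H" "irreducible H"
  obtains P u where "mpoly_eval id P H = 0" "mpoly_eval id u H \<noteq> 0" "poly (pderiv (line id P u H)) 0 \<noteq> 0"
proof -
  have Hnz: "H \<noteq> 0" and Hu: "\<not> H dvd 1" using H(3) by (auto simp: irreducible_def)
  have d: "d > 0" using Hu Hnz total_degree_homogeneous[OF H(2)] by (auto simp: mpoly_unit_iff)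
  obtain u where u: "mpoly_eval id u H \<noteq> 0" using mpoly_nonvanishing[OF H(1) Hnz] by blast
  define k where "k = line const_poly var_poly (\<lambda>i. const_poly (u i)) H"
  have prime: "prime_elem k"
    unfolding k_def by (intro line_prime mpoly_irreducible_imp_prime_elem H)
  have "coeff k d = const_poly (mpoly_eval id u H)"
    unfolding k_def line_lead(2)[OF H(1,2)] using hom_mpoly_eval[OF const_poly_hom, of id u H] by simp
  moreover have "degree k \<le> d" unfolding k_def by (rule line_lead(1)[OF H(1,2)])
  ultimately have dk: "degree k = d" using u by (metis const_poly_eq_0_iff le_antisym le_degree)
  have "pderiv k \<noteq> 0" "degree (pderiv k) < degree k" using dk d by (auto simp: pderiv_eq_0_iff degree_pderiv)
  then have "\<not> k dvd pderiv k" using dvd_imp_degree_le by (metis not_le)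
  moreover have "degree k > 0" using dk d by simp
  ultimately obtain \<alpha> \<beta> \<rho> where \<rho>: "\<rho> \<noteq> 0" "\<alpha> * k + \<beta> * pderiv k = [:\<rho>:]"
    using prime_elem_poly_bezout[OF prime] by blast
  obtain m where "\<rho> \<in> polys m" using ex_polys by blast
  then obtain X where X: "mpoly_eval id X \<rho> \<noteq> 0" using mpoly_nonvanishing \<rho>(1) by blast
  define e where "e = (mpoly_eval id X :: complex mpoly \<Rightarrow> complex)"
  have e: "comm_ring_hom e" unfolding e_def by (rule mpoly_eval_hom[OF id_comm_ring_hom(1)])
  interpret e: comm_ring_hom e by (rule e)
  interpret E: comm_ring_hom "map_poly e" by (rule map_poly_hom[OF e])
  have ek: "map_poly e k = line id X u H"
    unfolding k_def map_poly_line[OF e] by (simp add: e_def mpoly_eval_var id_def)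
  have pd: "map_poly e (pderiv k) = pderiv (map_poly e k)"
    by (intro poly_eqI) (simp add: coeff_map_poly coeff_pderiv e.hom_mult e.hom_add e.hom_of_nat)
  have "coeff (line id X u H) d \<noteq> 0" using u line_lead(2)[OF H(1,2)] by metis
  then have "degree (line id X u H) \<noteq> 0" using d by (metis coeff_eq_0 gr0I not_gr_zero)
  then obtain z where z: "poly (line id X u H) z = 0"
    using fundamental_theorem_of_algebra[of "line id X u H"] by (auto simp: constant_degree)
  have "map_poly e (\<alpha> * k + \<beta> * pderiv k) = [:e \<rho>:]" using \<rho>(2) by (simp add: map_poly_const)
  then have "poly (map_poly e \<alpha> * line id X u H + map_poly e \<beta> * pderiv (line id X u H)) z = e \<rho>"
    by (simp add: E.hom_add E.hom_mult pd ek)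
  then have z': "poly (pderiv (line id X u H)) z \<noteq> 0" using z X unfolding e_def by auto
  define P where "P i = X i + z * u i" for i
  have "line id P u H = pcompose (line id X u H) [:z, 1:]"
  proof -
    have h: "comm_ring_hom (\<lambda>p. pcompose p [:z, 1:])"
      by unfold_locales (auto simp: pcompose_add pcompose_mult pcompose_1)
    have "pcompose [:c, c':] [:z, 1:] = [:c + z * c', c':]" for c c' :: complex
      by (simp add: pcompose_pCons)
    then show ?thesis unfolding line_def hom_mpoly_eval[OF h] by (simp add: P_def mult.commute)
  qed
  then have "poly (pderiv (line id P u H)) 0 \<noteq> 0"
    using z' by (simp add: pderiv_pcompose poly_pcompose pderiv_pCons)
  moreover have "mpoly_eval id P H = 0" using z unfolding poly_line P_def .
  ultimately show thesis using u that by blast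
qed

text \<open>The Ruppert-Gao criterion as injectivity of a linear map. It makes sense over any
  domain, so it can be proved for an indeterminate \<open>v\<close> and specialized
  afterwards.\<close>

definition box_injective :: "nat \<Rightarrow> 'a::idom poly poly \<Rightarrow> bool" where
  "box_injective d f \<longleftrightarrow> (\<forall>g h. closed_form f g h = 0 \<longrightarrow> degree g < d \<longrightarrow> degree h < d \<longrightarrow>
     ydeg_le d g \<longrightarrow> ydeg_le d h \<longrightarrow> coeff (coeff g (d - 1)) 0 = 0 \<longrightarrow> g = 0 \<and> h = 0)"

lemma eval3_nonvanishing:
  fixes A :: "complex mpoly poly poly"
  assumes "A \<noteq> 0"
  obtains X x y where "poly (poly (map_poly (map_poly (mpoly_eval id X)) A) [:x:]) y \<noteq> (0 :: complex)"
proof -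
  obtain i where "coeff A i \<noteq> 0" using assms by (metis leading_coeff_0_iff)
  then obtain j where j: "coeff (coeff A i) j \<noteq> 0" by (metis leading_coeff_0_iff)
  obtain n where "coeff (coeff A i) j \<in> polys n" using ex_polys by blast
  then obtain X where X: "mpoly_eval id X (coeff (coeff A i) j) \<noteq> 0" using mpoly_nonvanishing j by blast
  define B where "B = map_poly (map_poly (mpoly_eval id X)) A"
  have "coeff (coeff B i) j \<noteq> 0" using X by (simp add: B_def coeff_map_poly)
  then have "B \<noteq> 0" by (metis coeff_0)
  then have "finite {a. poly B a = 0}" by (rule poly_roots_finite)
  moreover have "infinite (range (\<lambda>x :: complex. [:x:]))"
    by (subst finite_image_iff) (auto simp: inj_on_def infinite_UNIV_char_0)
  ultimately obtain x where "poly B [:x:] \<noteq> 0" by (metis (mono_tags, lifting) finite_subset mem_Collect_eq image_subsetI)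
  then obtain y where "poly (poly B [:x:]) y \<noteq> 0" using poly_all_0_iff_0 by blast
  then show thesis using that unfolding B_def by blast
qed

section \<open>Restriction to a plane whose second direction is indeterminate\<close>

locale generic_plane =
  fixes P u :: "nat \<Rightarrow> complex"
begin

text \<open>Only \<open>v\<close> is indeterminate. \<open>P\<close> and \<open>u\<close> are
  numbers because the curve has to pass through the origin with nonzero x-derivative there.\<close>

definition sub :: "complex mpoly \<Rightarrow> complex mpoly poly poly" where
  "sub = plane const_poly (\<lambda>i. const_poly (P i)) (\<lambda>i. const_poly (u i)) var_poly"

text \<open>Extends \<open>sub\<close> to polynomials in X, y and x by fixing x and y. Geometrically
  it is (v, y, x) -> (P + x u + y v, y, x), invertible where y is nonzero.\<close>

definition subst :: "complex mpoly poly poly \<Rightarrow> complex mpoly poly poly" where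
  "subst A = poly (map_poly (\<lambda>q. poly (map_poly sub q) varY) A) varX"

lemma sub_hom: "comm_ring_hom sub"
  unfolding sub_def by (rule plane_hom[OF const_poly_hom])

lemma inner_hom: "comm_ring_hom (\<lambda>q. poly (map_poly sub q) varY)"
  by (rule comm_ring_hom_comp[OF poly_eval_hom map_poly_hom[OF sub_hom]])

lemma subst_hom: "comm_ring_hom subst"
  unfolding subst_def by (rule comm_ring_hom_comp[OF poly_eval_hom map_poly_hom[OF inner_hom]])

sublocale sub: comm_ring_hom sub by (rule sub_hom)
sublocale subst: comm_ring_hom subst by (rule subst_hom)

lemma sub_const: "sub (const_poly c) = [:[:const_poly c:]:]"
  by (simp add: sub_def plane_def line_def)

lemma sub_var: "sub (var_poly i) = [:[:const_poly (P i), var_poly i:], [:const_poly (u i):]:]"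
  by (simp add: sub_def plane_def line_def mpoly_eval_var one_pCons)

lemma subst_const: "subst [:[:a:]:] = sub a"
  by (simp add: subst_def map_poly_const)

lemma subst_Y: "subst varY = varY"
  by (simp add: subst_def map_poly_const map_poly_linear)

lemma subst_X: "subst varX = varX"
  using inner_hom by (simp add: subst_def map_poly_linear map_poly_const)

lemma subst_injective:
  assumes "subst A = 0" shows "A = 0"
proof (rule ccontr)
  assume "A \<noteq> 0"
  \<comment> \<open>The extra factor y makes the point found below have nonzero y-coordinate, so
    that v can be solved for.\<close>
  then have "varY * A \<noteq> 0" by simp
  then obtain X x y where "poly (poly (map_poly (map_poly (mpoly_eval id X)) (varY * A)) [:x:]) y \<noteq> (0 :: complex)"
    by (rule eval3_nonvanishing)
  moreover define E where "E X A = poly (poly (map_poly (map_poly (mpoly_eval id X)) A) [:x:]) y"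
    for X :: "nat \<Rightarrow> complex" and A
  ultimately have E0: "E X (varY * A) \<noteq> 0" by simp
  have e: "comm_ring_hom (mpoly_eval id X :: complex mpoly \<Rightarrow> complex)" for X
    by (rule mpoly_eval_hom[OF id_comm_ring_hom(1)])
  have E: "comm_ring_hom (E X)" for X
    unfolding E_def by (intro comm_ring_hom_comp[OF poly_eval_hom] map_poly_hom e)
  have e1: "mpoly_eval id X (1 :: complex mpoly) = 1" for X
    using mpoly_eval_const[of id X 1] by simp
  have E_const: "E X [:[:a:]:] = mpoly_eval id X a" for X a
    by (simp add: E_def map_poly_const)
  have E_Y: "E X varY = y" for X
    by (simp add: E_def map_poly_const map_poly_linear e1 del: id_apply)
  have E_X: "E X varX = x" for X
    by (simp add: E_def map_poly_const map_poly_linear e1 one_pCons del: id_apply)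
  interpret EX: comm_ring_hom "E X" by (rule E)
  have y: "y \<noteq> 0" using E0 by (auto simp: EX.hom_mult E_Y simp del: mult_pCons_left mult_pCons_right)
  define V where "V i = (X i - P i - x * u i) / y" for i
  interpret EV: comm_ring_hom "E V" by (rule E)
  have "E V (subst A) = E X A" for A
  proof (rule poly_hom_eqI[where f = "\<lambda>A. E V (subst A)" and g = "E X"])
    show "comm_ring_hom (\<lambda>A. E V (subst A))" by (rule comm_ring_hom_comp[OF E subst_hom])
    show "comm_ring_hom (E X)" by (rule E)
    show "E V (subst [:a:]) = E X [:a:]" for a
    proof (rule poly_hom_eqI[where f = "\<lambda>a. E V (subst [:a:])" and g = "\<lambda>a. E X [:a:]"])
      have lift: "comm_ring_hom (\<lambda>a. [:a:] :: complex mpoly poly poly)"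
        by (rule const_lift_hom[OF id_comm_ring_hom(2)])
      show "comm_ring_hom (\<lambda>a. E V (subst [:a:]))"
        by (rule comm_ring_hom_comp[OF E comm_ring_hom_comp[OF subst_hom lift]])
      show "comm_ring_hom (\<lambda>a. E X [:a:])" by (rule comm_ring_hom_comp[OF E lift])
      show "E V (subst [:[:a:]:]) = E X [:[:a:]:]" for a
      proof -
        obtain n where n: "a \<in> polys n" using ex_polys by blast
        have "E V (sub a) = mpoly_eval id X a"
        proof (rule mpoly_hom_eqI[OF comm_ring_hom_comp[OF E sub_hom] e n])
          show "E V (sub (const_poly c)) = mpoly_eval id X (const_poly c)" for c
            by (simp add: sub_const E_const)
          fix i
          have "sub (var_poly i) = [:[:const_poly (P i):]:] + varY * [:[:var_poly i:]:] + varX * [:[:const_poly (u i):]:]"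
            by (simp add: sub_var)
          then have "E V (sub (var_poly i)) = P i + y * V i + x * u i"
            by (simp only: EV.hom_add EV.hom_mult E_const E_Y E_X) (simp add: mpoly_eval_var)
          then show "E V (sub (var_poly i)) = mpoly_eval id X (var_poly i)"
            using y by (simp add: V_def mpoly_eval_var)
        qed
        then show ?thesis by (simp add: subst_const E_const)
      qed
      show "E V (subst [:[:0, 1:]:]) = E X [:[:0, 1:]:]" by (simp only: subst_Y E_Y)
    qed
    show "E V (subst [:0, 1:]) = E X [:0, 1:]" by (simp only: subst_X E_X)
  qed
  then have "E X A = E V (subst A)" by simp
  also have "\<dots> = 0" unfolding assms by (rule EV.hom_zero)
  finally show False using E0 by (simp only: EX.hom_mult) simp
qed

text \<open>
  Off \<open>y = 0\<close> the substitution is invertible, the inverse being \<open>v = (X - P - x u) / y\<close>.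
\<close>

lemma near_inverse: "\<exists>N A. varY ^ N * a = subst A"
proof -
  \<comment> \<open>The good elements form a subring, so it suffices to place the constants, the
    variables v, and x and y in it.\<close>
  define Good where "Good a \<longleftrightarrow> (\<exists>N A. varY ^ N * a = subst A)" for a
  have subst_Yp: "subst (varY ^ N) = varY ^ N" for N
    by (simp only: subst.hom_power subst_Y)
  have image: "Good (subst A)" for A unfolding Good_def by (intro exI[of _ 0] exI[of _ A]) simp
  have add: "Good (a + b)" if ab: "Good a" "Good b" for a b
  proof -
    obtain N A M B where "varY ^ N * a = subst A" "varY ^ M * b = subst B"
      using ab unfolding Good_def by blast
    moreover have "p * q * (a + b) = q * (p * a) + p * (q * b)" for p q by (simp add: algebra_simps)
    ultimately have "varY ^ (N + M) * (a + b) = subst (varY ^ M * A + varY ^ N * B)"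
      by (simp only: subst.hom_add subst.hom_mult subst_Yp power_add)
    then show ?thesis unfolding Good_def by blast
  qed
  have mult: "Good (a * b)" if ab: "Good a" "Good b" for a b
  proof -
    obtain N A M B where "varY ^ N * a = subst A" "varY ^ M * b = subst B"
      using ab unfolding Good_def by blast
    moreover have "p * q * (a * b) = (p * a) * (q * b)" for p q by (simp add: algebra_simps)
    ultimately have "varY ^ (N + M) * (a * b) = subst (A * B)"
      by (simp only: subst.hom_mult power_add)
    then show ?thesis unfolding Good_def by blast
  qed
  have X: "Good varX" using image[of varX] by (simp only: subst_X)
  have Y: "Good varY" using image[of varY] by (simp only: subst_Y)
  have const: "Good [:[:const_poly c:]:]" for c using image[of "[:[:const_poly c:]:]"]
    by (simp only: subst_const sub_const)
  have var: "Good [:[:var_poly i:]:]" for i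
  proof -
    have "varY ^ 1 * [:[:var_poly i:]:] = sub (var_poly i) - [:[:const_poly (P i):]:] - varX * [:[:const_poly (u i):]:]"
      by (simp add: sub_var)
    also have "\<dots> = subst ([:[:var_poly i:]:] - [:[:const_poly (P i):]:] - varX * [:[:const_poly (u i):]:])"
      by (simp only: subst.hom_minus subst.hom_mult subst_const sub_const subst_X)
    finally show ?thesis unfolding Good_def by blast
  qed
  have mp: "Good [:[:a:]:]" for a
  proof -
    obtain n where n: "a \<in> polys n" using ex_polys by blast
    have "Good [:[:mpoly_eval const_poly var_poly a:]:]"
    proof (rule mpoly_eval_closed[OF n, where P = "\<lambda>a. Good [:[:a:]:]"])
      show "Good [:[:0:]:]" "Good [:[:1:]:]" using const[of 0] const[of 1]
        by (simp_all only: const_poly.hom_one const_poly.hom_zero)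
      show "Good [:[:a + b:]:]" if "Good [:[:a:]:]" "Good [:[:b:]:]" for a b
        using add[OF that] by simp
      show "Good [:[:a * b:]:]" if "Good [:[:a:]:]" "Good [:[:b:]:]" for a b
        using mult[OF that] by simp
    qed (use const var in auto)
    then show ?thesis by (simp only: mpoly_eval_id)
  qed
  have inner: "Good [:a:]" for a
  proof (induction a)
    case (pCons c a)
    have "[:pCons c a:] = [:[:c:]:] + varY * [:a:]" by simp
    then show ?case using add mult mp Y pCons by presburger
  qed (use const[of 0] in simp)
  have "Good a" for a
  proof (induction a)
    case (pCons c a)
    have "pCons c a = [:c:] + varX * a" by simp
    then show ?case using add mult inner X pCons by metis
  qed (use const[of 0] in simp)
  then show ?thesis unfolding Good_def by blast
qed

text \<open>y is prime and does not divide \<open>f\<close>, so it must divide the cofactor and can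
  be cancelled step by step.\<close>

lemma varY_power_dvd_cancel:
  fixes f :: "complex mpoly poly poly"
  assumes "varY ^ N * a = f * t" "map_poly (\<lambda>q. poly q 0) f \<noteq> 0"
  shows "f dvd a"
  using assms(1)
proof (induction N arbitrary: t)
  case (Suc N)
  interpret comm_ring_hom "map_poly (\<lambda>q :: complex mpoly poly. poly q 0)"
    by (rule map_poly_hom[OF poly_eval_hom])
  have "map_poly (\<lambda>q. poly q 0) f * map_poly (\<lambda>q. poly q 0) t =
      map_poly (\<lambda>q. poly q 0) (varY * (varY ^ N * a))"
    using arg_cong[OF Suc.prems, of "map_poly (\<lambda>q. poly q 0)"] by (simp only: hom_mult power_Suc mult.assoc)
  also have "\<dots> = 0" unfolding hom_mult by (simp add: map_poly_const)
  finally have "map_poly (\<lambda>q. poly q 0) t = 0" using assms(2) by simp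
  then have "poly (coeff t i) 0 = 0" for i by (metis coeff_map_poly coeff_0 poly_0)
  then have "[:0, 1:] dvd coeff t i" for i using poly_eq_0_iff_dvd[of "coeff t i" 0] by simp
  then obtain t' where "t = varY * t'" using const_poly_dvd_iff by (metis dvdE)
  then have "varY * (varY ^ N * a) = varY * (f * t')"
    using Suc.prems by (simp only: power_Suc mult.assoc mult.left_commute)
  then have "varY ^ N * a = f * t'" by (simp only: mult_cancel_left) simp
  then show ?case by (rule Suc.IH)
qed simp

text \<open>Once y is inverted, \<open>subst\<close> is an isomorphism that takes \<open>H\<close>
  to \<open>sub H\<close>, and \<open>H\<close> stays prime when x, y and 1/y are adjoined. As
  \<open>sub H\<close> is not zero at y = 0, primality descends to the ring where y is not
  inverted.\<close>

lemma sub_prime: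
  assumes H: "H \<in> polys n" "homogeneous d H" "prime_elem H" and u: "mpoly_eval id u H \<noteq> 0" and d: "d > 0"
  shows "prime_elem (sub H)"
proof -
  have dH: "degree (sub H) \<le> d" "coeff (sub H) d = [:const_poly (mpoly_eval id u H):]"
    using plane_lead[OF H(1,2) const_poly_hom] hom_mpoly_eval[OF const_poly_hom, of id u H]
    by (simp_all add: sub_def)
  have "coeff (map_poly (\<lambda>q. poly q 0) (sub H)) d \<noteq> 0"
    using u by (simp add: coeff_map_poly dH)
  then have f0: "map_poly (\<lambda>q. poly q 0) (sub H) \<noteq> 0" by (metis coeff_0)
  have deg: "degree (sub H) = d" using dH u by (metis const_poly_eq_0_iff le_antisym le_degree pCons_eq_0_iff)
  have prime: "prime_elem [:[:H:]:]" by (intro lift_prime_elem_poly H)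
  have nY: "\<not> [:[:H:]:] dvd varY ^ N" for N
  proof
    assume "[:[:H:]:] dvd varY ^ N"
    then have "[:H:] dvd [:0, 1:] ^ N" by (simp add: poly_const_pow const_poly_dvd_const_poly_iff)
    then have "H dvd coeff ([:0, 1:] ^ N) N" by (simp add: const_poly_dvd_iff)
    also have "[:0, 1:] ^ N = (monom 1 N :: complex mpoly poly)" by (simp add: monom_altdef)
    finally show False using H(3) by (simp add: prime_elem_def)
  qed
  show ?thesis
  proof (rule prime_elemI)
    show "sub H \<noteq> 0" using deg d by auto
    show "\<not> sub H dvd 1"
    proof
      assume "sub H dvd 1"
      then have "degree (sub H) \<le> degree (1 :: complex mpoly poly poly)"
        by (intro dvd_imp_degree_le) auto
      then show False using deg d by simp
    qed
    fix a b assume "sub H dvd a * b"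
    then obtain c where c: "a * b = sub H * c" by (rule dvdE)
    obtain N A where A: "varY ^ N * a = subst A" using near_inverse by blast
    obtain M B where B: "varY ^ M * b = subst B" using near_inverse by blast
    obtain L C where C: "varY ^ L * c = subst C" using near_inverse by blast
    have subst_Yp: "subst (varY ^ N) = varY ^ N" for N
      by (simp only: subst.hom_power subst_Y)
    have "subst (varY ^ L * (A * B)) = subst (varY ^ (N + M) * ([:[:H:]:] * C))"
    proof -
      have "subst (varY ^ L * (A * B)) = varY ^ L * ((varY ^ N * a) * (varY ^ M * b))"
        by (simp only: subst.hom_mult subst_Yp A B)
      also have "\<dots> = varY ^ L * varY ^ (N + M) * (a * b)" by (simp only: power_add ac_simps)
      also have "\<dots> = varY ^ (N + M) * (sub H * (varY ^ L * c))" unfolding c by (simp only: ac_simps)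
      also have "\<dots> = subst (varY ^ (N + M) * ([:[:H:]:] * C))"
        by (simp only: subst.hom_mult subst_Yp C subst_const)
      finally show ?thesis .
    qed
    note eq = this
    have "subst (varY ^ L * (A * B) - varY ^ (N + M) * ([:[:H:]:] * C)) = 0"
      unfolding subst.hom_minus eq by (rule diff_self)
    then have "varY ^ L * (A * B) - varY ^ (N + M) * ([:[:H:]:] * C) = 0" by (rule subst_injective)
    then have "varY ^ L * (A * B) = [:[:H:]:] * (varY ^ (N + M) * C)" by (simp only: right_minus_eq ac_simps)
    then have "[:[:H:]:] dvd varY ^ L * (A * B)" by (metis dvd_triv_left)
    then have "[:[:H:]:] dvd A \<or> [:[:H:]:] dvd B"
      using prime_elem_dvd_mult_iff[OF prime] nY by blast
    then show "sub H dvd a \<or> sub H dvd b"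
    proof
      assume "[:[:H:]:] dvd A"
      then obtain A' where "A = [:[:H:]:] * A'" by (rule dvdE)
      then have "varY ^ N * a = sub H * subst A'" using A by (simp only: subst.hom_mult subst_const)
      then show ?thesis using varY_power_dvd_cancel f0 by blast
    next
      assume "[:[:H:]:] dvd B"
      then obtain B' where "B = [:[:H:]:] * B'" by (rule dvdE)
      then have "varY ^ M * b = sub H * subst B'" using B by (simp only: subst.hom_mult subst_const)
      then show ?thesis using varY_power_dvd_cancel f0 by blast
    qed
  qed
qed

lemma sub_box_injective:
  assumes H: "H \<in> polys n" "homogeneous d H" "prime_elem H" and d: "d > 0"
    and P: "mpoly_eval id P H = 0" "mpoly_eval id u H \<noteq> 0" "poly (pderiv (line id P u H)) 0 \<noteq> 0"
  shows "box_injective d (sub H)"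
proof -
  have c: "coeff (sub H) d = [:const_poly (mpoly_eval id u H):]"
    using plane_lead[OF H(1,2) const_poly_hom] hom_mpoly_eval[OF const_poly_hom, of id u H]
    by (simp add: sub_def)
  have "degree (sub H) \<le> d" using plane_lead[OF H(1,2) const_poly_hom] by (simp add: sub_def)
  then have deg: "degree (sub H) = d"
    using c P(2) by (metis const_poly_eq_0_iff le_antisym le_degree pCons_eq_0_iff)
  have at0: "at0 (sub H) = 0"
    using P(1) hom_mpoly_eval[OF const_poly_hom, of id P H] by (simp add: sub_def at0_plane)
  have at0': "at0 (pderiv (sub H)) \<noteq> 0"
  proof -
    have "map_poly const_poly (line id P u H) = line const_poly (\<lambda>i. const_poly (P i)) (\<lambda>i. const_poly (u i)) H"
      using map_poly_line[OF const_poly_hom, of id P u H] by simp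
    then have "at0 (pderiv (sub H)) = poly (pderiv (map_poly const_poly (line id P u H))) 0"
      by (simp add: sub_def at0_pderiv_plane)
    also have "\<dots> = const_poly (poly (pderiv (line id P u H)) 0)"
      by (simp add: poly_0_coeff_0 coeff_pderiv coeff_map_poly)
    finally show ?thesis using P(3) by simp
  qed
  have lead: "coeff (coeff (sub H) d) 0 \<noteq> 0" using P(2) by (simp add: c)
  show ?thesis unfolding box_injective_def
    by (intro allI impI closed_form_unique[OF sub_prime[OF H P(2) d] deg d at0 at0' lead])
qed

end

subsection \<open>Planes as points of a parameter space\<close>

text \<open>
  The unknown coefficients of \<open>g\<close> (\<open>False\<close>) and \<open>h\<close> (\<open>True\<close>). Omitting the monomial
  \<open>x\<^bsup>d-1\<^esup>\<close> of \<open>g\<close> excludes the multiples of \<open>df\<close>.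
\<close>

definition box :: "nat \<Rightarrow> (bool \<times> nat \<times> nat) set" where
  "box d = (UNIV \<times> {..<d} \<times> {..d}) - {(False, d - 1, 0)}"

lemma finite_box [simp]: "finite (box d)"
  by (simp add: box_def)

lemma card_box: "card (box d) \<le> 2 * d * (d + 1)"
proof -
  have "card (box d) \<le> card ((UNIV :: bool set) \<times> {..<d} \<times> {..d})"
    unfolding box_def by (intro card_mono) auto
  then show ?thesis by (simp add: card_cartesian_product)
qed

definition unit_form :: "bool \<Rightarrow> bool \<times> nat \<times> nat \<Rightarrow> 'a::idom poly poly" where
  "unit_form t s = (if fst s = t then monom (monom 1 (snd (snd s))) (fst (snd s)) else 0)"

text \<open>A matrix entry of the linear system, for the unknown \<open>s\<close> and the equation
  at the exponent pair \<open>e\<close>. It is linear in \<open>f\<close>, so entries inherit the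
  degree of the coefficients of \<open>f\<close> in the parameters.\<close>

definition column :: "'a::idom poly poly \<Rightarrow> bool \<times> nat \<times> nat \<Rightarrow> nat \<times> nat \<Rightarrow> 'a" where
  "column f s e = coeff (coeff (closed_form f (unit_form False s) (unit_form True s)) (fst e)) (snd e)"

definition combine :: "nat \<Rightarrow> bool \<Rightarrow> (bool \<times> nat \<times> nat \<Rightarrow> 'a) \<Rightarrow> 'a::idom poly poly" where
  "combine d t k = (\<Sum>s\<in>box d. [:[:k s:]:] * unit_form t s)"

lemma coeff_combine:
  "coeff (coeff (combine d t k) i) j = (if (t, i, j) \<in> box d then k (t, i, j) else 0)"
proof -
  have "coeff (coeff ([:[:k s:]:] * unit_form t s) i) j = (if s = (t, i, j) then k (t, i, j) else 0)" for s
    by (cases s) (auto simp: unit_form_def)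
  then show ?thesis by (simp add: combine_def coeff_sum)
qed

lemma closed_form_add: "closed_form f (g + g') (h + h') = closed_form f g h + closed_form f g' h'"
  by (simp add: closed_form_def pderiv_add pderiv_y_add algebra_simps)

lemma closed_form_scale: "closed_form f ([:[:a:]:] * g) ([:[:a:]:] * h) = [:[:a:]:] * closed_form f g h"
proof -
  define c where "c = [:[:a:]:]"
  have [simp]: "pderiv c = 0" "pderiv_y c = 0" by (simp_all add: c_def pderiv_pCons pderiv_y_const)
  have "closed_form f (c * g) (c * h) = c * closed_form f g h"
    by (simp add: closed_form_def pderiv_mult pderiv_y_mult algebra_simps)
  then show ?thesis by (simp add: c_def)
qed

lemma closed_form_combine:
  "coeff (coeff (closed_form f (combine d False k) (combine d True k)) (fst e)) (snd e) =
    (\<Sum>s\<in>box d. k s * column f s e)"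
proof -
  have "closed_form f (\<Sum>s\<in>A. g s) (\<Sum>s\<in>A. h s) = (\<Sum>s\<in>A. closed_form f (g s) (h s))"
    for A :: "(bool \<times> nat \<times> nat) set" and g h
    by (induction A rule: infinite_finite_induct) (auto simp: closed_form_add, simp_all add: closed_form_def)
  then have "closed_form f (combine d False k) (combine d True k) =
      (\<Sum>s\<in>box d. [:[:k s:]:] * closed_form f (unit_form False s) (unit_form True s))"
    unfolding combine_def by (simp only: closed_form_scale)
  then show ?thesis by (simp add: coeff_sum column_def)
qed

lemma box_injective_iff:
  assumes "d > 0"
  shows "box_injective d f \<longleftrightarrow>
    (\<forall>k. (\<forall>e. (\<Sum>s\<in>box d. k s * column f s e) = 0) \<longrightarrow> (\<forall>s\<in>box d. k s = 0))"
proof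
  assume inj: "box_injective d f"
  show "\<forall>k. (\<forall>e. (\<Sum>s\<in>box d. k s * column f s e) = 0) \<longrightarrow> (\<forall>s\<in>box d. k s = 0)"
  proof (intro allI impI)
    fix k assume 0: "\<forall>e. (\<Sum>s\<in>box d. k s * column f s e) = 0"
    let ?g = "combine d False k" and ?h = "combine d True k"
    have "coeff (coeff (closed_form f ?g ?h) p) q = 0" for p q
      using closed_form_combine[of f d k "(p, q)"] 0 by simp
    then have "closed_form f ?g ?h = 0" by (intro poly_eqI) (simp add: poly_eq_iff)
    moreover have "degree (combine d t k) < d" for t
    proof -
      have "coeff (combine d t k) i = 0" if "i > d - 1" for i
        using that by (intro poly_eqI) (auto simp: coeff_combine box_def)
      then have "degree (combine d t k) \<le> d - 1" by (intro degree_le) auto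
      then show ?thesis using assms by simp
    qed
    moreover have "ydeg_le d (combine d t k)" for t
      unfolding ydeg_le_def by (intro allI degree_le) (auto simp: coeff_combine box_def)
    moreover have "coeff (coeff ?g (d - 1)) 0 = 0" by (simp add: coeff_combine box_def)
    ultimately have *: "?g = 0" "?h = 0" using inj unfolding box_injective_def by blast+
    show "\<forall>s\<in>box d. k s = 0"
    proof
      fix s assume s: "s \<in> box d"
      obtain t i j where tij: "s = (t, i, j)" by (cases s)
      then have "k s = coeff (coeff (combine d t k) i) j" using s by (simp add: coeff_combine)
      then show "k s = 0" using * by (cases t) auto
    qed
  qed
next
  assume inj: "\<forall>k. (\<forall>e. (\<Sum>s\<in>box d. k s * column f s e) = 0) \<longrightarrow> (\<forall>s\<in>box d. k s = 0)"
  show "box_injective d f" unfolding box_injective_def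
  proof (intro allI impI)
    fix g h assume *: "closed_form f g h = 0" "degree g < d" "degree h < d" "ydeg_le d g" "ydeg_le d h"
      "coeff (coeff g (d - 1)) 0 = 0"
    define k where "k s = coeff (coeff (if fst s then h else g) (fst (snd s))) (snd (snd s))" for s
    have box: "(t, i, j) \<in> box d \<or> coeff (coeff (if t then h else g) i) j = 0" for t i j
    proof (cases "i < d \<and> j \<le> d")
      case False
      then have "coeff (coeff (if t then h else g) i) j = 0"
        using * by (auto simp: ydeg_le_def coeff_eq_0 not_less not_le split: if_splits)
          (metis coeff_eq_0 le_less_trans)+
      then show ?thesis ..
    qed (use * in \<open>cases j; auto simp: box_def\<close>)
    have g: "combine d False k = g" "combine d True k = h"
      using box[of False] box[of True] by (intro poly_eqI; force simp: coeff_combine k_def)+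
    then have "\<forall>e. (\<Sum>s\<in>box d. k s * column f s e) = 0"
      using *(1) by (simp flip: closed_form_combine)
    then have "\<forall>s\<in>box d. k s = 0" using inj by blast
    then have "combine d t k = 0" for t by (intro poly_eqI) (simp add: coeff_combine)
    then show "g = 0 \<and> h = 0" using g by metis
  qed
qed

text \<open>The unknowns are numbered because the determinant lemmas expect columns indexed by
  natural numbers.\<close>

lemma box_injective_enumerate:
  fixes f :: "'a::idom poly poly"
  assumes "d > 0" "bij_betw \<beta> {..<N} (box d)"
  shows "box_injective d f \<longleftrightarrow>
    (\<forall>k. (\<forall>e. (\<Sum>j<N. k j * column f (\<beta> j) e) = 0) \<longrightarrow> (\<forall>j<N. k j = 0))"
proof -
  have sum: "(\<Sum>s\<in>box d. k s * column f s e) = (\<Sum>j<N. k (\<beta> j) * column f (\<beta> j) e)" for k e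
    using sum.reindex_bij_betw[OF assms(2), of "\<lambda>s. k s * column f s e"] by simp
  have "box d = \<beta> ` {..<N}" using assms(2) by (simp add: bij_betw_def)
  then have all: "(\<forall>s\<in>box d. k s = 0) \<longleftrightarrow> (\<forall>j<N. k (\<beta> j) = 0)" for k :: "_ \<Rightarrow> 'a"
    by (simp only: ball_simps(9)) auto
  show ?thesis unfolding box_injective_iff[OF assms(1)] sum all
  proof (intro iffI allI impI)
    fix k j assume *: "\<forall>k. (\<forall>e. (\<Sum>j<N. k (\<beta> j) * column f (\<beta> j) e) = 0) \<longrightarrow> (\<forall>j<N. k (\<beta> j) = 0)"
      "\<forall>e. (\<Sum>j<N. k j * column f (\<beta> j) e) = 0" "j < N"
    define k' where "k' s = k (the_inv_into {..<N} \<beta> s)" for s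
    have k': "k' (\<beta> j) = k j" if "j < N" for j
      using assms(2) that by (simp add: k'_def bij_betw_def the_inv_into_f_f)
    then have "\<forall>e. (\<Sum>j<N. k' (\<beta> j) * column f (\<beta> j) e) = 0" using *(2) by simp
    then have "\<forall>j<N. k' (\<beta> j) = 0" using *(1) by blast
    then show "k j = 0" using k' *(3) by simp
  next
    fix k :: "bool \<times> nat \<times> nat \<Rightarrow> 'a" and j
    assume *: "\<forall>k. (\<forall>e. (\<Sum>j<N. k j * column f (\<beta> j) e) = 0) \<longrightarrow> (\<forall>j<N. k j = 0)"
      "\<forall>e. (\<Sum>j<N. k (\<beta> j) * column f (\<beta> j) e) = 0" "j < N"
    then show "k (\<beta> j) = 0" using *(1)[THEN spec, of "\<lambda>j. k (\<beta> j)"] by blast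
  qed
qed

lemma map_poly_pderiv:
  assumes "comm_ring_hom \<kappa>" shows "map_poly \<kappa> (pderiv p) = pderiv (map_poly \<kappa> p)"
proof -
  interpret comm_ring_hom \<kappa> by fact
  show ?thesis by (intro poly_eqI) (simp add: coeff_map_poly coeff_pderiv hom_mult hom_add hom_of_nat)
qed

lemma hom_column:
  fixes \<kappa> :: "'a::idom \<Rightarrow> 'b::idom"
  assumes "comm_ring_hom \<kappa>"
  shows "\<kappa> (column f s e) = column (map_poly (map_poly \<kappa>) f) s e"
proof -
  let ?M = "map_poly (map_poly \<kappa>)"
  interpret \<kappa>: comm_ring_hom \<kappa> by fact
  interpret M: comm_ring_hom ?M by (intro map_poly_hom assms)
  have "?M (pderiv_y p) = pderiv_y (?M p)" for p
    by (intro poly_eqI) (simp add: coeff_map_poly pderiv_y_def flip: map_poly_pderiv[OF assms])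
  moreover have "?M (unit_form t s) = unit_form t s" for t
    by (auto simp: unit_form_def intro!: poly_eqI simp: coeff_map_poly)
  ultimately have "?M (closed_form f (unit_form False s) (unit_form True s)) =
      closed_form (?M f) (unit_form False s) (unit_form True s)"
    by (simp add: closed_form_def M.hom_add M.hom_minus M.hom_mult map_poly_pderiv[OF map_poly_hom[OF assms]])
  then show ?thesis
    by (simp add: column_def coeff_map_poly[of \<kappa>, symmetric] coeff_map_poly[of "map_poly \<kappa>", symmetric])
qed

definition hom_coeffs :: "nat \<Rightarrow> nat \<Rightarrow> 'a::idom mpoly poly poly \<Rightarrow> bool" where
  "hom_coeffs m d A \<longleftrightarrow> (\<forall>i j. coeff (coeff A i) j \<in> polys m \<and> homogeneous d (coeff (coeff A i) j))"

lemma hom_coeffs_add: "hom_coeffs m d A \<Longrightarrow> hom_coeffs m d B \<Longrightarrow> hom_coeffs m d (A + B)"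
  by (auto simp: hom_coeffs_def intro: homogeneous_add)

lemma hom_coeffs_diff: "hom_coeffs m d A \<Longrightarrow> hom_coeffs m d B \<Longrightarrow> hom_coeffs m d (A - B)"
  by (auto simp: hom_coeffs_def intro: homogeneous_diff)

lemma hom_coeffs_mult: "hom_coeffs m d A \<Longrightarrow> hom_coeffs m e B \<Longrightarrow> hom_coeffs m (d + e) (A * B)"
  unfolding hom_coeffs_def coeff_mult coeff_sum
  by (intro allI conjI sum_in_polys homogeneous_sum mult_in_polys homogeneous_mult) auto

lemma of_nat_mpoly: "of_nat k = (const_poly (of_nat k) :: 'a::comm_ring_1 mpoly)"
  by (rule const_poly.hom_of_nat[symmetric])

lemma hom_coeffs_pderiv: "hom_coeffs m d A \<Longrightarrow> hom_coeffs m d (pderiv A)"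
proof -
  assume *: "hom_coeffs m d A"
  have "coeff (of_nat (Suc i) * p) j = of_nat (Suc i) * coeff p j" for i j and p :: "'a mpoly poly"
    by (simp add: of_nat_poly del: of_nat_Suc)
  then show ?thesis using *
    by (auto simp: hom_coeffs_def coeff_pderiv of_nat_mpoly homogeneous_const_mult simp del: of_nat_Suc)
qed

lemma hom_coeffs_pderiv_y: "hom_coeffs m d A \<Longrightarrow> hom_coeffs m d (pderiv_y A)"
  by (auto simp: hom_coeffs_def coeff_pderiv of_nat_mpoly homogeneous_const_mult simp del: of_nat_Suc)

lemma hom_coeffs_unit_form: "hom_coeffs m 0 (unit_form t s)"
  by (auto simp: hom_coeffs_def unit_form_def)

lemma column_homogeneous:
  assumes "hom_coeffs m d f"
  shows "column f s e \<in> polys m" "homogeneous d (column f s e)"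
proof -
  have "hom_coeffs m d (closed_form f (unit_form False s) (unit_form True s))"
    unfolding closed_form_def
    using hom_coeffs_mult[OF assms hom_coeffs_diff[OF hom_coeffs_pderiv_y[OF hom_coeffs_unit_form]
        hom_coeffs_pderiv[OF hom_coeffs_unit_form]], of False s True s]
      hom_coeffs_mult[OF hom_coeffs_unit_form hom_coeffs_pderiv_y[OF assms], of False s]
      hom_coeffs_mult[OF hom_coeffs_unit_form hom_coeffs_pderiv[OF assms], of True s]
    by (auto intro: hom_coeffs_add hom_coeffs_diff)
  then show "column f s e \<in> polys m" "homogeneous d (column f s e)"
    by (auto simp: hom_coeffs_def column_def)
qed

text \<open>A parameter \<open>T\<close> packs the vectors \<open>P\<close>, \<open>u\<close>, \<open>v\<close> one after the other.\<close>

definition slice :: "nat \<Rightarrow> ('a::zero \<Rightarrow> 'b::idom) \<Rightarrow> (nat \<Rightarrow> 'b) \<Rightarrow> 'a mpoly \<Rightarrow> 'b poly poly" where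
  "slice n h T = plane h T (\<lambda>i. T (n + i)) (\<lambda>i. T (2 * n + i))"

lemma map_poly_slice:
  "comm_ring_hom k \<Longrightarrow> map_poly (map_poly k) (slice n h T H) = slice n (\<lambda>c. k (h c)) (\<lambda>i. k (T i)) H"
  by (simp add: slice_def map_poly_plane)

lemma hom_coeffs_slice:
  assumes "H \<in> polys n" "homogeneous d H"
  shows "hom_coeffs (3 * n) d (slice n const_poly var_poly H)"
  unfolding slice_def plane_def line_def
proof (rule mpoly_eval_graded[OF assms])
  fix i assume "i < n"
  then have "var_poly i \<in> polys (3 * n)" "var_poly (n + i) \<in> polys (3 * n)" "var_poly (2 * n + i) \<in> polys (3 * n)"
    by auto
  then show "hom_coeffs (3 * n) 1 [:[:var_poly i, var_poly (2 * n + i):], [:var_poly (n + i):]:]"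
    using homogeneous_var by (auto simp: hom_coeffs_def coeff_pCons split: nat.split)
qed (auto intro: hom_coeffs_add hom_coeffs_mult, auto simp: hom_coeffs_def coeff_pCons coeff_1 split: nat.split)

lemma irreducible_imp_pos_degree:
  fixes H :: "'a::field mpoly"
  assumes "homogeneous d H" "irreducible H" shows "d > 0"
  using assms total_degree_homogeneous[OF assms(1)] by (auto simp: irreducible_def mpoly_unit_iff)

text \<open>Injectivity is obtained for a smooth point \<open>P\<close> with \<open>v\<close>
  indeterminate, specialized to one complex \<open>v\<close>, and then spread by a determinant to
  all parameters off a hypersurface.\<close>

lemma box_injective_generic:
  fixes H :: "complex mpoly"
  assumes H: "H \<in> polys n" "homogeneous d H" "irreducible H"
  obtains W D where "W \<in> polys (3 * n)" "W \<noteq> 0" "homogeneous D W" "D \<le> 4 * d ^ 3"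
    "\<And>T. mpoly_eval id T W \<noteq> 0 \<Longrightarrow> box_injective d (slice n id T H)"
proof -
  have d: "d > 0" using irreducible_imp_pos_degree H by blast
  define N where "N = card (box d)"
  obtain \<beta> where \<beta>: "bij_betw \<beta> {..<N} (box d)"
    using ex_bij_betw_nat_finite[OF finite_box, of d] by (auto simp: N_def lessThan_atLeast0)
  obtain P u where P: "mpoly_eval id P H = 0" "mpoly_eval id u H \<noteq> 0" "poly (pderiv (line id P u H)) 0 \<noteq> 0"
    using smooth_point[OF H] by blast
  interpret generic_plane P u .
  have h: "comm_ring_hom (mpoly_eval id v :: complex mpoly \<Rightarrow> complex)" for v
    by (rule mpoly_eval_hom[OF id_comm_ring_hom(1)])
  have "box_injective d (sub H)"
    using sub_box_injective[OF H(1,2) mpoly_irreducible_imp_prime_elem[OF H(3)] d P] .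
  then have inj: "k j = 0" if "\<And>e. (\<Sum>j<N. k j * column (sub H) (\<beta> j) e) = 0" "j < N" for k j
    using that unfolding box_injective_enumerate[OF d \<beta>] by blast
  obtain v where v: "\<forall>k. (\<forall>e. (\<Sum>j<N. k j * mpoly_eval id v (column (sub H) (\<beta> j) e)) = 0) \<longrightarrow> (\<forall>j<N. k j = 0)"
    using generic_injective[where N = N and c = "\<lambda>j. column (sub H) (\<beta> j)"] inj by blast
  have sub_v: "map_poly (map_poly (mpoly_eval id v)) (sub H) = plane id P u v H"
    unfolding sub_def map_poly_plane[OF h] by (simp add: mpoly_eval_var id_def)
  define T0 where "T0 i = (if i < n then P i else if i < 2 * n then u (i - n) else v (i - 2 * n))" for i
  have T0: "slice n id T0 H = plane id P u v H"
    unfolding slice_def plane_def line_def by (rule mpoly_eval_cong[OF H(1)]) (auto simp: T0_def)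
  define f where "f = slice n const_poly var_poly H"
  have f: "map_poly (map_poly (mpoly_eval id T)) f = slice n id T H" for T
    unfolding f_def map_poly_slice[OF h] by (simp add: mpoly_eval_var id_def)
  have col: "mpoly_eval id T (column f s e) = column (slice n id T H) s e" for T s e
    unfolding hom_column[OF h] f ..
  have inj0: "k j = 0" if "\<And>e. (\<Sum>j<N. k j * mpoly_eval id T0 (column f (\<beta> j) e)) = 0" "j < N" for k j
    using that v unfolding hom_column[OF h] f T0 sub_v by blast
  have "\<exists>W \<in> polys (3 * n). homogeneous (N * d) W \<and> W \<noteq> 0 \<and> (\<forall>T. mpoly_eval id T W \<noteq> 0 \<longrightarrow>
      (\<forall>k. (\<forall>e. (\<Sum>j<N. k j * mpoly_eval id T (column f (\<beta> j) e)) = 0) \<longrightarrow> (\<forall>j<N. k j = 0)))"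
  proof (rule injective_open[where ?x0.0 = T0])
    show "column f (\<beta> j) e \<in> polys (3 * n)" "homogeneous d (column f (\<beta> j) e)" for j e
      unfolding f_def by (rule column_homogeneous[OF hom_coeffs_slice[OF H(1,2)]])+
  qed (rule inj0)
  then obtain W where W: "W \<in> polys (3 * n)" "homogeneous (N * d) W" "W \<noteq> 0"
    and inj: "\<And>T. mpoly_eval id T W \<noteq> 0 \<Longrightarrow> box_injective d (slice n id T H)"
    unfolding box_injective_enumerate[OF d \<beta>] col by blast
  \<comment> \<open>The number of unknowns times the degree of an entry;
    \<open>d + 1 \<le> 2 * d\<close> then gives the constant 4.\<close>
  have "N * d \<le> 2 * d * (d + 1) * d" unfolding N_def using card_box by (rule mult_right_mono) simp
  also have "\<dots> \<le> 4 * d ^ 3" using d by (simp add: power3_eq_cube algebra_simps)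
  finally show thesis using W inj that[of W "N * d"] by blast
qed

lemma slice_x_monic:
  assumes "H \<in> polys n" "homogeneous d H" "comm_ring_hom h" "mpoly_eval h (\<lambda>i. T (n + i)) H \<noteq> 0"
  shows "x_monic d (slice n h T H)"
  using plane_lead[OF assms(1-3)] assms(4)
  unfolding slice_def x_monic_def by (metis antisym le_degree pCons_eq_0_iff)

lemma slice_irreducible:
  fixes H :: "complex mpoly"
  assumes H: "H \<in> polys n" "homogeneous d H" "d > 0"
    and T: "box_injective d (slice n id T H)" "mpoly_eval id (\<lambda>i. T (n + i)) H \<noteq> 0"
  shows "irreducible (slice n id T H)"
proof -
  have m: "x_monic d (slice n id T H)" using slice_x_monic[OF H(1,2) id_comm_ring_hom(1) T(2)] .
  have y: "ydeg_le d (slice n id T H)" unfolding slice_def by (rule plane_ydeg[OF H(1,2)])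
  show ?thesis unfolding irreducible_def
  proof (intro conjI allI impI)
    show "slice n id T H \<noteq> 0" using m by (auto simp: x_monic_def)
    show "\<not> slice n id T H dvd 1"
    proof
      assume "slice n id T H dvd 1"
      then have "degree (slice n id T H) \<le> degree (1 :: complex poly poly)" by (intro dvd_imp_degree_le) auto
      then show False using m H(3) by (simp add: x_monic_def)
    qed
    fix a b assume "slice n id T H = a * b"
    then show "a dvd 1 \<or> b dvd 1"
      using reducible_closed_form[OF m y] T(1) unfolding box_injective_def by metis
  qed
qed

subsection \<open>Lifting rational factors\<close>

lemma lookup_map_0: "h 0 = 0 \<Longrightarrow> Poly_Mapping.lookup (Poly_Mapping.map h p) m = h (Poly_Mapping.lookup p m)"
  by (auto simp: Poly_Mapping.map.rep_eq when_def)

lemma keys_map_subset: "h 0 = 0 \<Longrightarrow> Poly_Mapping.keys (Poly_Mapping.map h p) \<subseteq> Poly_Mapping.keys p"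
  by (auto simp: in_keys_iff lookup_map_0)

lemma map_in_polys: "h 0 = 0 \<Longrightarrow> p \<in> polys n \<Longrightarrow> Poly_Mapping.map h p \<in> polys n"
  using keys_map_subset[of h p] by (fastforce simp: polys_def)

lemma map_homogeneous: "h 0 = 0 \<Longrightarrow> homogeneous d p \<Longrightarrow> homogeneous d (Poly_Mapping.map h p)"
  using keys_map_subset[of h p] by (fastforce simp: homogeneous_def)

lemma mpoly_eval_map:
  assumes "h 0 = 0" "k 0 = 0"
  shows "mpoly_eval k x (Poly_Mapping.map h p) = mpoly_eval (\<lambda>c. k (h c)) x p"
  using assms keys_map_subset[of h p]
  by (subst mpoly_eval_superset[of "Poly_Mapping.keys p"]) (auto simp: mpoly_eval_altdef lookup_map_0)

lemma map_eq_mpoly_eval: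
  fixes h :: "'a::comm_ring_1 \<Rightarrow> 'b::comm_ring_1"
  assumes "h 0 = 0" shows "Poly_Mapping.map h p = mpoly_eval (\<lambda>c. const_poly (h c)) var_poly p"
  by (subst mpoly_eval_id[symmetric], subst mpoly_eval_map) (use assms in auto)

lemma map_hom:
  fixes h :: "'a::comm_ring_1 \<Rightarrow> 'b::comm_ring_1"
  assumes "comm_ring_hom h" shows "comm_ring_hom (Poly_Mapping.map h :: 'a mpoly \<Rightarrow> _)"
proof -
  have "Poly_Mapping.map h = mpoly_eval (\<lambda>c. const_poly (h c)) var_poly"
    by (rule ext, rule map_eq_mpoly_eval, rule comm_ring_hom_zero[OF assms])
  then show ?thesis using mpoly_eval_hom[OF comm_ring_hom_comp[OF const_poly_hom assms]] by metis
qed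

lemma const_poly_mult: "const_poly c * A = Poly_Mapping.map ((*) c) (A :: 'a::comm_ring_1 mpoly)"
  unfolding const_poly_def by (rule mult_map_scale_conv_mult[symmetric])

lemma of_rat_hom: "comm_ring_hom (of_rat :: rat \<Rightarrow> complex)"
  by unfold_locales (auto simp: of_rat_add of_rat_mult)

lemma slice_hom: "comm_ring_hom h \<Longrightarrow> comm_ring_hom (slice n h T)"
  unfolding slice_def by (rule plane_hom)

text \<open>\<open>\<phi>\<close> is only Q-linear, so a product passes through it when one factor
  is rational; \<open>map_mult\<close> is this for polynomials.\<close>

locale rational_projection =
  fixes \<phi> :: "complex \<Rightarrow> rat"
  assumes one: "\<phi> 1 = 1" and add: "\<phi> (a + b) = \<phi> a + \<phi> b" and scale: "\<phi> (of_rat q * a) = q * \<phi> a"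
begin

lemma zero [simp]: "\<phi> 0 = 0" using add[of 0 0] by simp

lemma sum: "\<phi> (sum f A) = (\<Sum>i\<in>A. \<phi> (f i))"
  by (induction A rule: infinite_finite_induct) (auto simp: add)

lemma of_rat [simp]: "\<phi> (of_rat q) = q" using scale[of q 1] by (simp add: one)

lemma eval_rational:
  "mpoly_eval id x (Poly_Mapping.map \<phi> A) = \<phi> (mpoly_eval id (\<lambda>i. of_rat (x i)) A)"
proof -
  have "\<phi> (c * monom_val (\<lambda>i. of_rat (x i)) m) = \<phi> c * monom_val x m" for c m
  proof -
    have "monom_val (\<lambda>i. of_rat (x i) :: complex) m = of_rat (monom_val x m)"
      by (simp add: monom_val_def of_rat_prod of_rat_power)
    then show ?thesis using scale[of "monom_val x m" c] by (simp add: mult.commute)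
  qed
  then show ?thesis
    by (simp add: mpoly_eval_map) (simp add: mpoly_eval_altdef sum)
qed

lemma vanishing_on_rationals:
  assumes "\<And>x. mpoly_eval id (\<lambda>i. of_rat (x i)) (A :: complex mpoly) = 0" shows "A = 0"
proof (rule ccontr)
  assume "A \<noteq> 0"
  then obtain m where m: "Poly_Mapping.lookup A m \<noteq> 0" by (metis lookup_zero poly_mapping_eqI)
  \<comment> \<open>Scaling one coefficient to 1 keeps the image under \<open>\<phi>\<close>
    nonzero, although \<open>\<phi>\<close> has a kernel.\<close>
  define c where "c = 1 / Poly_Mapping.lookup A m"
  let ?B = "Poly_Mapping.map \<phi> (const_poly c * A)"
  have "Poly_Mapping.lookup (const_poly c * A) m = c * Poly_Mapping.lookup A m"
    by (simp add: const_poly_mult lookup_map_0)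
  then have "Poly_Mapping.lookup ?B m = 1" using m by (simp add: lookup_map_0 c_def one)
  then have "?B \<noteq> 0" by auto
  moreover obtain n where "?B \<in> polys n" using ex_polys by blast
  ultimately obtain x where x: "mpoly_eval id x ?B \<noteq> 0" using mpoly_nonvanishing by blast
  interpret E: comm_ring_hom "mpoly_eval id (\<lambda>i. of_rat (x i)) :: complex mpoly \<Rightarrow> complex"
    by (rule mpoly_eval_hom[OF id_comm_ring_hom(1)])
  have "mpoly_eval id (\<lambda>i. of_rat (x i)) (const_poly c * A) = 0"
    by (simp only: E.hom_mult assms) simp
  then show False using x by (simp add: eval_rational)
qed

lemma map_mult:
  fixes A :: "rat mpoly"
  shows "Poly_Mapping.map \<phi> (Poly_Mapping.map of_rat A * B) = A * Poly_Mapping.map \<phi> B"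
proof -
  have "mpoly_eval id x (Poly_Mapping.map \<phi> (Poly_Mapping.map of_rat A * B) - A * Poly_Mapping.map \<phi> B) = 0" for x
  proof -
    interpret E: comm_ring_hom "mpoly_eval id x :: rat mpoly \<Rightarrow> rat"
      by (rule mpoly_eval_hom[OF id_comm_ring_hom(1)])
    interpret E': comm_ring_hom "mpoly_eval id (\<lambda>i. of_rat (x i)) :: complex mpoly \<Rightarrow> complex"
      by (rule mpoly_eval_hom[OF id_comm_ring_hom(1)])
    have "mpoly_eval id (\<lambda>i. of_rat (x i)) (Poly_Mapping.map of_rat A) = (of_rat (mpoly_eval id x A) :: complex)"
      using hom_mpoly_eval[OF of_rat_hom, of id x A] by (simp add: mpoly_eval_map)
    then show ?thesis
      by (simp add: E.hom_minus E.hom_mult eval_rational E'.hom_mult scale del: id_apply)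
  qed
  then show ?thesis using mpoly_nonvanishing ex_polys by (metis (no_types, lifting) right_minus_eq)
qed

lemma rational_values_imp_rational:
  assumes "\<And>x. of_rat (\<phi> (mpoly_eval id (\<lambda>i. of_rat (x i)) A)) = mpoly_eval id (\<lambda>i. of_rat (x i)) A"
  shows "A = Poly_Mapping.map of_rat (Poly_Mapping.map \<phi> A)"
proof -
  have "A - Poly_Mapping.map of_rat (Poly_Mapping.map \<phi> A) = 0"
  proof (rule vanishing_on_rationals)
    fix x
    interpret E: comm_ring_hom "mpoly_eval id (\<lambda>i. of_rat (x i)) :: complex mpoly \<Rightarrow> complex"
      by (rule mpoly_eval_hom[OF id_comm_ring_hom(1)])
    have "mpoly_eval id (\<lambda>i. of_rat (x i)) (Poly_Mapping.map of_rat (Poly_Mapping.map \<phi> A)) =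
        (of_rat (mpoly_eval id x (Poly_Mapping.map \<phi> A)) :: complex)"
      by (subst mpoly_eval_map; simp) (simp add: hom_mpoly_eval[OF of_rat_hom])
    then show "mpoly_eval id (\<lambda>i. of_rat (x i)) (A - Poly_Mapping.map of_rat (Poly_Mapping.map \<phi> A)) = 0"
      unfolding E.hom_minus eval_rational assms by simp
  qed
  then show ?thesis by simp
qed

end

lemma coeff_mult_low:
  fixes X Y :: "'a::comm_ring_1 poly"
  assumes "\<And>i. i < j \<Longrightarrow> coeff X i = 0"
  shows "coeff (X * Y) j = coeff X j * coeff Y 0" "i < j \<Longrightarrow> coeff (X * Y) i = 0"
proof -
  have "coeff (X * Y) j = (\<Sum>i\<le>j. if i = j then coeff X j * coeff Y 0 else 0)"
    unfolding coeff_mult using assms by (intro sum.cong) (auto simp: le_less)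
  then show "coeff (X * Y) j = coeff X j * coeff Y 0" by simp
  show "coeff (X * Y) i = 0" if "i < j"
    unfolding coeff_mult using assms that by (intro sum.neutral) auto
qed

text \<open>First-order expansion of a power: if \<open>X\<close> and \<open>Y\<close> agree below
  index j, the difference of their powers starts at j with the derivative times the
  difference.\<close>

lemma coeff_power_diff_low:
  fixes X Y :: "'a::comm_ring_1 poly"
  assumes "\<And>i. i < j \<Longrightarrow> coeff X i = coeff Y i" "j > 0"
  shows "coeff (X ^ Suc m - Y ^ Suc m) j = of_nat (Suc m) * coeff Y 0 ^ m * (coeff X j - coeff Y j) \<and>
    (\<forall>i<j. coeff (X ^ Suc m - Y ^ Suc m) i = 0)"
proof (induction m)
  case 0
  show ?case using assms by simp
next
  case (Suc m)
  have low: "coeff (X - Y) i = 0" if "i < j" for i using assms that by simp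
  define Dm where "Dm = X ^ Suc m - Y ^ Suc m"
  have split: "X ^ Suc (Suc m) - Y ^ Suc (Suc m) = (X - Y) * X ^ Suc m + Dm * Y"
    by (simp add: Dm_def algebra_simps)
  have x0: "coeff (X ^ Suc m) 0 = coeff Y 0 ^ Suc m"
    using assms(1)[of 0] assms(2) by (metis coeff_0_power)
  have Dm: "coeff Dm j = of_nat (Suc m) * coeff Y 0 ^ m * (coeff X j - coeff Y j)"
    "\<And>i. i < j \<Longrightarrow> coeff Dm i = 0"
    using Suc.IH by (auto simp only: Dm_def)
  have "coeff (X ^ Suc (Suc m) - Y ^ Suc (Suc m)) j =
      (coeff X j - coeff Y j) * coeff Y 0 ^ Suc m + of_nat (Suc m) * coeff Y 0 ^ m * (coeff X j - coeff Y j) * coeff Y 0"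
  proof -
    have "coeff ((X - Y) * X ^ Suc m) j = (coeff X j - coeff Y j) * coeff Y 0 ^ Suc m"
      using coeff_mult_low(1)[where X = "X - Y" and j = j and Y = "X ^ Suc m"] low x0 by simp
    moreover have "coeff (Dm * Y) j = of_nat (Suc m) * coeff Y 0 ^ m * (coeff X j - coeff Y j) * coeff Y 0"
      using coeff_mult_low(1)[where X = Dm and j = j and Y = Y] Dm by metis
    ultimately show ?thesis unfolding split coeff_add by simp
  qed
  also have "\<dots> = of_nat (Suc (Suc m)) * coeff Y 0 ^ Suc m * (coeff X j - coeff Y j)"
    by (simp add: algebra_simps)
  finally show ?case
    using coeff_mult_low(2)[where X = "X - Y" and j = j and Y = "X ^ Suc m"]
      coeff_mult_low(2)[where X = Dm and j = j and Y = Y] low Dm(2) unfolding split coeff_add by simp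
qed

text \<open>
  Comparing coefficients of \<open>z\<^sup>j\<close> in \<open>F = G\<^sup>m Q\<close> gives a linear equation for those of \<open>G\<close> and \<open>Q\<close>
  whose solution is unique, hence fixed by \<open>\<Phi>\<close>.
\<close>

lemma hensel_fixed:
  fixes \<Phi> :: "'a::idom \<Rightarrow> 'a"
  assumes \<Phi>: "\<Phi> 1 = 1" "\<And>a b. \<Phi> (a + b) = \<Phi> a + \<Phi> b" "\<And>a. \<Phi> (\<Phi> a) = \<Phi> a"
    "\<And>r a. \<Phi> r = r \<Longrightarrow> \<Phi> (r * a) = r * \<Phi> a"
    and F: "F = G ^ Suc m * Q" "\<And>i. \<Phi> (coeff F i) = coeff F i"
    and GQ: "\<Phi> (coeff G 0) = coeff G 0" "\<Phi> (coeff Q 0) = coeff Q 0" "coeff G 0 \<noteq> 0"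
    and uniq: "\<And>j B. j > 0 \<Longrightarrow> of_nat (Suc m) * coeff Q 0 * (coeff G j - \<Phi> (coeff G j)) + coeff G 0 * B = 0 \<Longrightarrow>
      coeff G j - \<Phi> (coeff G j) = 0"
  shows "\<Phi> (coeff G j) = coeff G j \<and> \<Phi> (coeff Q j) = coeff Q j"
proof (induction j rule: less_induct)
  case (less j)
  show ?case
  proof (cases "j = 0")
    case False
    then have j: "j > 0" by simp
    have \<Phi>0: "\<Phi> 0 = 0" using \<Phi>(4)[OF \<Phi>(1), of 0] \<Phi>(2)[of 0 0] by (metis add_cancel_right_right add_0)
    have \<Phi>_minus: "\<Phi> (a - b) = \<Phi> a - \<Phi> b" for a b using \<Phi>(2)[of "a - b" b] by simp
    have fix_mult: "\<Phi> (a * b) = a * b" if "\<Phi> a = a" "\<Phi> b = b" for a b using \<Phi>(4) that by simp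
    have fix_power: "\<Phi> (a ^ k) = a ^ k" if "\<Phi> a = a" for a k
      using that by (induction k) (auto simp: \<Phi>(1) fix_mult)
    have fix_nat: "\<Phi> (of_nat k) = of_nat k" for k by (induction k) (auto simp: \<Phi>0 \<Phi>(1,2))
    have fix_sum: "\<Phi> (sum f A) = sum f A" if "\<And>i. i \<in> A \<Longrightarrow> \<Phi> (f i) = f i" for f and A :: "nat set"
      using that by (induction A rule: infinite_finite_induct) (auto simp: \<Phi>0 \<Phi>(2))
    define fixp where "fixp A \<longleftrightarrow> (\<forall>i. \<Phi> (coeff A i) = coeff A i)" for A
    have fixp_mult: "fixp (A * B)" if "fixp A" "fixp B" for A B
      using that unfolding fixp_def coeff_mult by (intro allI fix_sum fix_mult) auto
    \<comment> \<open>The projected factors agree with \<open>G\<close> and \<open>Q\<close> below j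
      by induction, so at j only the errors \<open>A\<close> and \<open>B\<close> enter, and they
      enter linearly.\<close>
    define G' Q' where "G' = map_poly \<Phi> G" and "Q' = map_poly \<Phi> Q"
    have G': "coeff G' i = \<Phi> (coeff G i)" and Q': "coeff Q' i = \<Phi> (coeff Q i)" for i
      by (simp_all add: G'_def Q'_def coeff_map_poly \<Phi>0)
    have "fixp G'" "fixp Q'" by (simp_all add: fixp_def G' Q' \<Phi>(3))
    moreover have "fixp (A ^ k)" if "fixp A" for A k
      using that by (induction k) (auto simp: fixp_mult, simp add: fixp_def coeff_1 \<Phi>0 \<Phi>(1))
    ultimately have fix': "fixp (G' ^ Suc m * Q')" by (intro fixp_mult)
    define g q where "g = coeff G 0" and "q = coeff Q 0"
    define A B where "A = coeff G j - \<Phi> (coeff G j)" and "B = coeff Q j - \<Phi> (coeff Q j)"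
    have AB: "\<Phi> A = 0" "\<Phi> B = 0" by (simp_all add: A_def B_def \<Phi>_minus \<Phi>(3))
    have agree: "coeff G i = coeff G' i" "coeff Q i = coeff Q' i" if "i < j" for i
      using less[OF that] by (simp_all add: G' Q')
    have pw: "coeff (G ^ Suc m - G' ^ Suc m) j = of_nat (Suc m) * g ^ m * A"
      "\<And>i. i < j \<Longrightarrow> coeff (G ^ Suc m - G' ^ Suc m) i = 0"
      using coeff_power_diff_low[OF agree(1) j, of m] unfolding G' GQ(1) g_def A_def by blast+
    have "F - G' ^ Suc m * Q' = (G ^ Suc m - G' ^ Suc m) * Q + (Q - Q') * G' ^ Suc m"
      unfolding F(1) by (simp add: algebra_simps)
    moreover have "coeff ((G ^ Suc m - G' ^ Suc m) * Q) j = of_nat (Suc m) * g ^ m * A * q"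
      using coeff_mult_low(1)[where X = "G ^ Suc m - G' ^ Suc m" and j = j and Y = Q] pw
      unfolding q_def by metis
    moreover have "coeff ((Q - Q') * G' ^ Suc m) j = B * g ^ Suc m"
    proof -
      have "coeff ((Q - Q') * G' ^ Suc m) j = coeff (Q - Q') j * coeff (G' ^ Suc m) 0"
        by (rule coeff_mult_low(1)) (use agree in simp)
      also have "coeff (G' ^ Suc m) 0 = g ^ Suc m" by (simp only: coeff_0_power G' GQ(1) g_def)
      finally show ?thesis by (simp add: B_def Q')
    qed
    ultimately have r: "coeff F j - coeff (G' ^ Suc m * Q') j = of_nat (Suc m) * g ^ m * A * q + B * g ^ Suc m"
      unfolding coeff_diff[symmetric] by (simp only: coeff_add)
    have fg: "\<Phi> (of_nat (Suc m) * g ^ m * q) = of_nat (Suc m) * g ^ m * q" "\<Phi> (g ^ Suc m) = g ^ Suc m"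
      using GQ by (auto simp: g_def q_def intro!: fix_mult fix_power fix_nat simp del: of_nat_Suc power_Suc)
    \<comment> \<open>This quantity is killed by \<open>\<Phi>\<close> because \<open>A\<close> and
      \<open>B\<close> are, and it is also fixed by \<open>\<Phi>\<close>, being a coefficient of a
      difference of fixed polynomials. Hence it is 0.\<close>
    have "\<Phi> (of_nat (Suc m) * g ^ m * q * A + g ^ Suc m * B) = 0"
      unfolding \<Phi>(2) \<Phi>(4)[OF fg(1), of A] \<Phi>(4)[OF fg(2), of B] AB by simp
    moreover have "\<Phi> (coeff F j - coeff (G' ^ Suc m * Q') j) = coeff F j - coeff (G' ^ Suc m * Q') j"
      using F(2) fix' by (simp only: \<Phi>_minus fixp_def)
    moreover have r': "coeff F j - coeff (G' ^ Suc m * Q') j = of_nat (Suc m) * g ^ m * q * A + g ^ Suc m * B"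
    proof -
      have "N * p * A * q + B * p' = N * p * q * A + p' * B" for N p p' by (simp add: algebra_simps)
      then show ?thesis unfolding r .
    qed
    ultimately have z: "of_nat (Suc m) * g ^ m * q * A + g ^ Suc m * B = 0"
      by metis
    have "g ^ m * (N * q * A + g * B) = N * g ^ m * q * A + g ^ Suc m * B" for N
      by (simp add: algebra_simps)
    then have "g ^ m * (of_nat (Suc m) * q * A + g * B) = 0" using z by metis
    then have z': "of_nat (Suc m) * q * A + g * B = 0" using GQ(3) by (simp add: g_def)
    then have "A = 0" using uniq[OF j, of B] by (simp only: q_def g_def A_def)
    then have "B = 0" using z' GQ(3) by (simp add: g_def)
    then show ?thesis using \<open>A = 0\<close> by (simp add: A_def B_def)
  qed (use GQ in simp)
qed

section \<open>A third direction, and unique lifting of factorizations\<close>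

lemma mpoly_of_rat_eval:
  "mpoly_eval id x (Poly_Mapping.map of_rat A) = (mpoly_eval of_rat x A :: complex)"
  by (simp add: mpoly_eval_map)

text \<open>The slice thickened in a third direction: H(P + x u + y v + z t) with z outermost. At x
  = y = 0 and z = 1 it gives the value at P + t.\<close>

definition space :: "nat \<Rightarrow> ('a::zero \<Rightarrow> 'b::idom) \<Rightarrow> (nat \<Rightarrow> 'b) \<Rightarrow> (nat \<Rightarrow> 'b) \<Rightarrow> 'a mpoly \<Rightarrow> 'b poly poly poly" where
  "space n h T t = line (\<lambda>c. [:[:h c:]:]) (\<lambda>i. [:[:T i, T (2 * n + i):], [:T (n + i):]:]) (\<lambda>i. [:[:t i:]:])"

lemma space_hom: "comm_ring_hom h \<Longrightarrow> comm_ring_hom (space n h T t)"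
  unfolding space_def by (intro line_hom const_lift_hom)

lemma coeff_0_space: "coeff (space n h T t G) 0 = slice n h T G"
  using poly_line[of "\<lambda>c. [:[:h c:]:]" "\<lambda>i. [:[:T i, T (2 * n + i):], [:T (n + i):]:]" "\<lambda>i. [:[:t i:]:]" G 0]
  by (simp add: space_def slice_def plane_def line_def poly_0_coeff_0)

text \<open>The total degree in x and z is at most \<open>e\<close>, so for positive j the
  coefficient of z^j has degree below \<open>e\<close> in x. This makes the linear equation of the
  Hensel step uniquely solvable.\<close>

lemma degree_coeff_space:
  fixes T :: "nat \<Rightarrow> 'b::idom"
  assumes "G \<in> polys n" "homogeneous e G"
  shows "coeff (space n h T t G) j \<noteq> 0 \<Longrightarrow> degree (coeff (space n h T t G) j) + j \<le> e"
proof -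
  define Q where "Q e A \<longleftrightarrow> (\<forall>j. (j > e \<longrightarrow> coeff A j = 0) \<and> degree (coeff A j) \<le> e - j)"
    for e and A :: "'b poly poly poly"
  have "Q e (space n h T t G)"
    unfolding space_def line_def
  proof (rule mpoly_eval_graded[OF assms])
    show "Q e (A + B)" if "Q e A" "Q e B" for e A B
      using that by (auto simp: Q_def intro: degree_add_le)
    show "Q (d + e) (A * B)" if AB: "Q d A" "Q e B" for d e A B
      unfolding Q_def
    proof (intro allI conjI impI)
      fix j
      show "coeff (A * B) j = 0" if "d + e < j"
        unfolding coeff_mult
      proof (intro sum.neutral ballI)
        fix i assume "i \<in> {..j}"
        then have "d < i \<or> e < j - i" using that by auto
        then show "coeff A i * coeff B (j - i) = 0" using AB by (auto simp: Q_def)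
      qed
      show "degree (coeff (A * B) j) \<le> d + e - j"
        unfolding coeff_mult
      proof (intro degree_sum_le)
        fix i assume i: "i \<in> {..j}"
        show "degree (coeff A i * coeff B (j - i)) \<le> d + e - j"
        proof (cases "d < i \<or> e < j - i")
          case True
          then show ?thesis using AB by (auto simp: Q_def)
        next
          case False
          moreover have "degree (coeff A i) \<le> d - i" "degree (coeff B (j - i)) \<le> e - (j - i)"
            using AB by (auto simp: Q_def)
          ultimately show ?thesis using i degree_mult_le[of "coeff A i" "coeff B (j - i)"] by auto
        qed
      qed simp
    qed
  qed (auto simp: Q_def coeff_pCons coeff_1 split: nat.splits)
  then have "(j > e \<longrightarrow> coeff (space n h T t G) j = 0) \<and> degree (coeff (space n h T t G) j) \<le> e - j"
    by (simp add: Q_def)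
  then show "degree (coeff (space n h T t G) j) + j \<le> e" if "coeff (space n h T t G) j \<noteq> 0"
    using that by (cases "j > e") auto
qed

lemma const_units:
  assumes "[:[:c:]:] = a * b" "c \<noteq> (0::complex)"
  obtains c1 c2 where "a = [:[:c1:]:]" "b = [:[:c2:]:]" "c1 * c2 = c"
proof -
  have nz: "a \<noteq> 0" "b \<noteq> 0" using assms by auto
  have "degree a + degree b = 0" using assms nz by (metis degree_mult_eq degree_pCons_0)
  then obtain a0 b0 where ab: "a = [:a0:]" "b = [:b0:]" by (metis add_is_0 degree_0_id)
  then have eq: "[:c:] = a0 * b0" using assms by simp
  then have "a0 \<noteq> 0" "b0 \<noteq> 0" using assms by auto
  then have "degree a0 + degree b0 = 0" using eq by (metis degree_mult_eq degree_pCons_0)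
  then obtain c1 c2 where "a0 = [:c1:]" "b0 = [:c2:]" by (metis add_is_0 degree_0_id)
  then show thesis using that ab eq by simp
qed

text \<open>\<open>S\<close> will be the set of irreducible factors of \<open>F\<close> over C.
  Between irreducible slices divisibility means proportionality, so \<open>assoc\<close> says that
  non-proportional factors stay so on the plane.\<close>

locale good_slice =
  fixes n :: nat and T :: "nat \<Rightarrow> complex" and S :: "complex mpoly set"
  assumes irr: "H \<in> S \<Longrightarrow> irreducible (slice n id T H)"
    and assoc: "H \<in> S \<Longrightarrow> H' \<in> S \<Longrightarrow> slice n id T H dvd slice n id T H' \<Longrightarrow>
      \<exists>\<kappa>. \<kappa> \<noteq> 0 \<and> H' = const_poly \<kappa> * H"
begin

definition sl :: "complex mpoly \<Rightarrow> complex poly poly" where "sl = slice n id T"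

sublocale sl: comm_ring_hom sl unfolding sl_def by (rule slice_hom[OF id_comm_ring_hom(1)])

lemmas sl_irr = irr[folded sl_def]
lemmas sl_assoc = assoc[folded sl_def]

text \<open>The units are constants. Carrying the constant explicitly lets factorizations lift as
  equalities instead of up to association.\<close>

definition scaled :: "complex \<Rightarrow> complex mpoly multiset \<Rightarrow> complex mpoly" where
  "scaled c M = const_poly c * prod_mset M"

lemma sl_const: "sl (const_poly c) = [:[:c:]:]"
  by (simp add: sl_def slice_def plane_def line_def)

lemma sl_prime: "H \<in> S \<Longrightarrow> prime_elem (sl H)"
  using sl_irr irreducible_imp_prime_elem by blast

lemma scaled_add: "scaled c (add_mset H M) = H * scaled c M"
  by (simp add: scaled_def mult.left_commute)

lemma scaled_empty: "scaled c {#} = const_poly c"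
  by (simp add: scaled_def)

lemma sl_scaled_empty: "sl (scaled c {#}) = [:[:c:]:]"
  by (simp only: scaled_empty sl_const)

text \<open>Each \<open>sl H\<close> is prime and therefore divides \<open>a\<close> or
  \<open>b\<close>; this distributes the multiset over the two factors.\<close>

lemma lift_factor:
  assumes "c \<noteq> 0" "set_mset M \<subseteq> S" "sl (scaled c M) = a * b"
  shows "\<exists>M1 M2 c1 c2. M = M1 + M2 \<and> c1 * c2 = c \<and> a = sl (scaled c1 M1) \<and> b = sl (scaled c2 M2)"
  using assms(2,3)
proof (induction M arbitrary: a b)
  case empty
  then have "[:[:c:]:] = a * b" unfolding sl_scaled_empty by blast
  then obtain c1 c2 where "a = [:[:c1:]:]" "b = [:[:c2:]:]" "c1 * c2 = c"
    using const_units assms(1) by metis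
  then show ?case
    by (intro exI[of _ "{#}"] exI[of _ c1] exI[of _ c2]) (simp only: sl_scaled_empty add_0 simp_thms)
next
  case (add H M)
  have H: "prime_elem (sl H)" using add.prems sl_prime by simp
  have ab: "sl H * sl (scaled c M) = a * b" using add.prems by (simp add: scaled_add sl.hom_mult)
  then have "sl H dvd a * b" by (metis dvd_triv_left)
  then consider a' where "a = sl H * a'" | b' where "b = sl H * b'"
    using H prime_elem_dvd_mult_iff by (metis dvdE)
  then show ?case
  proof cases
    case 1
    then have "sl H * sl (scaled c M) = sl H * (a' * b)" using ab by (simp add: mult.assoc)
    then have "sl (scaled c M) = a' * b" using H by (simp only: mult_cancel_left) (auto simp: prime_elem_def)
    then obtain M1 M2 c1 c2 where
      "M = M1 + M2" "c1 * c2 = c" "a' = sl (scaled c1 M1)" "b = sl (scaled c2 M2)"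
      using add.IH[of a' b] add.prems by auto
    then show ?thesis using 1
      by (intro exI[of _ "add_mset H M1"] exI[of _ M2] exI[of _ c1] exI[of _ c2])
        (simp add: scaled_add sl.hom_mult)
  next
    case 2
    then have "sl H * sl (scaled c M) = sl H * (a * b')" using ab by (simp add: mult.left_commute)
    then have "sl (scaled c M) = a * b'" using H by (simp only: mult_cancel_left) (auto simp: prime_elem_def)
    then obtain M1 M2 c1 c2 where
      "M = M1 + M2" "c1 * c2 = c" "a = sl (scaled c1 M1)" "b' = sl (scaled c2 M2)"
      using add.IH[of a b'] add.prems by auto
    then show ?thesis using 2
      by (intro exI[of _ M1] exI[of _ "add_mset H M2"] exI[of _ c1] exI[of _ c2])
        (simp add: scaled_add sl.hom_mult)
  qed
qed

text \<open>Primality on the plane together with \<open>assoc\<close> matches the two multisets up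
  to constants. Because of this the equal factors of a power have one common lift in
  \<open>lift_power\<close>.\<close>

lemma unique_lift:
  assumes "set_mset M \<subseteq> S" "set_mset M' \<subseteq> S" "c \<noteq> 0" "c' \<noteq> 0" "sl (scaled c M) = sl (scaled c' M')"
  shows "scaled c M = scaled c' M'"
  using assms
proof (induction M arbitrary: M' c')
  case empty
  have "M' = {#}"
  proof (rule ccontr)
    assume "M' \<noteq> {#}"
    then obtain H M'' where M': "M' = add_mset H M''" by (meson multiset_cases)
    have "sl (scaled c {#}) dvd 1"
      using empty.prems(3) by (intro dvdI[of _ _ "[:[:1 / c:]:]"]) (simp only: sl_scaled_empty, simp add: one_pCons)
    then have "sl H dvd 1"
      unfolding empty.prems(5) M' scaled_add sl.hom_mult using dvd_mult_left by blast
    then show False using sl_irr[of H] empty.prems(2) M' by (auto simp: irreducible_def)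
  qed
  then have "[:[:c:]:] = [:[:c':]:]"
    using empty.prems(5) by (simp only: \<open>M' = {#}\<close> sl_scaled_empty)
  then show ?case using \<open>M' = {#}\<close> by simp
next
  case (add H M)
  have H: "H \<in> S" "prime_elem (sl H)" using add.prems sl_prime by auto
  have "sl H dvd sl (scaled c' M')" unfolding add.prems(5)[symmetric] by (simp add: scaled_add sl.hom_mult)
  then have "\<exists>H'. H' \<in># M' \<and> sl H dvd sl H'"
    using add.prems(2)
  proof (induction M')
    case empty
    have "sl (scaled c' {#}) dvd 1"
      using add.prems(4) by (intro dvdI[of _ _ "[:[:1 / c':]:]"]) (simp only: sl_scaled_empty, simp add: one_pCons)
    then have "sl H dvd 1" using empty(1) dvd_trans by blast
    then show ?case using sl_irr[OF H(1)] by (auto simp: irreducible_def)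
  next
    case (add H' M')
    then have "sl H dvd sl H' \<or> sl H dvd sl (scaled c' M')"
      using H(2) by (simp add: scaled_add sl.hom_mult prime_elem_dvd_mult_iff)
    then show ?case using add by auto
  qed
  then obtain H' where H': "H' \<in># M'" "sl H dvd sl H'" by blast
  then obtain \<kappa> where \<kappa>: "\<kappa> \<noteq> 0" "H' = const_poly \<kappa> * H" using sl_assoc H(1) add.prems(2) by blast
  obtain M'' where M'': "M' = add_mset H' M''" using H'(1) by (meson mset_add)
  have eq: "scaled c' M' = H * scaled (\<kappa> * c') M''"
    unfolding M'' scaled_add \<kappa>(2) by (simp add: scaled_def const_poly.hom_mult algebra_simps)
  have "sl H * sl (scaled c M) = sl H * sl (scaled (\<kappa> * c') M'')"
    using add.prems(5) unfolding eq scaled_add sl.hom_mult .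
  then have "sl (scaled c M) = sl (scaled (\<kappa> * c') M'')"
    using H by (simp only: mult_cancel_left) (auto simp: prime_elem_def)
  then have "scaled c M = scaled (\<kappa> * c') M''"
    using add.prems M'' \<kappa>(1) by (intro add.IH) auto
  then show ?case unfolding eq scaled_add by simp
qed

lemma lift_power:
  assumes "c \<noteq> 0" "set_mset M \<subseteq> S" "sl (scaled c M) = g ^ Suc m * q"
  shows "\<exists>M1 c1 Q. set_mset M1 \<subseteq> S \<and> c1 \<noteq> 0 \<and> scaled c M = scaled c1 M1 ^ Suc m * Q \<and>
    sl (scaled c1 M1) = g \<and> sl Q = q"
  using assms
proof (induction m arbitrary: c M)
  case 0
  then obtain M1 M2 c1 c2 where *: "M = M1 + M2" "c1 * c2 = c" "g = sl (scaled c1 M1)" "q = sl (scaled c2 M2)"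
    using lift_factor[of c M g q] by (simp only: power_Suc power_0 mult_1_right) blast
  moreover have "scaled c M = scaled c1 M1 ^ Suc 0 * scaled c2 M2"
    by (simp add: *(1) flip: *(2)) (simp add: scaled_def const_poly.hom_mult algebra_simps)
  ultimately show ?case using 0 by (intro exI[of _ M1] exI[of _ c1] exI[of _ "scaled c2 M2"]) auto
next
  case (Suc m)
  then obtain M1 M2 c1 c2 where *: "M = M1 + M2" "c1 * c2 = c" "g = sl (scaled c1 M1)"
    "g ^ Suc m * q = sl (scaled c2 M2)"
    using lift_factor[of c M g "g ^ Suc m * q"] by (simp only: power_Suc[of g "Suc m"] mult.assoc) blast
  have nz: "c1 \<noteq> 0" "c2 \<noteq> 0" using * Suc.prems by auto
  obtain M3 c3 Q where 3: "set_mset M3 \<subseteq> S" "c3 \<noteq> 0" "scaled c2 M2 = scaled c3 M3 ^ Suc m * Q"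
    "sl (scaled c3 M3) = g" "sl Q = q"
    using Suc.IH[of c2 M2] nz * Suc.prems by auto
  have "scaled c1 M1 = scaled c3 M3"
    using 3 * nz Suc.prems by (intro unique_lift) auto
  moreover have "scaled c M = scaled c1 M1 * scaled c2 M2"
    by (simp add: *(1) flip: *(2)) (simp add: scaled_def const_poly.hom_mult algebra_simps)
  ultimately have "scaled c M = scaled c3 M3 ^ Suc (Suc m) * Q" using 3(3) by (simp add: mult.assoc)
  then show ?case using 3 by blast
qed

end

text \<open>A projection onto its ring of fixed elements that is linear over this ring. In this form
  the property passes to polynomials coefficientwise, and twice so for plane curves.\<close>

definition linear_proj :: "('a::comm_ring_1 \<Rightarrow> 'a) \<Rightarrow> bool" where
  "linear_proj \<Phi> \<longleftrightarrow> \<Phi> 1 = 1 \<and> (\<forall>a b. \<Phi> (a + b) = \<Phi> a + \<Phi> b) \<and> (\<forall>a. \<Phi> (\<Phi> a) = \<Phi> a) \<and>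
     (\<forall>r a. \<Phi> r = r \<longrightarrow> \<Phi> (r * a) = r * \<Phi> a)"

lemma linear_proj_0: "linear_proj \<Phi> \<Longrightarrow> \<Phi> 0 = 0"
  unfolding linear_proj_def by (metis add_cancel_right_right add_0)

lemma linear_proj_map_poly:
  assumes "linear_proj \<Phi>" shows "linear_proj (map_poly \<Phi>)"
proof -
  note 0 = linear_proj_0[OF assms]
  have \<Phi>: "\<Phi> 1 = 1" "\<Phi> (a + b) = \<Phi> a + \<Phi> b" "\<Phi> (\<Phi> a) = \<Phi> a" "\<Phi> r = r \<Longrightarrow> \<Phi> (r * a) = r * \<Phi> a" for a b r
    using assms by (auto simp: linear_proj_def)
  have sum: "\<Phi> (sum f A) = (\<Sum>i\<in>A. \<Phi> (f i))" for f and A :: "nat set"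
    by (induction A rule: infinite_finite_induct) (auto simp: 0 \<Phi>)
  show ?thesis unfolding linear_proj_def
  proof (intro conjI allI impI)
    show "map_poly \<Phi> 1 = 1" by (intro poly_eqI) (simp add: coeff_map_poly 0 coeff_1 \<Phi>)
    fix a b r
    show "map_poly \<Phi> (a + b) = map_poly \<Phi> a + map_poly \<Phi> b" by (intro poly_eqI) (simp add: coeff_map_poly 0 \<Phi>)
    show "map_poly \<Phi> (map_poly \<Phi> a) = map_poly \<Phi> a" by (intro poly_eqI) (simp add: coeff_map_poly 0 \<Phi>)
    assume r: "map_poly \<Phi> r = r"
    have "\<Phi> (coeff r i) = coeff r i" for i by (metis r coeff_map_poly 0)
    then show "map_poly \<Phi> (r * a) = r * map_poly \<Phi> a"
      by (intro poly_eqI) (simp add: coeff_map_poly 0 coeff_mult sum \<Phi>)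
  qed
qed

lemma line_map:
  "h 0 = 0 \<Longrightarrow> k 0 = 0 \<Longrightarrow> line h a b (Poly_Mapping.map k H) = line (\<lambda>c. h (k c)) a b H"
  unfolding line_def by (subst mpoly_eval_map) auto

lemma slice_map:
  "h 0 = 0 \<Longrightarrow> k 0 = 0 \<Longrightarrow> slice n h T (Poly_Mapping.map k H) = slice n (\<lambda>c. h (k c)) T H"
  unfolding slice_def plane_def by (subst line_map) auto

lemma space_map:
  "h 0 = 0 \<Longrightarrow> k 0 = 0 \<Longrightarrow> space n h T t (Poly_Mapping.map k H) = space n (\<lambda>c. h (k c)) T t H"
  unfolding space_def by (subst line_map) auto

lemma map_poly_space:
  assumes "comm_ring_hom k"
  shows "map_poly (map_poly (map_poly k)) (space n h T t H) = space n (\<lambda>c. k (h c)) (\<lambda>i. k (T i)) (\<lambda>i. k (t i)) H"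
  unfolding space_def map_poly_line[OF map_poly_hom[OF map_poly_hom[OF assms]]]
  by (simp add: map_poly_const map_poly_linear comm_ring_hom_zero[OF assms])

lemma at0_poly_space:
  "at0 (poly (space n h T t G) 1) = mpoly_eval h (\<lambda>i. T i + t i) G"
  unfolding space_def poly_line hom_mpoly_eval[OF poly_eval_hom] by simp

context rational_projection
begin

definition proj :: "complex \<Rightarrow> complex" where "proj z = of_rat (\<phi> z)"

lemma linear_proj_proj: "linear_proj proj"
  unfolding linear_proj_def
proof (intro conjI allI impI)
  show "proj (r * a) = r * proj a" if "proj r = r" for r a
    using that scale[of "\<phi> r" a] by (simp add: proj_def of_rat_mult)
qed (simp_all add: proj_def one add of_rat_add)

text \<open>For rational \<open>x\<close> the factor is expanded in the direction t = x - P, so that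
  its value at \<open>x\<close> appears at z = 1. The coefficient at z^0 is rational by hypothesis,
  and \<open>hensel_fixed\<close> extends this to all powers of z. Rational values at all rational
  points give rational coefficients.\<close>

lemma rational_lift:
  fixes F0 :: "rat mpoly" and \<tau> :: "nat \<Rightarrow> rat"
  defines "T \<equiv> \<lambda>i. of_rat (\<tau> i)"
  assumes F: "Poly_Mapping.map of_rat F0 = G ^ Suc m * Q" and G: "G \<in> polys n" "homogeneous e G"
    and g: "slice n id T G = map_poly (map_poly of_rat) g" "degree (slice n id T G) = e" "slice n id T G \<noteq> 0"
    and q: "slice n id T Q = map_poly (map_poly of_rat) q"
    and cop: "\<And>A. slice n id T G dvd slice n id T Q * A \<Longrightarrow> slice n id T G dvd A"
  shows "G = Poly_Mapping.map of_rat (Poly_Mapping.map \<phi> G)"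
proof (rule rational_values_imp_rational)
  fix x :: "nat \<Rightarrow> rat"
  define \<Phi> where "\<Phi> = map_poly (map_poly proj)"
  have lp: "linear_proj \<Phi>" unfolding \<Phi>_def by (intro linear_proj_map_poly linear_proj_proj)
  note \<Phi>0 = linear_proj_0[OF lp]
  have proj0: "proj 0 = 0" using linear_proj_0[OF linear_proj_proj] .
  have \<Phi>_rat: "\<Phi> (map_poly (map_poly of_rat) p) = map_poly (map_poly of_rat) p" for p
    by (intro poly_eqI) (simp add: \<Phi>_def coeff_map_poly proj0, simp add: proj_def)
  define t where "t i = (of_rat (x i - \<tau> i) :: complex)" for i
  let ?s = "space n id T t"
  interpret s: comm_ring_hom ?s by (rule space_hom[OF id_comm_ring_hom(1)])
  have fixed: "\<Phi> (coeff (?s G) j) = coeff (?s G) j" for j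
  proof -
    have "\<Phi> (coeff (?s G) j) = coeff (?s G) j \<and> \<Phi> (coeff (?s Q) j) = coeff (?s Q) j"
    proof (rule hensel_fixed[where m = m and F = "?s (Poly_Mapping.map of_rat F0)"])
      show "?s (Poly_Mapping.map of_rat F0) = ?s G ^ Suc m * ?s Q"
        unfolding F by (simp only: s.hom_mult s.hom_power)
      show "\<Phi> (coeff (?s (Poly_Mapping.map of_rat F0)) i) = coeff (?s (Poly_Mapping.map of_rat F0)) i" for i
      proof -
        have "?s (Poly_Mapping.map of_rat F0) =
            map_poly (map_poly (map_poly of_rat)) (space n id \<tau> (\<lambda>i. x i - \<tau> i) F0)"
          unfolding map_poly_space[OF of_rat_hom] by (subst space_map) (auto simp: T_def t_def[abs_def])
        then show ?thesis by (simp add: coeff_map_poly \<Phi>_rat)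
      qed
      show "\<Phi> (coeff (?s G) 0) = coeff (?s G) 0" "\<Phi> (coeff (?s Q) 0) = coeff (?s Q) 0" "coeff (?s G) 0 \<noteq> 0"
        unfolding coeff_0_space using g(3) by (simp_all add: g(1) q \<Phi>_rat)
      fix j B
      \<comment> \<open>The defect of rationality at z^j. The slice of \<open>G\<close>, of degree
        \<open>e\<close> in x, divides a positive multiple of \<open>A\<close>, whose degree is
        below \<open>e\<close>; so \<open>A = 0\<close>.\<close>
      define A where "A = coeff (?s G) j - \<Phi> (coeff (?s G) j)"
      assume j: "j > 0" and "of_nat (Suc m) * coeff (?s Q) 0 * (coeff (?s G) j - \<Phi> (coeff (?s G) j)) + coeff (?s G) 0 * B = 0"
      then have "slice n id T Q * (of_nat (Suc m) * A) = slice n id T G * (- B)"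
        unfolding coeff_0_space A_def[symmetric] by (simp add: algebra_simps add_eq_0_iff del: of_nat_Suc)
      then have "slice n id T G dvd slice n id T Q * (of_nat (Suc m) * A)" by (metis dvd_triv_left)
      then have dvd: "slice n id T G dvd of_nat (Suc m) * A" by (rule cop)
      show "coeff (?s G) j - \<Phi> (coeff (?s G) j) = 0"
      proof (rule ccontr)
        assume "\<not> ?thesis"
        then have A: "A \<noteq> 0" by (simp add: A_def)
        then have "coeff (?s G) j \<noteq> 0" using \<Phi>0 by (auto simp: A_def)
        then have "degree (coeff (?s G) j) < e" using degree_coeff_space[OF G, of id T t j] j by linarith
        moreover have "degree (\<Phi> (coeff (?s G) j)) \<le> degree (coeff (?s G) j)"
          unfolding \<Phi>_def by (rule degree_map_poly_le)
        ultimately have "degree A < e" unfolding A_def by (intro degree_diff_less) auto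
        moreover have "degree (of_nat (Suc m) * A) \<le> degree A"
          using degree_mult_le[of "of_nat (Suc m)" A] by (simp add: of_nat_poly del: of_nat_Suc)
        moreover have "of_nat (Suc m) * A \<noteq> 0" using A by (simp del: of_nat_Suc)
        ultimately show False using dvd_imp_degree_le[OF dvd] g(2) by linarith
      qed
    qed (use lp in \<open>auto simp: linear_proj_def\<close>)
    then show ?thesis ..
  qed
  have "\<Phi> (poly (?s G) 1) = poly (?s G) 1"
  proof -
    have "\<Phi> (sum f I) = (\<Sum>i\<in>I. \<Phi> (f i))" for f and I :: "nat set"
      by (induction I rule: infinite_finite_induct) (use lp \<Phi>0 in \<open>auto simp: linear_proj_def\<close>)
    then show ?thesis by (simp add: poly_altdef fixed)
  qed
  then have "coeff (coeff (\<Phi> (poly (?s G) 1)) 0) 0 = coeff (coeff (poly (?s G) 1) 0) 0" by simp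
  then have "proj (at0 (poly (?s G) 1)) = at0 (poly (?s G) 1)"
    by (simp add: \<Phi>_def coeff_map_poly proj0 poly_0_coeff_0)
  moreover have "at0 (poly (?s G) 1) = mpoly_eval id (\<lambda>i. of_rat (x i)) G"
    unfolding at0_poly_space by (simp add: T_def t_def of_rat_diff)
  ultimately show "of_rat (\<phi> (mpoly_eval id (\<lambda>i. of_rat (x i)) G)) = mpoly_eval id (\<lambda>i. of_rat (x i)) G"
    by (simp add: proj_def)
qed

end

lemma total_degree_map_of_rat: "total_degree (Poly_Mapping.map of_rat p :: complex mpoly) = total_degree p"
proof -
  have "Poly_Mapping.keys (Poly_Mapping.map of_rat p :: complex mpoly) = Poly_Mapping.keys p"
    by (auto simp: in_keys_iff lookup_map_0)
  then show ?thesis by (simp add: total_degree_def)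
qed

lemma map_of_rat_eq_iff: "Poly_Mapping.map of_rat p = (Poly_Mapping.map of_rat q :: complex mpoly) \<longleftrightarrow> p = q"
proof
  assume *: "Poly_Mapping.map of_rat p = (Poly_Mapping.map of_rat q :: complex mpoly)"
  show "p = q"
  proof (rule poly_mapping_eqI)
    fix m show "Poly_Mapping.lookup p m = Poly_Mapping.lookup q m"
      using arg_cong[OF *, of "\<lambda>p. Poly_Mapping.lookup p m"] by (simp add: lookup_map_0)
  qed
qed simp

text \<open>A prime factor \<open>g\<close> over Q is split off with its full multiplicity, which
  makes it coprime to the cofactor \<open>q\<close> as the Hensel argument requires. Its lift
  \<open>G\<close> turns out rational and divides \<open>F0\<close>, with total degree equal to the
  x-degree of \<open>g\<close>.\<close>

theorem slice_no_small_factor: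
  fixes F0 :: "rat mpoly" and \<tau> :: "nat \<Rightarrow> rat"
  assumes F0: "F0 \<in> polys n" "homogeneous d F0" "r_irreducible n r F0"
    and M: "Poly_Mapping.map of_rat F0 = const_poly c * prod_mset M" "c \<noteq> 0"
    and good: "good_slice n (\<lambda>i. of_rat (\<tau> i)) (set_mset M)"
    and u: "mpoly_eval id (\<lambda>i. \<tau> (n + i)) F0 \<noteq> 0"
    and ab: "slice n id \<tau> F0 = a * b" "1 \<le> degree a" "degree a \<le> r"
  shows False
proof -
  obtain \<phi> where "rational_projection \<phi>"
    using rational_functional by (auto simp: rational_projection_def)
  then interpret rational_projection \<phi> .
  define T where "T i = (of_rat (\<tau> i) :: complex)" for i
  interpret good_slice n T "set_mset M" using good unfolding T_def .
  define C where "C = (map_poly (map_poly of_rat) :: rat poly poly \<Rightarrow> complex poly poly)"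
  interpret C: comm_ring_hom C unfolding C_def by (intro map_poly_hom of_rat_hom)
  have coeff_C: "coeff (coeff (C p) i) j = of_rat (coeff (coeff p i) j)" for p i j
    by (simp add: C_def coeff_map_poly)
  have C_eq_0: "p = 0" if "C p = 0" for p
  proof (intro poly_eqI)
    fix i j show "coeff (coeff p i) j = coeff (coeff 0 i) j" using coeff_C[of p i j] that by simp
  qed
  define F where "F = (Poly_Mapping.map of_rat F0 :: complex mpoly)"
  have slF: "sl F = C (slice n id \<tau> F0)"
    unfolding F_def C_def sl_def map_poly_slice[OF of_rat_hom] by (subst slice_map) (auto simp: T_def[abs_def])
  have FM: "F = scaled c M" using M(1) by (simp add: F_def scaled_def)
  have xm: "x_monic d (slice n id \<tau> F0)"
    using slice_x_monic[OF F0(1,2) id_comm_ring_hom(1) u] .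
  have Fnz: "slice n id \<tau> F0 \<noteq> 0" using xm by (auto simp: x_monic_def)
  have "\<not> a dvd 1"
  proof
    assume "a dvd 1"
    then have "degree a \<le> degree (1 :: rat poly poly)" by (intro dvd_imp_degree_le) auto
    then show False using ab by simp
  qed
  moreover have "a \<noteq> 0" using ab Fnz by auto
  ultimately obtain g where g: "g dvd a" "prime g" using prime_divisor_exists by blast
  have gp: "prime_elem g" using g by simp
  have "g dvd slice n id \<tau> F0" using g ab by simp
  then obtain g' where "slice n id \<tau> F0 = g * g'" by (rule dvdE)
  then obtain k l where k: "x_monic k g" "k + l = d" using x_monic_factors xm by metis
  have k1: "k \<ge> 1"
  proof (rule ccontr)
    assume "\<not> k \<ge> 1"
    then have "k = 0" by simp
    then have "g dvd 1" using x_monic_0_unit[of g] k by blast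
    then show False using gp by (simp add: prime_elem_def)
  qed
  have kr: "k \<le> r" using dvd_imp_degree_le[OF g(1) \<open>a \<noteq> 0\<close>] k ab by (simp add: x_monic_def)
  define m where "m = multiplicity g (slice n id \<tau> F0)"
  obtain q where q: "slice n id \<tau> F0 = g ^ m * q" "\<not> g dvd q"
    using multiplicity_decompose'[of "slice n id \<tau> F0" g] Fnz gp unfolding m_def prime_elem_def by metis
  have "m \<noteq> 0" using q \<open>g dvd slice n id \<tau> F0\<close> by (metis mult_1 power_0)
  then obtain m' where m': "m = Suc m'" using not0_implies_Suc by blast
  have "sl (scaled c M) = C g ^ Suc m' * C q"
    using slF by (simp only: FM q(1) m' C.hom_mult C.hom_power)
  from lift_power[OF M(2) subset_refl this] obtain M1 c1 Q where
    G: "c1 \<noteq> 0" "scaled c M = scaled c1 M1 ^ Suc m' * Q" "sl (scaled c1 M1) = C g" "sl Q = C q" by blast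
  define G where "G = scaled c1 M1"
  have FG: "F = G ^ Suc m' * Q" using G(2) by (simp add: FM G_def)
  have Fp: "F \<in> polys n" "homogeneous d F" unfolding F_def using F0 by (auto intro: map_in_polys map_homogeneous)
  have "F \<noteq> 0" using slF C_eq_0 Fnz by auto
  have FG': "F = G * (G ^ m' * Q)" using FG by (simp add: mult.assoc)
  define e where "e = total_degree G"
  have Gp: "G \<in> polys n" "homogeneous e G"
    using polys_dvd_closed[of G "G ^ m' * Q" n] homogeneous_factor[of d G "G ^ m' * Q"] Fp \<open>F \<noteq> 0\<close>
    unfolding FG'[symmetric] e_def by auto
  have Gu: "mpoly_eval id (\<lambda>i. T (n + i)) G \<noteq> 0"
  proof
    assume *: "mpoly_eval id (\<lambda>i. T (n + i)) G = 0"
    interpret E: comm_ring_hom "mpoly_eval id (\<lambda>i. T (n + i)) :: complex mpoly \<Rightarrow> complex"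
      by (rule mpoly_eval_hom[OF id_comm_ring_hom(1)])
    have "mpoly_eval id (\<lambda>i. T (n + i)) F = 0" unfolding FG' E.hom_mult * by simp
    moreover have "mpoly_eval id (\<lambda>i. T (n + i)) F = of_rat (mpoly_eval id (\<lambda>i. \<tau> (n + i)) F0)"
      unfolding F_def mpoly_of_rat_eval T_def hom_mpoly_eval[OF of_rat_hom] by simp
    ultimately show False using u by simp
  qed
  then have xG: "x_monic e (sl G)" unfolding sl_def using slice_x_monic[OF Gp id_comm_ring_hom(1)] by blast
  have "degree (C g) = k"
  proof -
    have "degree (C g) = degree g" unfolding C_def
    proof (rule degree_map_poly)
      have "g \<noteq> 0" using gp by auto
      then obtain i where i: "coeff (lead_coeff g) i \<noteq> 0" by (metis leading_coeff_0_iff)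
      have "coeff (map_poly of_rat (lead_coeff g)) i = (of_rat (coeff (lead_coeff g) i) :: complex)"
        by (simp add: coeff_map_poly)
      then have "map_poly of_rat (lead_coeff g) \<noteq> (0 :: complex poly)" using i
        by (metis coeff_0 of_rat_eq_0_iff)
      then show "map_poly of_rat (lead_coeff g) = (0 :: complex poly) \<longleftrightarrow> g = 0" using \<open>g \<noteq> 0\<close> by simp
    qed
    then show ?thesis using k by (simp add: x_monic_def)
  qed
  \<comment> \<open>No degree is lost on the plane, since \<open>G\<close>, as a factor of
    \<open>F\<close>, does not vanish at the direction u.\<close>
  then have ek: "e = k" using xG G(3) by (simp add: x_monic_def G_def)
  \<comment> \<open>Coprimality over Q survives over C through Bezout: a common factor divides a
    nonzero polynomial in y alone, so it has degree 0 in x, and being x-monic it is a unit.\<close>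
  have cop: "sl G dvd A" if "sl G dvd sl Q * A" for A
  proof -
    obtain \<alpha> \<beta> \<rho> where \<rho>: "\<rho> \<noteq> 0" "\<alpha> * g + \<beta> * q = [:\<rho>:]"
      using prime_elem_poly_bezout[OF gp _ q(2)] k k1 by (auto simp: x_monic_def)
    have "coprime (sl G) (sl Q)"
    proof (rule coprimeI)
      fix p assume p: "p dvd sl G" "p dvd sl Q"
      then obtain p' where "sl G = p * p'" by (auto elim: dvdE)
      then obtain j where j: "x_monic j p" using x_monic_factors xG by metis
      have "p dvd C \<alpha> * C g + C \<beta> * C q"
        using p unfolding G_def G(3,4) by (intro dvd_add dvd_mult)
      then have "p dvd C [:\<rho>:]" unfolding \<rho>(2)[symmetric] by (simp only: C.hom_add C.hom_mult)
      moreover have "C [:\<rho>:] \<noteq> 0" using C_eq_0[of "[:\<rho>:]"] \<rho>(1) by auto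
      moreover have "degree (C [:\<rho>:]) = 0" by (simp add: C_def map_poly_const)
      ultimately have "degree p = 0" using dvd_imp_degree_le[of p "C [:\<rho>:]"] by simp
      then have "x_monic 0 p" using j by (auto simp: x_monic_def)
      then show "p dvd 1" by (rule x_monic_0_unit)
    qed
    then show ?thesis using that by (simp add: coprime_dvd_mult_right_iff)
  qed
  define G0 where "G0 = Poly_Mapping.map \<phi> G"
  have GG0: "G = Poly_Mapping.map of_rat G0"
    unfolding G0_def
  proof (rule rational_lift[where \<tau> = \<tau> and n = n and e = e and g = g and q = q])
    show "Poly_Mapping.map of_rat F0 = G ^ Suc m' * Q" using FG unfolding F_def .
    show "slice n id (\<lambda>i. of_rat (\<tau> i)) G = map_poly (map_poly of_rat) g"
      using G(3) unfolding sl_def unfolding T_def[abs_def] G_def C_def .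
    show "slice n id (\<lambda>i. of_rat (\<tau> i)) Q = map_poly (map_poly of_rat) q"
      using G(4) unfolding sl_def unfolding T_def[abs_def] C_def .
    show "degree (slice n id (\<lambda>i. of_rat (\<tau> i)) G) = e" "slice n id (\<lambda>i. of_rat (\<tau> i)) G \<noteq> 0"
      using xG unfolding sl_def unfolding T_def[abs_def] by (auto simp: x_monic_def)
    show "slice n id (\<lambda>i. of_rat (\<tau> i)) G dvd A"
      if "slice n id (\<lambda>i. of_rat (\<tau> i)) G dvd slice n id (\<lambda>i. of_rat (\<tau> i)) Q * A" for A
      using cop[of A] that unfolding sl_def unfolding T_def[abs_def] .
  qed (fact Gp)+
  \<comment> \<open>Applying \<open>\<phi>\<close> to the factorization of \<open>F\<close> with the
    rational factor \<open>G\<close> produces a rational cofactor.\<close>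
  have "F0 = Poly_Mapping.map \<phi> (Poly_Mapping.map of_rat F0)"
    by (intro poly_mapping_eqI) (simp add: lookup_map_0)
  also have "Poly_Mapping.map of_rat F0 = Poly_Mapping.map of_rat G0 * (G ^ m' * Q)"
    using FG' GG0 by (simp add: F_def)
  finally have F0G0: "F0 = G0 * Poly_Mapping.map \<phi> (G ^ m' * Q)" by (simp only: map_mult)
  have "F0 \<noteq> 0" using u by auto
  then have "G0 \<in> polys n" "Poly_Mapping.map \<phi> (G ^ m' * Q) \<in> polys n"
    using polys_dvd_closed F0(1) F0G0 by (metis, metis mult.commute)
  moreover have "total_degree G0 = k"
    using ek e_def GG0 total_degree_map_of_rat by metis
  ultimately show False using F0(3) F0G0 k1 kr unfolding r_irreducible_def by blast
qed

subsection \<open>The hypersurface\<close>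

lemma mpoly_factorization:
  fixes p :: "'a::field mpoly"
  assumes "p \<noteq> 0"
  shows "\<exists>c M. c \<noteq> 0 \<and> p = const_poly c * prod_mset M \<and> (\<forall>H \<in># M. irreducible H)"
  using assms
proof (induction "total_degree p" arbitrary: p rule: less_induct)
  case less
  show ?case
  proof (cases "p dvd 1")
    case True
    then obtain c where "p = const_poly c" using mpoly_unit_iff total_degree_0_const by blast
    then show ?thesis using less.prems by (intro exI[of _ c] exI[of _ "{#}"]) auto
  next
    case False
    then obtain \<pi> p' where \<pi>: "irreducible \<pi>" "p = \<pi> * p'"
      using mpoly_irreducible_divisor[of p] less.prems by (metis dvdE)
    then have nz: "\<pi> \<noteq> 0" "p' \<noteq> 0" using less.prems by auto
    have "total_degree \<pi> \<noteq> 0" using \<pi>(1) nz by (auto simp: irreducible_def mpoly_unit_iff)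
    then have "total_degree p' < total_degree p" using total_degree_mult[OF nz] \<pi>(2) by simp
    from less.hyps[OF this nz(2)] obtain c M where
      "c \<noteq> 0" "p' = const_poly c * prod_mset M" "\<forall>H \<in># M. irreducible H" by blast
    then show ?thesis using \<pi>
      by (intro exI[of _ c] exI[of _ "add_mset \<pi> M"]) (auto simp: mult.left_commute)
  qed
qed

lemma total_degree_prod_mset:
  fixes M :: "'a::idom mpoly multiset"
  assumes "\<And>H. H \<in># M \<Longrightarrow> H \<noteq> 0"
  shows "total_degree (prod_mset M) = (\<Sum>H\<in>#M. total_degree H)"
  using assms
proof (induction M)
  case empty
  then show ?case using total_degree_const[of "1::'a"] by (simp del: total_degree_const)
next
  case (add H M)
  moreover have "prod_mset M \<noteq> 0" using add.prems by (auto simp: prod_mset_zero_iff)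
  ultimately show ?case by (simp add: total_degree_mult)
qed

lemma sum_set_mset_le: "sum f (set_mset M) \<le> (\<Sum>x\<in>#M. f x)" for f :: "'a \<Rightarrow> nat"
  by (induction M) (auto simp: sum.insert_if)

text \<open>Superadditivity of the cube: treating the irreducible factors separately costs no more
  than one irreducible polynomial of the full degree.\<close>

lemma sum_cubes_le: "(\<Sum>a\<in>A. k a ^ 3) \<le> (\<Sum>a\<in>A. k a) ^ 3" for k :: "'a \<Rightarrow> nat"
proof (induction A rule: infinite_finite_induct)
  case (insert a A)
  have "x ^ 3 + y ^ 3 \<le> (x + y) ^ 3" for x y :: nat by (simp add: power3_eq_cube algebra_simps)
  then show ?case using insert by (simp add: order.trans[OF add_left_mono])
qed auto

text \<open>Genericity with a degree budget: a conjunction multiplies the equations, so the bounds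
  \<open>k\<close> add up.\<close>

definition generic_cond :: "nat \<Rightarrow> nat \<Rightarrow> ((nat \<Rightarrow> complex) \<Rightarrow> bool) \<Rightarrow> bool" where
  "generic_cond m k G \<longleftrightarrow> (\<exists>W D. W \<in> polys m \<and> W \<noteq> 0 \<and> homogeneous D W \<and> D \<le> k \<and>
     (\<forall>T. mpoly_eval id T W \<noteq> 0 \<longrightarrow> G T))"

lemma generic_cond_mono: "generic_cond m k G \<Longrightarrow> k \<le> l \<Longrightarrow> (\<And>T. G T \<Longrightarrow> G' T) \<Longrightarrow> generic_cond m l G'"
  unfolding generic_cond_def by (meson order.trans)

lemma generic_cond_True: "generic_cond m 0 (\<lambda>_. True)"
  unfolding generic_cond_def by (intro exI[of _ 1] exI[of _ 0]) auto

lemma generic_cond_conj: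
  assumes "generic_cond m k G" "generic_cond m l G'"
  shows "generic_cond m (k + l) (\<lambda>T. G T \<and> G' T)"
proof -
  obtain W D W' D' where W: "W \<in> polys m" "W \<noteq> 0" "homogeneous D W" "D \<le> k" "\<forall>T. mpoly_eval id T W \<noteq> 0 \<longrightarrow> G T"
    and W': "W' \<in> polys m" "W' \<noteq> 0" "homogeneous D' W'" "D' \<le> l" "\<forall>T. mpoly_eval id T W' \<noteq> 0 \<longrightarrow> G' T"
    using assms unfolding generic_cond_def by blast
  have ev: "mpoly_eval id T (W * W') = mpoly_eval id T W * mpoly_eval id T W'" for T
    by (rule mpoly_eval_mult) auto
  show ?thesis unfolding generic_cond_def
  proof (intro exI conjI allI impI)
    show "W * W' \<in> polys m" "W * W' \<noteq> 0" "homogeneous (D + D') (W * W')" "D + D' \<le> k + l"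
      using W W' by (auto intro: homogeneous_mult)
    fix T assume "mpoly_eval id T (W * W') \<noteq> 0"
    then have "mpoly_eval id T W \<noteq> 0" "mpoly_eval id T W' \<noteq> 0" unfolding ev by auto
    then show "G T" "G' T" using W W' by blast+
  qed
qed

lemma generic_cond_Ball:
  assumes "finite A" "\<And>a. a \<in> A \<Longrightarrow> generic_cond m (k a) (G a)"
  shows "generic_cond m (\<Sum>a\<in>A. k a) (\<lambda>T. \<forall>a\<in>A. G a T)"
  using assms
proof (induction A)
  case empty
  then show ?case using generic_cond_True by simp
next
  case (insert a A)
  then have "generic_cond m (k a + (\<Sum>a\<in>A. k a)) (\<lambda>T. G a T \<and> (\<forall>a\<in>A. G a T))"
    by (intro generic_cond_conj) auto
  then show ?case using insert by simp
qed

lemma eval_substitute: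
  "mpoly_eval id T (mpoly_eval const_poly L H) = mpoly_eval id (\<lambda>i. mpoly_eval id T (L i)) (H :: 'a::comm_ring_1 mpoly)"
  using hom_mpoly_eval[OF mpoly_eval_hom[OF id_comm_ring_hom(1)], of T const_poly L H] by (simp add: id_def)

lemma substitute_homogeneous:
  fixes H :: "'a::comm_ring_1 mpoly"
  assumes "H \<in> polys n" "homogeneous d H" "\<And>i. i < n \<Longrightarrow> L i \<in> polys m" "\<And>i. i < n \<Longrightarrow> homogeneous 1 (L i)"
  shows "mpoly_eval const_poly L H \<in> polys m" "homogeneous d (mpoly_eval const_poly L H)"
proof -
  show "mpoly_eval const_poly L H \<in> polys m"
    by (rule mpoly_eval_closed[OF assms(1)]) (use assms(3) in auto)
  show "homogeneous d (mpoly_eval const_poly L H)"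
    by (rule mpoly_eval_graded[OF assms(1,2)]) (use assms(4) in \<open>auto intro: homogeneous_add homogeneous_mult\<close>)
qed

lemma generic_nonvanishing:
  fixes F :: "complex mpoly"
  assumes "F \<in> polys n" "homogeneous d F" "F \<noteq> 0"
  shows "generic_cond (3 * n) d (\<lambda>T. mpoly_eval id (\<lambda>i. T (n + i)) F \<noteq> 0)"
  unfolding generic_cond_def
proof (intro exI[of _ "mpoly_eval const_poly (\<lambda>i. var_poly (n + i)) F"] exI[of _ d] conjI allI impI)
  let ?W = "mpoly_eval const_poly (\<lambda>i. var_poly (n + i)) F"
  show "?W \<in> polys (3 * n)"
    by (rule substitute_homogeneous(1)[OF assms(1,2)]; (rule homogeneous_var | rule var_in_polys, simp))
  show "homogeneous d ?W"
    by (rule substitute_homogeneous(2)[OF assms(1,2), where m = "3 * n"];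
        (rule homogeneous_var | rule var_in_polys, simp))
  have ev: "mpoly_eval id T ?W = mpoly_eval id (\<lambda>i. T (n + i)) F" for T
    unfolding eval_substitute by (simp add: mpoly_eval_var)
  obtain u where "mpoly_eval id u F \<noteq> 0" using mpoly_nonvanishing assms by blast
  then have "mpoly_eval id (\<lambda>i. u (i - n)) ?W \<noteq> 0" unfolding ev by simp
  then show "?W \<noteq> 0" by auto
  show "mpoly_eval id (\<lambda>i. T (n + i)) F \<noteq> 0" if "mpoly_eval id T ?W \<noteq> 0" for T
    using that unfolding ev .
qed simp

text \<open>A 2 by 2 determinant comparing the forms at P and P + u, the points (0, 0) and (1, 0) of
  the plane. Proportional slices would make it vanish.\<close>

definition two_point :: "nat \<Rightarrow> (nat \<Rightarrow> complex) \<Rightarrow> complex mpoly \<Rightarrow> complex mpoly \<Rightarrow> bool" where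
  "two_point n T H H' \<longleftrightarrow> mpoly_eval id T H * mpoly_eval id (\<lambda>i. T i + T (n + i)) H' \<noteq>
     mpoly_eval id (\<lambda>i. T i + T (n + i)) H * mpoly_eval id T H'"

lemma generic_two_point:
  fixes H H' :: "complex mpoly"
  assumes H: "H \<in> polys n" "homogeneous d H" "H \<noteq> 0" and H': "H' \<in> polys n" "homogeneous d' H'" "H' \<noteq> 0"
    and np: "\<not> (\<exists>\<kappa>. \<kappa> \<noteq> 0 \<and> H' = const_poly \<kappa> * H)"
  shows "generic_cond (3 * n) (d + d') (\<lambda>T. two_point n T H H')"
proof -
  define p where "p A = mpoly_eval const_poly var_poly A" for A :: "complex mpoly"
  define q where "q A = mpoly_eval const_poly (\<lambda>i. var_poly i + var_poly (n + i)) A" for A :: "complex mpoly"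
  have p: "p A \<in> polys (3 * n) \<and> homogeneous e (p A)" if "A \<in> polys n" "homogeneous e A" for A e
    unfolding p_def
    by (intro conjI substitute_homogeneous[OF that, where m = "3 * n"];
        (rule homogeneous_var | rule var_in_polys, simp))
  have q: "q A \<in> polys (3 * n) \<and> homogeneous e (q A)" if "A \<in> polys n" "homogeneous e A" for A e
    unfolding q_def
    by (intro conjI substitute_homogeneous[OF that, where m = "3 * n"];
        (rule homogeneous_add[OF homogeneous_var homogeneous_var] | rule add_in_polys; rule var_in_polys; simp))
  define W where "W = p H * q H' - q H * p H'"
  have E: "comm_ring_hom (mpoly_eval id T :: complex mpoly \<Rightarrow> complex)" for T
    by (rule mpoly_eval_hom[OF id_comm_ring_hom(1)])
  have ev: "mpoly_eval id T W = mpoly_eval id T H * mpoly_eval id (\<lambda>i. T i + T (n + i)) H' -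
      mpoly_eval id (\<lambda>i. T i + T (n + i)) H * mpoly_eval id T H'" for T
  proof -
    interpret comm_ring_hom "mpoly_eval id T :: complex mpoly \<Rightarrow> complex" by (rule E)
    show ?thesis unfolding W_def hom_minus hom_mult p_def q_def eval_substitute hom_add
      by (simp add: mpoly_eval_var)
  qed
  have "W \<noteq> 0"
  proof
    assume "W = 0"
    then have 0: "mpoly_eval id T W = 0" for T by simp
    have sym: "mpoly_eval id a H * mpoly_eval id b H' = mpoly_eval id b H * mpoly_eval id a H'" for a b
    proof -
      \<comment> \<open>Any two points \<open>a\<close> and \<open>b\<close> occur as P and P + u.
        If the determinant vanished for all of them, the ratio of \<open>H'\<close> to
        \<open>H\<close> would be constant.\<close>
      define T where "T i = (if i < n then a i else b (i - n) - a (i - n))" for i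
      have "mpoly_eval id T A = mpoly_eval id a A" "mpoly_eval id (\<lambda>i. T i + T (n + i)) A = mpoly_eval id b A"
        if "A \<in> polys n" for A :: "complex mpoly"
        using that by (auto intro!: mpoly_eval_cong simp: T_def)
      then show ?thesis using 0[of T] H H' unfolding ev by simp
    qed
    obtain b where b: "mpoly_eval id b H \<noteq> 0" using mpoly_nonvanishing H by blast
    define \<kappa> where "\<kappa> = mpoly_eval id b H' / mpoly_eval id b H"
    have "H' - const_poly \<kappa> * H = 0"
    proof (rule ccontr)
      assume "H' - const_poly \<kappa> * H \<noteq> 0"
      moreover have "H' - const_poly \<kappa> * H \<in> polys n" using H H' by auto
      ultimately obtain a where a: "mpoly_eval id a (H' - const_poly \<kappa> * H) \<noteq> 0"
        using mpoly_nonvanishing by blast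
      interpret comm_ring_hom "mpoly_eval id a :: complex mpoly \<Rightarrow> complex" by (rule E)
      have "mpoly_eval id a (H' - const_poly \<kappa> * H) = mpoly_eval id a H' - \<kappa> * mpoly_eval id a H"
        by (simp only: hom_minus hom_mult) simp
      then show False using a sym[of a b] b by (simp add: \<kappa>_def field_simps)
    qed
    then have "H' = const_poly \<kappa> * H" by simp
    moreover from this have "\<kappa> \<noteq> 0" using H' by auto
    ultimately show False using np by blast
  qed
  moreover have "W \<in> polys (3 * n)" "homogeneous (d + d') W"
    unfolding W_def using p[OF H(1,2)] p[OF H'(1,2)] q[OF H(1,2)] q[OF H'(1,2)]
    by (auto intro!: homogeneous_diff homogeneous_mult)
  ultimately show ?thesis unfolding generic_cond_def two_point_def
    by (intro exI[of _ W] exI[of _ "d + d'"]) (auto simp: ev)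
qed

lemma two_point_not_dvd:
  fixes H H' :: "complex mpoly"
  assumes "irreducible (slice n id T H)" "irreducible (slice n id T H')" "two_point n T H H'"
  shows "\<not> slice n id T H dvd slice n id T H'"
proof
  assume "slice n id T H dvd slice n id T H'"
  then obtain w where w: "slice n id T H' = slice n id T H * w" by (rule dvdE)
  then have "w dvd 1" using assms(1,2) by (auto simp: irreducible_def)
  then obtain w' where "1 = w * w'" by (rule dvdE)
  then have "[:[:1:]:] = w * w'" by (simp add: one_pCons)
  then obtain \<kappa> where \<kappa>: "w = [:[:\<kappa>:]:]" using const_units by (metis zero_neq_one)
  have 0: "poly (poly (slice n id T A) 0) 0 = mpoly_eval id T A" for A :: "complex mpoly"
    unfolding slice_def at0_plane ..
  have 1: "poly (poly (slice n id T A) 1) 0 = mpoly_eval id (\<lambda>i. T i + T (n + i)) A" for A :: "complex mpoly"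
    unfolding slice_def plane_def poly_line hom_mpoly_eval[OF poly_eval_hom] by (simp add: id_def)
  have "mpoly_eval id T H' = mpoly_eval id T H * \<kappa>"
    unfolding 0[symmetric] w \<kappa> by simp
  moreover have "mpoly_eval id (\<lambda>i. T i + T (n + i)) H' = mpoly_eval id (\<lambda>i. T i + T (n + i)) H * \<kappa>"
    unfolding 1[symmetric] w \<kappa> by simp
  ultimately show False using assms(3) unfolding two_point_def by simp
qed

lemma generic_good_slice:
  fixes F :: "complex mpoly"
  assumes F: "F \<in> polys n" "homogeneous d F" "F \<noteq> 0"
  obtains c M where "F = const_poly c * prod_mset M" "c \<noteq> 0"
    "generic_cond (3 * n) (7 * d ^ 3) (\<lambda>T. good_slice n T (set_mset M) \<and> mpoly_eval id (\<lambda>i. T (n + i)) F \<noteq> 0)"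
proof -
  obtain c M where cM: "c \<noteq> 0" "F = const_poly c * prod_mset M" "\<forall>H \<in># M. irreducible H"
    using mpoly_factorization[OF F(3)] by blast
  define e where "e = (total_degree :: complex mpoly \<Rightarrow> nat)"
  let ?A = "set_mset M"
  have M: "H \<in> polys n" "homogeneous (e H) H" "irreducible H" "H \<noteq> 0" "e H > 0" "H dvd F" if "H \<in> ?A" for H
  proof -
    show irr: "irreducible H" using cM that by blast
    then show "H \<noteq> 0" by (auto simp: irreducible_def)
    show "H dvd F" using that cM(2) by (simp add: dvd_prod_mset)
    then obtain K where K: "F = H * K" by (rule dvdE)
    then show "H \<in> polys n" "homogeneous (e H) H"
      using F polys_dvd_closed[of H K n] homogeneous_factor[of d H K] by (auto simp: e_def)
    then show "e H > 0" using irreducible_imp_pos_degree irr by blast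
  qed
  have deg: "(\<Sum>H\<in>#M. e H) = d"
  proof -
    have "prod_mset M \<noteq> 0" using F cM by auto
    then have "total_degree F = (\<Sum>H\<in>#M. e H)"
      unfolding cM(2) e_def using cM(1) M(4) by (simp add: total_degree_mult total_degree_prod_mset)
    then show ?thesis using total_degree_homogeneous[OF F(2,3)] by simp
  qed
  have sum_e: "(\<Sum>H\<in>?A. e H) \<le> d" using sum_set_mset_le[of e M] deg by simp
  have cardA: "card ?A \<le> d"
  proof -
    have "card ?A = (\<Sum>H\<in>?A. 1)" by simp
    also have "\<dots> \<le> (\<Sum>H\<in>?A. e H)" using M(5) by (intro sum_mono) (simp add: Suc_leI)
    finally show ?thesis using sum_e by simp
  qed
  have e_le: "e H \<le> d" if "H \<in> ?A" for H
    using member_le_sum[of H ?A e] that sum_e by simp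
  \<comment> \<open>One condition for each distinct irreducible factor; the cubes of their degrees
    add up to at most \<open>d ^ 3\<close>.\<close>
  have 1: "generic_cond (3 * n) (4 * d ^ 3) (\<lambda>T. \<forall>H\<in>?A. box_injective (e H) (slice n id T H))"
  proof (rule generic_cond_mono[OF generic_cond_Ball])
    show "generic_cond (3 * n) (4 * e H ^ 3) (\<lambda>T. box_injective (e H) (slice n id T H))" if "H \<in> ?A" for H
      using box_injective_generic[OF M(1-3)[OF that]] unfolding generic_cond_def by metis
    have "(\<Sum>H\<in>?A. 4 * e H ^ 3) = 4 * (\<Sum>H\<in>?A. e H ^ 3)" by (simp add: sum_distrib_left)
    also have "\<dots> \<le> 4 * d ^ 3"
      using order.trans[OF sum_cubes_le[of e ?A] power_mono[OF sum_e, of 3]] by simp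
    finally show "(\<Sum>H\<in>?A. 4 * e H ^ 3) \<le> 4 * d ^ 3" .
  qed auto
  define G where "G p T \<longleftrightarrow> (\<exists>\<kappa>. \<kappa> \<noteq> 0 \<and> snd p = const_poly \<kappa> * fst p) \<or> two_point n T (fst p) (snd p)" for p T
  \<comment> \<open>There are at most \<open>d ^ 2\<close> ordered pairs of factors, each of cost at
    most \<open>2 * d\<close>; proportional pairs cost nothing.\<close>
  have 2: "generic_cond (3 * n) (2 * d ^ 3) (\<lambda>T. \<forall>p\<in>?A \<times> ?A. G p T)"
  proof (rule generic_cond_mono[OF generic_cond_Ball])
    show "generic_cond (3 * n) (2 * d) (G p)" if p: "p \<in> ?A \<times> ?A" for p
    proof (cases "\<exists>\<kappa>. \<kappa> \<noteq> 0 \<and> snd p = const_poly \<kappa> * fst p")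
      case True
      then show ?thesis by (intro generic_cond_mono[OF generic_cond_True]) (auto simp: G_def)
    next
      case False
      have A: "fst p \<in> ?A" "snd p \<in> ?A" using p by auto
      show ?thesis
        using generic_two_point[OF M(1,2,4)[OF A(1)] M(1,2,4)[OF A(2)] False]
        by (rule generic_cond_mono) (use e_le[OF A(1)] e_le[OF A(2)] in \<open>auto simp: G_def\<close>)
    qed
    have "(\<Sum>p\<in>?A \<times> ?A. 2 * d) = card ?A * card ?A * (2 * d)" by (simp add: card_cartesian_product)
    also have "\<dots> \<le> d * d * (2 * d)" using cardA by (intro mult_mono) auto
    also have "\<dots> = 2 * d ^ 3" by (simp add: power3_eq_cube)
    finally show "(\<Sum>p\<in>?A \<times> ?A. 2 * d) \<le> 2 * d ^ 3" .
  qed auto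
  have "d \<le> d ^ 3" by (cases d) (simp_all add: power3_eq_cube)
  then have bound: "4 * d ^ 3 + 2 * d ^ 3 + d \<le> 7 * d ^ 3" by simp
  have "generic_cond (3 * n) (7 * d ^ 3) (\<lambda>T. good_slice n T ?A \<and> mpoly_eval id (\<lambda>i. T (n + i)) F \<noteq> 0)"
  proof (rule generic_cond_mono[OF generic_cond_conj[OF generic_cond_conj[OF 1 2] generic_nonvanishing[OF F]] bound])
    fix T assume *: "((\<forall>H\<in>?A. box_injective (e H) (slice n id T H)) \<and> (\<forall>p\<in>?A \<times> ?A. G p T)) \<and>
      mpoly_eval id (\<lambda>i. T (n + i)) F \<noteq> 0"
    have irr: "irreducible (slice n id T H)" if H: "H \<in> ?A" for H
    proof (rule slice_irreducible[OF M(1,2,5)[OF H]])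
      show "box_injective (e H) (slice n id T H)" using * H by blast
      obtain K where "F = H * K" using M(6)[OF H] by (rule dvdE)
      moreover have "mpoly_eval id (\<lambda>i. T (n + i)) (H * K) =
          mpoly_eval id (\<lambda>i. T (n + i)) H * mpoly_eval id (\<lambda>i. T (n + i)) K"
        by (rule mpoly_eval_mult) auto
      ultimately show "mpoly_eval id (\<lambda>i. T (n + i)) H \<noteq> 0" using * by auto
    qed
    have "good_slice n T ?A"
    proof
      show "irreducible (slice n id T H)" if "H \<in> ?A" for H using irr that .
      fix H H' assume H: "H \<in> ?A" "H' \<in> ?A" "slice n id T H dvd slice n id T H'"
      then have "\<not> two_point n T H H'" using two_point_not_dvd irr by blast
      moreover have "G (H, H') T" using * H by blast
      ultimately show "\<exists>\<kappa>. \<kappa> \<noteq> 0 \<and> H' = const_poly \<kappa> * H" by (simp add: G_def)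
    qed
    then show "good_slice n T ?A \<and> mpoly_eval id (\<lambda>i. T (n + i)) F \<noteq> 0" using * by blast
  qed
  then show thesis using that cM by blast
qed

text \<open>The equation, scaled to have a coefficient 1, is mapped by \<open>\<phi>\<close> to a
  nonzero rational form. Its value at a rational point is \<open>\<phi>\<close> of the scaled value
  of \<open>W\<close>, so wherever it is nonzero \<open>W\<close> is nonzero too.\<close>

lemma generic_cond_rational:
  assumes "generic_cond m k G"
  shows "\<exists>W D. W \<in> polys m \<and> (W :: rat mpoly) \<noteq> 0 \<and> homogeneous D W \<and> D \<le> k \<and>
    (\<forall>\<tau>. mpoly_eval id \<tau> W \<noteq> 0 \<longrightarrow> G (\<lambda>i. of_rat (\<tau> i)))"
proof -
  obtain \<phi> where "rational_projection \<phi>"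
    using rational_functional by (auto simp: rational_projection_def)
  then interpret rational_projection \<phi> .
  obtain W D where W: "W \<in> polys m" "W \<noteq> 0" "homogeneous D W" "D \<le> k" "\<And>T. mpoly_eval id T W \<noteq> 0 \<Longrightarrow> G T"
    using assms unfolding generic_cond_def by blast
  obtain l where l: "Poly_Mapping.lookup W l \<noteq> 0" using W(2) by (metis lookup_zero poly_mapping_eqI)
  define c where "c = 1 / Poly_Mapping.lookup W l"
  define V where "V = Poly_Mapping.map \<phi> (const_poly c * W)"
  have "Poly_Mapping.lookup V l = 1"
    using l by (simp add: V_def const_poly_mult lookup_map_0 c_def one)
  then have "V \<noteq> 0" by auto
  moreover have "V \<in> polys m" "homogeneous D V"
    unfolding V_def using W by (auto intro!: map_in_polys map_homogeneous homogeneous_const_mult)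
  moreover have "G (\<lambda>i. of_rat (\<tau> i))" if "mpoly_eval id \<tau> V \<noteq> 0" for \<tau>
  proof (rule W(5))
    have "mpoly_eval id (\<lambda>i. of_rat (\<tau> i)) (const_poly c * W) = c * mpoly_eval id (\<lambda>i. of_rat (\<tau> i)) W"
      by (subst mpoly_eval_mult) auto
    then show "mpoly_eval id (\<lambda>i. of_rat (\<tau> i)) W \<noteq> 0" using that unfolding V_def eval_rational by auto
  qed
  ultimately show ?thesis using W(4) by blast
qed

section \<open>Rational planes inside a given hyperplane\<close>

lemma hyperplane_through_three:
  fixes x :: "nat \<Rightarrow> nat \<Rightarrow> 'a::field"
  assumes "n \<ge> 4"
  obtains l where "\<exists>i<n. l i \<noteq> 0" "\<And>b. b < 3 \<Longrightarrow> (\<Sum>i<n. l i * x b i) = 0"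
proof -
  define A where "A = mat n n (\<lambda>(b, i). if b < 3 then x b i else 0)"
  have A: "A \<in> carrier_mat n n" by (simp add: A_def)
  have "det A = 0" unfolding det_def'[OF A]
  proof (intro sum.neutral ballI)
    fix p assume "p \<in> {p. p permutes {0..<n}}"
    then have "p 3 < n" using permutes_in_image[of p "{0..<n}" 3] assms by auto
    \<comment> \<open>The vectors occupy rows 0 to 2, so for \<open>n \<ge> 4\<close> there is a row
      of index 3, and it is zero.\<close>
    then have "A $$ (3, p 3) = 0" using assms by (simp add: A_def)
    then have "\<exists>i\<in>{0..<n}. A $$ (i, p i) = 0" using assms by (intro bexI[of _ 3]) auto
    then have "(\<Prod>i = 0..<n. A $$ (i, p i)) = 0" by (simp add: prod_zero_iff)
    then show "signof p * (\<Prod>i = 0..<n. A $$ (i, p i)) = 0" by simp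
  qed
  then obtain v where v: "v \<in> carrier_vec n" "v \<noteq> 0\<^sub>v n" "A *\<^sub>v v = 0\<^sub>v n"
    using det_0_iff_vec_prod_zero[OF A] by blast
  show thesis
  proof (rule that[of "\<lambda>i. v $ i"])
    show "\<exists>i<n. v $ i \<noteq> 0" using v(1,2) by (metis carrier_vecD eq_vecI index_zero_vec)
    fix b :: nat assume b: "b < 3"
    then have "(A *\<^sub>v v) $ b = (\<Sum>i<n. x b i * v $ i)"
      using assms v(1) by (simp add: A_def scalar_prod_def lessThan_atLeast0)
    then show "(\<Sum>i<n. v $ i * x b i) = 0" using v(3) b assms by (simp add: mult.commute)
  qed
qed

lemma restrict_homogeneous:
  assumes "F \<in> polys n" "homogeneous d F" "A \<in> carrier_mat n (n - 1)"
  shows "homogeneous d (restrict_poly A F)"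
  unfolding restrict_poly_def
  by (rule mpoly_eval_graded[OF assms(1,2)])
    (auto intro!: homogeneous_add homogeneous_mult homogeneous_sum homogeneous_const_mult homogeneous_var
      simp del: One_nat_def)

text \<open>A plane given in the coordinates \<open>A\<close> of the hyperplane is the plane in the
  ambient space spanned by the images of its three vectors, which \<open>\<tau>\<close>
  packs.\<close>

lemma plane_restrict:
  fixes \<tau> :: "nat \<Rightarrow> rat"
  assumes F: "F \<in> polys n" and A: "A \<in> carrier_mat n (n - 1)"
    and y: "\<And>b i. b < 3 \<Longrightarrow> i < n \<Longrightarrow> (\<Sum>j<n - 1. A $$ (i, j) * y b j) = \<tau> (b * n + i)"
  shows "plane id (y 0) (y 1) (y 2) (restrict_poly A F) = slice n id \<tau> F"
proof -
  let ?h = "plane id (y 0) (y 1) (y 2) :: rat mpoly \<Rightarrow> rat poly poly"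
  have h: "comm_ring_hom ?h" by (rule plane_hom[OF id_comm_ring_hom(1)])
  interpret comm_ring_hom ?h by (rule h)
  have h_const: "?h (const_poly c) = [:[:c:]:]" for c
    by (simp add: plane_def line_def)
  have h_var: "?h (var_poly j) = [:[:y 0 j, y 2 j:], [:y 1 j:]:]" for j
    by (simp add: plane_def line_def mpoly_eval_var one_pCons)
  have sum: "(\<Sum>j\<in>I. [:[:a j:]:] * [:[:p j, v j:], [:u j:]:]) = [:[:\<Sum>j\<in>I. a j * p j, \<Sum>j\<in>I. a j * v j:], [:\<Sum>j\<in>I. a j * u j:]:]"
    for I :: "nat set" and a p u v :: "nat \<Rightarrow> rat"
    by (induction I rule: infinite_finite_induct) auto
  have "?h (restrict_poly A F) = mpoly_eval (\<lambda>c. [:[:c:]:]) (\<lambda>i. ?h (\<Sum>j < dim_col A. const_poly (A $$ (i, j)) * var_poly j)) F"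
    unfolding restrict_poly_def hom_mpoly_eval[OF h] h_const ..
  also have "\<dots> = mpoly_eval (\<lambda>c. [:[:c:]:]) (\<lambda>i. [:[:\<tau> i, \<tau> (2 * n + i):], [:\<tau> (n + i):]:]) F"
  proof (rule mpoly_eval_cong[OF F])
    fix i assume "i < n"
    then have "(\<Sum>j<n - 1. A $$ (i, j) * y 0 j) = \<tau> i" "(\<Sum>j<n - 1. A $$ (i, j) * y 1 j) = \<tau> (n + i)"
      "(\<Sum>j<n - 1. A $$ (i, j) * y 2 j) = \<tau> (2 * n + i)"
      using y[of 0 i] y[of 1 i] y[of 2 i] by auto
    then show "?h (\<Sum>j < dim_col A. const_poly (A $$ (i, j)) * var_poly j) = [:[:\<tau> i, \<tau> (2 * n + i):], [:\<tau> (n + i):]:]"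
      using A by (simp only: hom_sum hom_mult h_const h_var sum carrier_matD)
  qed
  finally show ?thesis by (simp add: slice_def plane_def line_def)
qed

text \<open>The three vectors lie on the hyperplane, so they have preimages under any coordinates
  \<open>A\<close>, and a small factor there would restrict to a small factor of the slice.\<close>

lemma restriction_r_irreducibleI:
  fixes F :: "rat mpoly" and \<tau> :: "nat \<Rightarrow> rat"
  assumes F: "F \<in> polys n" "homogeneous d F" "r_irreducible n r F"
    and M: "Poly_Mapping.map of_rat F = const_poly c * prod_mset M" "c \<noteq> 0"
    and good: "good_slice n (\<lambda>i. of_rat (\<tau> i)) (set_mset M)"
    and u: "mpoly_eval id (\<lambda>i. of_rat (\<tau> (n + i)) :: complex) (Poly_Mapping.map of_rat F) \<noteq> 0"
    and l: "\<And>b. b < 3 \<Longrightarrow> (\<Sum>i<n. l $ i * \<tau> (b * n + i)) = 0" "l \<in> carrier_vec n"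
  shows "restriction_r_irreducible n r l F"
  unfolding restriction_r_irreducible_def r_irreducible_def
proof (intro allI impI notI, elim bexE conjE)
  fix A g q
  assume A: "linear_coords n l A" and gq: "g \<in> polys (n - 1)" "q \<in> polys (n - 1)" "restrict_poly A F = g * q"
    "1 \<le> total_degree g" "total_degree g \<le> r"
  have Ac: "A \<in> carrier_mat n (n - 1)"
    and bij: "bij_betw (\<lambda>y. A *\<^sub>v y) (carrier_vec (n - 1)) (hyperplane n l)"
    using A by (auto simp: linear_coords_def)
  have "\<exists>y \<in> carrier_vec (n - 1). A *\<^sub>v y = vec n (\<lambda>i. \<tau> (b * n + i))" if "b < 3" for b
  proof -
    have "vec n (\<lambda>i. \<tau> (b * n + i)) \<in> hyperplane n l"
      using l that by (simp add: hyperplane_def scalar_prod_def lessThan_atLeast0)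
    then show ?thesis using bij unfolding bij_betw_def by (metis imageE)
  qed
  then obtain Y where Y: "\<And>b. b < 3 \<Longrightarrow> Y b \<in> carrier_vec (n - 1)"
    "\<And>b. b < 3 \<Longrightarrow> A *\<^sub>v Y b = vec n (\<lambda>i. \<tau> (b * n + i))" by metis
  have y: "(\<Sum>j<n - 1. A $$ (i, j) * Y b $ j) = \<tau> (b * n + i)" if "b < 3" "i < n" for b i
  proof -
    have "(A *\<^sub>v Y b) $ i = (\<Sum>j<n - 1. A $$ (i, j) * Y b $ j)"
      using Ac Y(1)[OF that(1)] that(2) by (simp add: scalar_prod_def lessThan_atLeast0)
    then show ?thesis using Y(2)[OF that(1)] that(2) by simp
  qed
  define h where "h = (plane id (\<lambda>j. Y 0 $ j) (\<lambda>j. Y 1 $ j) (\<lambda>j. Y 2 $ j) :: rat mpoly \<Rightarrow> rat poly poly)"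
  interpret h: comm_ring_hom h unfolding h_def by (rule plane_hom[OF id_comm_ring_hom(1)])
  have hr: "h (restrict_poly A F) = slice n id \<tau> F"
    unfolding h_def by (rule plane_restrict[OF F(1) Ac, of "\<lambda>b j. Y b $ j"]) (rule y)
  have u': "mpoly_eval id (\<lambda>i. \<tau> (n + i)) F \<noteq> 0"
    using u hom_mpoly_eval[OF of_rat_hom, of id "\<lambda>i. \<tau> (n + i)" F] by (auto simp: mpoly_of_rat_eval)
  have xm: "x_monic d (slice n id \<tau> F)" by (rule slice_x_monic[OF F(1,2) id_comm_ring_hom(1) u'])
  have ab: "slice n id \<tau> F = h g * h q" using hr gq(3) by (simp add: h.hom_mult)
  obtain k k' where kk: "x_monic k (h g)" "x_monic k' (h q)" "k + k' = d"
    using x_monic_factors[of d "h g" "h q"] xm ab by metis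
  have hdeg: "degree (h p) \<le> total_degree p" if "p \<in> polys (n - 1)" for p
    unfolding h_def plane_def line_def
    by (rule mpoly_eval_filtered[OF that order.refl, where P = "\<lambda>d p. degree p \<le> d"])
      (auto intro: degree_add_le order.trans[OF degree_mult_le] add_mono)
  have "slice n id \<tau> F \<noteq> 0" using xm by (auto simp: x_monic_def)
  then have nz: "g * q \<noteq> 0" using hr gq(3) by (metis h.hom_zero)
  \<comment> \<open>Restriction to the plane can only lower the degree of each factor, but total
    degrees and x-degrees both sum to \<open>d\<close>. So \<open>g\<close> keeps its degree, and in
    particular does not become constant.\<close>
  have "total_degree g + total_degree q = d"
    using total_degree_mult[of g q] nz total_degree_homogeneous[OF restrict_homogeneous[OF F(1,2) Ac]] gq(3) by simp
  then have "1 \<le> degree (h g)" "degree (h g) \<le> r"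
    using hdeg[OF gq(1)] hdeg[OF gq(2)] gq(4,5) kk by (auto simp: x_monic_def)
  then show False
    using slice_no_small_factor[OF F M good u' ab] by blast
qed

theorem theorem1p12:
  fixes n :: nat
  assumes "n \<ge> 4"
  shows "\<exists>C::nat. \<forall>(d::nat) (r::nat) (F :: int mpoly).
           r \<ge> 1 \<longrightarrow> F \<in> polys n \<longrightarrow> homogeneous d F \<longrightarrow> r_irreducible n r (rat_poly F) \<longrightarrow>
           (\<exists>D W. dual_hypersurface n D W \<and> D \<le> C * d ^ 3 \<and>
              (\<forall>l \<in> dual_points n - rational_points n W.
                 restriction_r_irreducible n r l (rat_poly F)))"
proof (rule exI[of _ 7], intro allI impI)
  fix d r :: nat and F0 :: "int mpoly"
  assume r: "r \<ge> 1" and F0: "F0 \<in> polys n" "homogeneous d F0" and irr: "r_irreducible n r (rat_poly F0)"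
  define F where "F = rat_poly F0"
  have F: "F \<in> polys n" "homogeneous d F"
    unfolding F_def rat_poly_def using F0 by (auto intro: map_in_polys map_homogeneous)
  \<comment> \<open>The zero polynomial is divisible by a variable, whose degree 1 is at most
    \<open>r\<close>.\<close>
  have "F \<noteq> 0"
  proof
    assume "F = 0"
    then have "rat_poly F0 = var_poly 0 * 0" by (simp add: F_def)
    moreover have "total_degree (var_poly 0 :: rat mpoly) = 1"
      by (rule total_degree_homogeneous[OF homogeneous_var]) (metis var_poly_def lookup_single_eq lookup_zero zero_neq_one)
    moreover have "var_poly 0 \<in> polys n" using assms by (intro var_in_polys) simp
    ultimately show False using irr r unfolding r_irreducible_def by (metis zero_in_polys order.refl)
  qed
  define FC where "FC = (Poly_Mapping.map of_rat F :: complex mpoly)"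
  have FC: "FC \<in> polys n" "homogeneous d FC"
    unfolding FC_def using F by (auto intro: map_in_polys map_homogeneous)
  have "FC \<noteq> 0" using \<open>F \<noteq> 0\<close> map_of_rat_eq_iff[of F 0] comm_ring_hom_zero[OF map_hom[OF of_rat_hom]]
    by (simp add: FC_def)
  obtain c M where M: "FC = const_poly c * prod_mset M" "c \<noteq> 0"
    "generic_cond (3 * n) (7 * d ^ 3) (\<lambda>T. good_slice n T (set_mset M) \<and> mpoly_eval id (\<lambda>i. T (n + i)) FC \<noteq> 0)"
    using generic_good_slice[OF FC \<open>FC \<noteq> 0\<close>] by blast
  from generic_cond_rational[OF M(3)] obtain V D where V: "V \<in> polys (3 * n)" "V \<noteq> 0" "homogeneous D V" "D \<le> 7 * d ^ 3"
    and good: "\<And>\<tau>. mpoly_eval id \<tau> V \<noteq> 0 \<Longrightarrow> good_slice n (\<lambda>i. of_rat (\<tau> i)) (set_mset M) \<and>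
      mpoly_eval id (\<lambda>i. of_rat (\<tau> (n + i))) FC \<noteq> 0" by blast
  obtain \<tau>0 where \<tau>0: "mpoly_eval id \<tau>0 V \<noteq> (0 :: rat)" using mpoly_nonvanishing V by blast
  obtain l0 where l0: "\<exists>i<n. l0 i \<noteq> 0" "\<And>b. b < 3 \<Longrightarrow> (\<Sum>i<n. l0 i * \<tau>0 (b * n + i)) = 0"
    using hyperplane_through_three[OF assms, of "\<lambda>b i. \<tau>0 (b * n + i)"] by blast
  then obtain k where k: "k < n" "l0 k \<noteq> 0" by blast
  \<comment> \<open>A vector whose product with \<open>l0\<close> is 1.\<close>
  define e where "e i = (if i = k then 1 / l0 k else 0)" for i
  define b where "b s = s div n * n" for s :: nat
  \<comment> \<open>Each vector w packed in \<open>\<tau>0\<close> becomes (l.e) w - (l.w) e. This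
    is linear in l, so the degree \<open>D\<close> is kept; it is orthogonal to l; and it equals w
    at \<open>l0\<close>, which keeps \<open>W\<close> from vanishing identically.\<close>
  define L where "L s = const_poly (e k * \<tau>0 s) * var_poly k -
    const_poly (e (s mod n)) * (\<Sum>j<n. const_poly (\<tau>0 (b s + j)) * var_poly j)" for s
  define \<tau> where "\<tau> l s = l k * e k * \<tau>0 s - e (s mod n) * (\<Sum>j<n. l j * \<tau>0 (b s + j))" for l s
  define W where "W = mpoly_eval const_poly L V"
  have "L s \<in> polys n" for s unfolding L_def using k
    by (intro diff_in_polys mult_in_polys sum_in_polys const_in_polys var_in_polys) auto
  moreover have "homogeneous 1 (L s)" for s
    unfolding L_def by (intro homogeneous_diff homogeneous_const_mult homogeneous_sum homogeneous_var)
  ultimately have W: "W \<in> polys n" "homogeneous D W"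
    unfolding W_def using substitute_homogeneous[OF V(1,3), of L n] by auto
  have evW: "mpoly_eval id l W = mpoly_eval id (\<tau> l) V" for l
  proof -
    interpret comm_ring_hom "mpoly_eval id l :: rat mpoly \<Rightarrow> rat" by (rule mpoly_eval_hom[OF id_comm_ring_hom(1)])
    have [simp]: "mpoly_eval id l (const_poly a) = a" "mpoly_eval id l (var_poly j) = l j" for a j
      by (simp_all add: mpoly_eval_var)
    have "mpoly_eval id l (L s) = \<tau> l s" for s
      unfolding L_def \<tau>_def hom_minus hom_mult hom_sum by (simp add: mult.commute mult.left_commute)
    then show ?thesis unfolding W_def eval_substitute by simp
  qed
  have "mpoly_eval id (\<tau> l0) V = mpoly_eval id \<tau>0 V"
  proof (rule mpoly_eval_cong[OF V(1)])
    fix s assume s: "s < 3 * n"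
    then have "s div n < 3" using assms by (simp add: less_mult_imp_div_less)
    then show "\<tau> l0 s = \<tau>0 s" using l0(2)[of "s div n"] k by (simp add: \<tau>_def e_def b_def)
  qed
  then have "W \<noteq> 0" using evW[of l0] \<tau>0 by auto
  then have "dual_hypersurface n D W" using W by (simp add: dual_hypersurface_def)
  moreover have "restriction_r_irreducible n r l (rat_poly F0)" if "l \<in> dual_points n - rational_points n W" for l
  proof -
    have l: "l \<in> carrier_vec n" "mpoly_eval id (\<lambda>i. l $ i) W \<noteq> 0"
      using that by (auto simp: dual_points_def rational_points_def)
    define \<sigma> where "\<sigma> = \<tau> (\<lambda>i. l $ i)"
    have g: "good_slice n (\<lambda>i. of_rat (\<sigma> i)) (set_mset M)" "mpoly_eval id (\<lambda>i. of_rat (\<sigma> (n + i))) FC \<noteq> 0"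
      using good[of \<sigma>] l(2) unfolding evW \<sigma>_def by auto
    have "(\<Sum>i<n. l $ i * \<sigma> (a * n + i)) = 0" if "a < 3" for a
    proof -
      define S where "S = (\<Sum>j<n. l $ j * \<tau>0 (a * n + j))"
      have \<sigma>: "\<sigma> (a * n + i) = l $ k * e k * \<tau>0 (a * n + i) - e i * S" if "i < n" for i
        using that by (simp add: \<sigma>_def \<tau>_def b_def S_def)
      have le: "(\<Sum>i<n. l $ i * e i) = l $ k * e k"
      proof -
        have "(\<Sum>i<n. l $ i * e i) = (\<Sum>i<n. if i = k then l $ k * e k else 0)"
          by (intro sum.cong) (auto simp: e_def)
        then show ?thesis using k by simp
      qed
      have "(\<Sum>i<n. l $ i * \<sigma> (a * n + i)) = (\<Sum>i<n. l $ k * e k * (l $ i * \<tau>0 (a * n + i)) - (l $ i * e i) * S)"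
      proof (intro sum.cong refl)
        fix i assume "i \<in> {..<n}"
        then have "i < n" by simp
        show "l $ i * \<sigma> (a * n + i) = l $ k * e k * (l $ i * \<tau>0 (a * n + i)) - (l $ i * e i) * S"
          unfolding \<sigma>[OF \<open>i < n\<close>] by (simp add: algebra_simps)
      qed
      also have "\<dots> = l $ k * e k * S - (\<Sum>i<n. l $ i * e i) * S"
        unfolding sum_subtractf sum_distrib_left[symmetric] sum_distrib_right[symmetric]
        by (simp only: S_def)
      finally show ?thesis by (simp add: le)
    qed
    then show ?thesis
      using restriction_r_irreducibleI[of F n d r c M \<sigma> l] F irr M(1,2) g l(1)
      unfolding F_def[symmetric] FC_def by blast
  qed
  ultimately show "\<exists>D W. dual_hypersurface n D W \<and> D \<le> 7 * d ^ 3 \<and>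
      (\<forall>l \<in> dual_points n - rational_points n W. restriction_r_irreducible n r l (rat_poly F0))"
    using V(4) by blast
qed

end
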